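(* Let $(M,g_M)$ be a Riemannian manifold of dimension $m>1$ and let $\mathcal{T}_M$ be endowed with the weighted almost-Hermitian structure $(g,J,\omega)$ defined by any positive smooth weights $\mu,\lambda$ depending only on $r(u)=\|u\|_M$. Given any two real functions $f_1,f_2$ on $\mathcal{T}_M$, every real $m$-plane $P$, or $JP$, where $P$ is of the form $$P_{f_1,f_2}=\{f_1x^h+f_2x^v:\ x\in TM\}$$ (that is, at $u\in\mathcal{T}_M$, $x$ ranges over $T_{\pi(u)}M$, and $f_1(u),f_2(u)$ are not both zero), is an $\mathbb{R}$-Lagrangian tangent distribution. In particular, $H^\nabla$ and $V$ are $\mathbb{R}$-Lagrangian distributions, and hence the zero-section and the fibres of $\mathcal{T}_M$ are totally geodesic $\mathbb{R}$-Lagrangian submanifolds of $(\mathcal{T}_M,g,\omega)$.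
   Context: Let $\pi:\mathcal{T}_M\to M$ be the total space of the tangent bundle and $\nabla$ the Levi-Civita connection of $g_M$. It induces a splitting $T\mathcal{T}_M=H^\nabla\oplus V$ into horizontal and vertical ($V=\ker\mathrm{d}\pi$) sub-bundles, each canonically isomorphic to $\pi^*TM$. For $u\in\mathcal{T}_M$ and $w\in T_{\pi(u)}M$, denote by $w^h\in H^\nabla_u$ and $w^v\in V_u$ the horizontal and vertical lifts. The metric $g$ makes $H^\nabla$ and $V$ orthogonal and satisfies $g(w^h,z^h)=\mu^2g_M(w,z)$, $g(w^v,z^v)=\lambda^2g_M(w,z)$. The almost-complex structure is $J(w^h)=\frac{\mu}{\lambda}w^v$, $J(w^v)=-\frac{\lambda}{\mu}w^h$, and $\omega(X,Y)=g(JX,Y)$. A distribution (or submanifold) of real rank (dimension) $m$ is called $\mathbb{R}$-Lagrangian if $\omega$ vanishes identically on it; $\omega$ is not required to be closed. *)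

theory Defs
  imports "HOL-Analysis.Analysis" "HOL-Library.Function_Algebras"
begin

section \<open>Pointwise real vector space structure on functions\<close>

text \<open>Tangent vectors are encoded below as functions from charts to coordinate vectors; this
  instance makes \<^term>\<open>subspace\<close>, \<^term>\<open>span\<close> and \<^term>\<open>dim\<close> available for them.\<close>

instantiation "fun" :: (type, scaleR) scaleR
begin
definition scaleR_fun :: "real \<Rightarrow> ('a \<Rightarrow> 'b) \<Rightarrow> 'a \<Rightarrow> 'b"
  where "scaleR_fun a f = (\<lambda>x. a *\<^sub>R f x)"
instance ..
end

instance "fun" :: (type, real_vector) real_vector
  by standard (auto simp: scaleR_fun_def plus_fun_def fun_eq_iff algebra_simps)


section \<open>Smooth maps between open subsets of normed spaces\<close>

primrec Ck_on :: "nat \<Rightarrow> 'n::real_normed_vector set \<Rightarrow> ('n \<Rightarrow> 'b::real_normed_vector) \<Rightarrow> bool"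
  where
    "Ck_on 0 S f \<longleftrightarrow> continuous_on S f"
  | "Ck_on (Suc k) S f \<longleftrightarrow> (\<forall>x\<in>S. f differentiable (at x)) \<and>
       (\<forall>v. Ck_on k S (\<lambda>x. frechet_derivative f (at x) v))"

definition smooth_on :: "'n::real_normed_vector set \<Rightarrow> ('n \<Rightarrow> 'b::real_normed_vector) \<Rightarrow> bool"
  where "smooth_on S f \<longleftrightarrow> (\<forall>k. Ck_on k S f)"


section \<open>Smooth manifolds\<close>

text \<open>A manifold is given by an atlas. A chart is a pair \<open>(U, \<phi>)\<close>; only the values of \<open>\<phi>\<close> on \<open>U\<close>
  are relevant. The model space is a Euclidean space, so the dimension of the manifold is the one
  of the model. The underlying set is the union of the chart domains, and it carries the topology
  induced by the charts.\<close>

type_synonym ('a, 'n) chart = "'a set \<times> ('a \<Rightarrow> 'n)"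
type_synonym ('a, 'n) atlas = "('a, 'n) chart set"
type_synonym ('a, 'n) tvec = "('a, 'n) chart \<Rightarrow> 'n"

definition chart_inv :: "('a, 'n) chart \<Rightarrow> 'n \<Rightarrow> 'a"
  where "chart_inv c = inv_into (fst c) (snd c)"

definition mcarrier :: "('a, 'n) atlas \<Rightarrow> 'a set"
  where "mcarrier A = (\<Union>c\<in>A. fst c)"

definition is_chart :: "('a, 'n::euclidean_space) chart \<Rightarrow> bool"
  where "is_chart c \<longleftrightarrow> inj_on (snd c) (fst c) \<and> open (snd c ` fst c)"

definition smooth_transition :: "('a, 'n::euclidean_space) chart \<Rightarrow> ('a, 'n) chart \<Rightarrow> bool"
  where "smooth_transition c d \<longleftrightarrow>
    open (snd c ` (fst c \<inter> fst d)) \<and> smooth_on (snd c ` (fst c \<inter> fst d)) (snd d \<circ> chart_inv c)"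

definition mopen :: "('a, 'n::euclidean_space) atlas \<Rightarrow> 'a set \<Rightarrow> bool"
  where "mopen A W \<longleftrightarrow> W \<subseteq> mcarrier A \<and> (\<forall>c\<in>A. open (snd c ` (W \<inter> fst c)))"

definition smooth_manifold :: "('a, 'n::euclidean_space) atlas \<Rightarrow> bool"
  where "smooth_manifold A \<longleftrightarrow>
    (\<forall>c\<in>A. is_chart c) \<and> (\<forall>c\<in>A. \<forall>d\<in>A. smooth_transition c d) \<and>
    Hausdorff_space (topology (mopen A)) \<and>
    (\<exists>\<B>. countable \<B> \<and> (\<forall>V\<in>\<B>. mopen A V) \<and>
      (\<forall>W p. mopen A W \<longrightarrow> p \<in> W \<longrightarrow> (\<exists>V\<in>\<B>. p \<in> V \<and> V \<subseteq> W)))"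

text \<open>Charts of the maximal atlas.\<close>

definition maximal_chart :: "('a, 'n::euclidean_space) atlas \<Rightarrow> ('a, 'n) chart \<Rightarrow> bool"
  where "maximal_chart A c \<longleftrightarrow> is_chart c \<and> fst c \<subseteq> mcarrier A \<and>
    (\<forall>d\<in>A. smooth_transition c d \<and> smooth_transition d c)"

definition smooth_fun ::
    "('a, 'n::euclidean_space) atlas \<Rightarrow> 'a set \<Rightarrow> ('a \<Rightarrow> 'b::real_normed_vector) \<Rightarrow> bool"
  where "smooth_fun A W f \<longleftrightarrow> (\<forall>c\<in>A. smooth_on (snd c ` (W \<inter> fst c)) (f \<circ> chart_inv c))"


section \<open>Tangent vectors\<close>

text \<open>A tangent vector at \<open>p\<close> is the family of its coordinate vectors in all charts around \<open>p\<close>,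
  related by the derivatives of the transition maps (and set to 0 for all other arguments).\<close>

definition tangent_space :: "('a, 'n::euclidean_space) atlas \<Rightarrow> 'a \<Rightarrow> ('a, 'n) tvec set"
  where "tangent_space A p = {v.
    (\<forall>c. \<not> (c \<in> A \<and> p \<in> fst c) \<longrightarrow> v c = 0) \<and>
    (\<forall>c\<in>A. \<forall>d\<in>A. p \<in> fst c \<inter> fst d \<longrightarrow>
      v d = frechet_derivative (snd d \<circ> chart_inv c) (at (snd c p)) (v c))}"

definition dir_deriv ::
    "('a, 'n::euclidean_space) atlas \<Rightarrow> ('a \<Rightarrow> 'b::real_normed_vector) \<Rightarrow> 'a \<Rightarrow> ('a, 'n) tvec \<Rightarrow> 'b"
  where "dir_deriv A f p v = (let c = (SOME c. c \<in> A \<and> p \<in> fst c) in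
    frechet_derivative (f \<circ> chart_inv c) (at (snd c p)) (v c))"

definition differential ::
    "('a, 'n::euclidean_space) atlas \<Rightarrow> ('b, 'k::euclidean_space) atlas \<Rightarrow> ('a \<Rightarrow> 'b) \<Rightarrow>
     'a \<Rightarrow> ('a, 'n) tvec \<Rightarrow> ('b, 'k) tvec"
  where "differential A B F p v =
    (\<lambda>d. if d \<in> B \<and> F p \<in> fst d then dir_deriv A (snd d \<circ> F) p v else 0)"

definition velocity :: "('a, 'n::euclidean_space) atlas \<Rightarrow> (real \<Rightarrow> 'a) \<Rightarrow> real \<Rightarrow> ('a, 'n) tvec"
  where "velocity A \<gamma> t =
    (\<lambda>c. if c \<in> A \<and> \<gamma> t \<in> fst c then vector_derivative (snd c \<circ> \<gamma>) (at t) else 0)"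

definition smooth_curve :: "('a, 'n::euclidean_space) atlas \<Rightarrow> real set \<Rightarrow> (real \<Rightarrow> 'a) \<Rightarrow> bool"
  where "smooth_curve A I \<gamma> \<longleftrightarrow> \<gamma> ` I \<subseteq> mcarrier A \<and>
    (\<forall>c\<in>A. open {t\<in>I. \<gamma> t \<in> fst c} \<and> smooth_on {t\<in>I. \<gamma> t \<in> fst c} (snd c \<circ> \<gamma>))"

text \<open>Vector fields over an open set \<open>W\<close>; values outside \<open>W\<close> are irrelevant.\<close>

definition smooth_vector_field ::
    "('a, 'n::euclidean_space) atlas \<Rightarrow> 'a set \<Rightarrow> ('a \<Rightarrow> ('a, 'n) tvec) \<Rightarrow> bool"
  where "smooth_vector_field A W X \<longleftrightarrow>
    (\<forall>p\<in>W. X p \<in> tangent_space A p) \<and>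
    (\<forall>c\<in>A. smooth_on (snd c ` (W \<inter> fst c)) (\<lambda>x. X (chart_inv c x) c))"

definition lie_bracket ::
    "('a, 'n::euclidean_space) atlas \<Rightarrow> ('a \<Rightarrow> ('a, 'n) tvec) \<Rightarrow> ('a \<Rightarrow> ('a, 'n) tvec) \<Rightarrow>
     'a \<Rightarrow> ('a, 'n) tvec"
  where "lie_bracket A X Y p =
    (\<lambda>c. if c \<in> A \<and> p \<in> fst c
         then dir_deriv A (\<lambda>q. Y q c) p (X p) - dir_deriv A (\<lambda>q. X q c) p (Y p) else 0)"


section \<open>Riemannian metrics and the Levi-Civita connection\<close>

definition riemannian_metric ::
    "('a, 'n::euclidean_space) atlas \<Rightarrow> ('a \<Rightarrow> ('a, 'n) tvec \<Rightarrow> ('a, 'n) tvec \<Rightarrow> real) \<Rightarrow> bool"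
  where "riemannian_metric A g \<longleftrightarrow>
    (\<forall>p\<in>mcarrier A. \<forall>v\<in>tangent_space A p. \<forall>w\<in>tangent_space A p.
      g p v w = g p w v \<and> (v \<noteq> 0 \<longrightarrow> g p v v > 0) \<and>
      (\<forall>a. g p (a *\<^sub>R v) w = a * g p v w) \<and>
      (\<forall>v'\<in>tangent_space A p. g p (v + v') w = g p v w + g p v' w)) \<and>
    (\<forall>W X Y. mopen A W \<longrightarrow> smooth_vector_field A W X \<longrightarrow> smooth_vector_field A W Y \<longrightarrow>
      smooth_fun A W (\<lambda>p. g p (X p) (Y p)))"

text \<open>An affine connection, as an operator on vector fields over open sets. Since the operator is
  applied to total functions, its compatibility with restrictions is part of the definition.\<close>

definition affine_connection ::
    "('a, 'n::euclidean_space) atlas \<Rightarrow>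
     (('a \<Rightarrow> ('a, 'n) tvec) \<Rightarrow> ('a \<Rightarrow> ('a, 'n) tvec) \<Rightarrow> 'a \<Rightarrow> ('a, 'n) tvec) \<Rightarrow> bool"
  where "affine_connection A D \<longleftrightarrow>
    (\<forall>W X X' Y Y' f. mopen A W \<longrightarrow>
      smooth_vector_field A W X \<longrightarrow> smooth_vector_field A W X' \<longrightarrow>
      smooth_vector_field A W Y \<longrightarrow> smooth_vector_field A W Y' \<longrightarrow>
      smooth_fun A W (f :: 'a \<Rightarrow> real) \<longrightarrow>
      smooth_vector_field A W (D X Y) \<and>
      ((\<forall>q\<in>W. X q = X' q \<and> Y q = Y' q) \<longrightarrow> (\<forall>p\<in>W. D X Y p = D X' Y' p)) \<and>
      (\<forall>p\<in>W.
        D (\<lambda>q. X q + X' q) Y p = D X Y p + D X' Y p \<and>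
        D (\<lambda>q. f q *\<^sub>R X q) Y p = f p *\<^sub>R D X Y p \<and>
        D X (\<lambda>q. Y q + Y' q) p = D X Y p + D X Y' p \<and>
        D X (\<lambda>q. f q *\<^sub>R Y q) p = dir_deriv A f p (X p) *\<^sub>R Y p + f p *\<^sub>R D X Y p))"

definition levi_civita ::
    "('a, 'n::euclidean_space) atlas \<Rightarrow> ('a \<Rightarrow> ('a, 'n) tvec \<Rightarrow> ('a, 'n) tvec \<Rightarrow> real) \<Rightarrow>
     (('a \<Rightarrow> ('a, 'n) tvec) \<Rightarrow> ('a \<Rightarrow> ('a, 'n) tvec) \<Rightarrow> 'a \<Rightarrow> ('a, 'n) tvec) \<Rightarrow> bool"
  where "levi_civita A g D \<longleftrightarrow> affine_connection A D \<and>
    (\<forall>W X Y Z. mopen A W \<longrightarrow> smooth_vector_field A W X \<longrightarrow> smooth_vector_field A W Y \<longrightarrow>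
      smooth_vector_field A W Z \<longrightarrow>
      (\<forall>p\<in>W. D X Y p - D Y X p = lie_bracket A X Y p \<and>
        dir_deriv A (\<lambda>q. g q (Y q) (Z q)) p (X p) = g p (D X Y p) (Z p) + g p (Y p) (D X Z p)))"


section \<open>Distributions and submanifolds\<close>

definition plane_field ::
    "('a, 'n::euclidean_space) atlas \<Rightarrow> nat \<Rightarrow> ('a \<Rightarrow> ('a, 'n) tvec set) \<Rightarrow> bool"
  where "plane_field A k P \<longleftrightarrow>
    (\<forall>p\<in>mcarrier A. P p \<subseteq> tangent_space A p \<and> subspace (P p) \<and> dim (P p) = k)"

definition distribution ::
    "('a, 'n::euclidean_space) atlas \<Rightarrow> nat \<Rightarrow> ('a \<Rightarrow> ('a, 'n) tvec set) \<Rightarrow> bool"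
  where "distribution A k P \<longleftrightarrow> plane_field A k P \<and>
    (\<forall>p\<in>mcarrier A. \<exists>W X. mopen A W \<and> p \<in> W \<and>
      (\<forall>i<k. smooth_vector_field A W (X i)) \<and>
      (\<forall>q\<in>W. P q = span ((\<lambda>i. X i q) ` {..<k})))"

definition embedded_submanifold ::
    "('a, 'n::euclidean_space) atlas \<Rightarrow> nat \<Rightarrow> 'a set \<Rightarrow> bool"
  where "embedded_submanifold A k N \<longleftrightarrow> N \<subseteq> mcarrier A \<and>
    (\<forall>p\<in>N. \<exists>c S. maximal_chart A c \<and> p \<in> fst c \<and> subspace S \<and> dim S = k \<and>
      snd c ` (fst c \<inter> N) = {x \<in> snd c ` fst c. x - snd c p \<in> S})"

definition submanifold_tangent ::
    "('a, 'n::euclidean_space) atlas \<Rightarrow> 'a set \<Rightarrow> 'a \<Rightarrow> ('a, 'n) tvec set"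
  where "submanifold_tangent A N p = {velocity A \<gamma> 0 | \<gamma> e. e > 0 \<and>
    smooth_curve A {-e<..<e} \<gamma> \<and> \<gamma> 0 = p \<and> \<gamma> ` {-e<..<e} \<subseteq> N}"

text \<open>Vanishing of the second fundamental form: for the Levi-Civita connection \<open>D\<close> of the ambient
  metric, \<open>D X Y\<close> has no normal component along \<open>N\<close> whenever \<open>X\<close> and \<open>Y\<close> are tangent to \<open>N\<close>
  along \<open>N\<close>. The quantifier over \<open>D\<close> ranges over a connection that exists and is unique (up to
  irrelevant values on non-smooth arguments) whenever \<open>g\<close> is a Riemannian metric.\<close>

definition totally_geodesic ::
    "('a, 'n::euclidean_space) atlas \<Rightarrow> ('a \<Rightarrow> ('a, 'n) tvec \<Rightarrow> ('a, 'n) tvec \<Rightarrow> real) \<Rightarrow>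
     'a set \<Rightarrow> bool"
  where "totally_geodesic A g N \<longleftrightarrow>
    (\<forall>D. levi_civita A g D \<longrightarrow>
      (\<forall>W X Y. mopen A W \<longrightarrow> smooth_vector_field A W X \<longrightarrow> smooth_vector_field A W Y \<longrightarrow>
        (\<forall>q\<in>W \<inter> N. X q \<in> submanifold_tangent A N q \<and> Y q \<in> submanifold_tangent A N q) \<longrightarrow>
        (\<forall>q\<in>W \<inter> N. D X Y q \<in> submanifold_tangent A N q)))"

definition vanishes_on ::
    "('a \<Rightarrow> ('a, 'n) tvec \<Rightarrow> ('a, 'n) tvec \<Rightarrow> real) \<Rightarrow> 'a set \<Rightarrow> ('a \<Rightarrow> ('a, 'n) tvec set) \<Rightarrow> bool"
  where "vanishes_on om N P \<longleftrightarrow> (\<forall>p\<in>N. \<forall>X\<in>P p. \<forall>Y\<in>P p. om p X Y = 0)"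

text \<open>In the \<open>\<real>\<close>-Lagrangian notions, \<open>2 * m\<close> is the dimension of the ambient manifold. The first
  one makes sense for plane fields without any regularity.\<close>

definition R_Lagrangian_plane_field ::
    "('a, 'n::euclidean_space) atlas \<Rightarrow> ('a \<Rightarrow> ('a, 'n) tvec \<Rightarrow> ('a, 'n) tvec \<Rightarrow> real) \<Rightarrow> nat \<Rightarrow>
     ('a \<Rightarrow> ('a, 'n) tvec set) \<Rightarrow> bool"
  where "R_Lagrangian_plane_field A om m P \<longleftrightarrow>
    2 * m = DIM('n) \<and> plane_field A m P \<and> vanishes_on om (mcarrier A) P"

definition R_Lagrangian_distribution ::
    "('a, 'n::euclidean_space) atlas \<Rightarrow> ('a \<Rightarrow> ('a, 'n) tvec \<Rightarrow> ('a, 'n) tvec \<Rightarrow> real) \<Rightarrow> nat \<Rightarrow>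
     ('a \<Rightarrow> ('a, 'n) tvec set) \<Rightarrow> bool"
  where "R_Lagrangian_distribution A om m P \<longleftrightarrow>
    2 * m = DIM('n) \<and> distribution A m P \<and> vanishes_on om (mcarrier A) P"

definition R_Lagrangian_submanifold ::
    "('a, 'n::euclidean_space) atlas \<Rightarrow> ('a \<Rightarrow> ('a, 'n) tvec \<Rightarrow> ('a, 'n) tvec \<Rightarrow> real) \<Rightarrow> nat \<Rightarrow>
     'a set \<Rightarrow> bool"
  where "R_Lagrangian_submanifold A om m N \<longleftrightarrow>
    2 * m = DIM('n) \<and> embedded_submanifold A m N \<and> vanishes_on om N (submanifold_tangent A N)"


section \<open>The total space of the tangent bundle\<close>

type_synonym ('a, 'n) tpoint = "'a \<times> ('a, 'n) tvec"

definition TM :: "('a, 'n::euclidean_space) atlas \<Rightarrow> ('a, 'n) tpoint set"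
  where "TM A = Sigma (mcarrier A) (tangent_space A)"

definition tangent_chart ::
    "('a, 'n::euclidean_space) atlas \<Rightarrow> ('a, 'n) chart \<Rightarrow> (('a, 'n) tpoint, 'n \<times> 'n) chart"
  where "tangent_chart A c = ({u \<in> TM A. fst u \<in> fst c}, \<lambda>u. (snd c (fst u), snd u c))"

definition tangent_atlas ::
    "('a, 'n::euclidean_space) atlas \<Rightarrow> (('a, 'n) tpoint, 'n \<times> 'n) atlas"
  where "tangent_atlas A = tangent_chart A ` A"

definition zero_section :: "('a, 'n::euclidean_space) atlas \<Rightarrow> ('a, 'n) tpoint set"
  where "zero_section A = (\<lambda>p. (p, 0)) ` mcarrier A"

definition tangent_fibre :: "('a, 'n::euclidean_space) atlas \<Rightarrow> 'a \<Rightarrow> ('a, 'n) tpoint set"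
  where "tangent_fibre A p = {p} \<times> tangent_space A p"

definition vertical ::
    "('a, 'n::euclidean_space) atlas \<Rightarrow> ('a, 'n) tpoint \<Rightarrow> (('a, 'n) tpoint, 'n \<times> 'n) tvec set"
  where "vertical A u =
    {\<xi> \<in> tangent_space (tangent_atlas A) u. differential (tangent_atlas A) A fst u \<xi> = 0}"

text \<open>The horizontal space at \<open>u\<close> of a connection \<open>D\<close>: all images \<open>dY(w)\<close> of tangent vectors \<open>w\<close>
  under local sections \<open>Y\<close> through \<open>u\<close> with \<open>D\<^sub>w Y = 0\<close>, where \<open>w\<close> is the value of \<open>X\<close>.\<close>

definition horizontal ::
    "('a, 'n::euclidean_space) atlas \<Rightarrow>
     (('a \<Rightarrow> ('a, 'n) tvec) \<Rightarrow> ('a \<Rightarrow> ('a, 'n) tvec) \<Rightarrow> 'a \<Rightarrow> ('a, 'n) tvec) \<Rightarrow>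
     ('a, 'n) tpoint \<Rightarrow> (('a, 'n) tpoint, 'n \<times> 'n) tvec set"
  where "horizontal A D u =
    {differential A (tangent_atlas A) (\<lambda>q. (q, Y q)) (fst u) (X (fst u)) | W X Y.
      mopen A W \<and> fst u \<in> W \<and> smooth_vector_field A W X \<and> smooth_vector_field A W Y \<and>
      Y (fst u) = snd u \<and> D X Y (fst u) = 0}"

definition hlift ::
    "('a, 'n::euclidean_space) atlas \<Rightarrow>
     (('a \<Rightarrow> ('a, 'n) tvec) \<Rightarrow> ('a \<Rightarrow> ('a, 'n) tvec) \<Rightarrow> 'a \<Rightarrow> ('a, 'n) tvec) \<Rightarrow>
     ('a, 'n) tpoint \<Rightarrow> ('a, 'n) tvec \<Rightarrow> (('a, 'n) tpoint, 'n \<times> 'n) tvec"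
  where "hlift A D u w =
    (THE \<xi>. \<xi> \<in> horizontal A D u \<and> differential (tangent_atlas A) A fst u \<xi> = w)"

definition vlift ::
    "('a, 'n::euclidean_space) atlas \<Rightarrow> ('a, 'n) tpoint \<Rightarrow> ('a, 'n) tvec \<Rightarrow>
     (('a, 'n) tpoint, 'n \<times> 'n) tvec"
  where "vlift A u w = velocity (tangent_atlas A) (\<lambda>t. (fst u, snd u + t *\<^sub>R w)) 0"


section \<open>The weighted almost-Hermitian structure\<close>

definition tnorm ::
    "('a \<Rightarrow> ('a, 'n) tvec \<Rightarrow> ('a, 'n) tvec \<Rightarrow> real) \<Rightarrow> ('a, 'n) tpoint \<Rightarrow> real"
  where "tnorm g u = sqrt (g (fst u) (snd u) (snd u))"

definition radial_weight ::
    "('a, 'n::euclidean_space) atlas \<Rightarrow> ('a \<Rightarrow> ('a, 'n) tvec \<Rightarrow> ('a, 'n) tvec \<Rightarrow> real) \<Rightarrow>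
     (('a, 'n) tpoint \<Rightarrow> real) \<Rightarrow> bool"
  where "radial_weight A g h \<longleftrightarrow> smooth_fun (tangent_atlas A) (TM A) h \<and>
    (\<forall>u\<in>TM A. h u > 0) \<and> (\<exists>k. \<forall>u\<in>TM A. h u = k (tnorm g u))"

definition weighted_metric ::
    "('a, 'n::euclidean_space) atlas \<Rightarrow> ('a \<Rightarrow> ('a, 'n) tvec \<Rightarrow> ('a, 'n) tvec \<Rightarrow> real) \<Rightarrow>
     (('a \<Rightarrow> ('a, 'n) tvec) \<Rightarrow> ('a \<Rightarrow> ('a, 'n) tvec) \<Rightarrow> 'a \<Rightarrow> ('a, 'n) tvec) \<Rightarrow>
     (('a, 'n) tpoint \<Rightarrow> real) \<Rightarrow> (('a, 'n) tpoint \<Rightarrow> real) \<Rightarrow>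
     (('a, 'n) tpoint \<Rightarrow> (('a, 'n) tpoint, 'n \<times> 'n) tvec \<Rightarrow>
       (('a, 'n) tpoint, 'n \<times> 'n) tvec \<Rightarrow> real) \<Rightarrow> bool"
  where "weighted_metric A gM D mu lam g \<longleftrightarrow> riemannian_metric (tangent_atlas A) g \<and>
    (\<forall>u\<in>TM A.
      (\<forall>\<xi>\<in>horizontal A D u. \<forall>\<eta>\<in>vertical A u. g u \<xi> \<eta> = 0) \<and>
      (\<forall>w\<in>tangent_space A (fst u). \<forall>z\<in>tangent_space A (fst u).
        g u (hlift A D u w) (hlift A D u z) = (mu u)\<^sup>2 * gM (fst u) w z \<and>
        g u (vlift A u w) (vlift A u z) = (lam u)\<^sup>2 * gM (fst u) w z))"

definition weighted_complex_structure ::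
    "('a, 'n::euclidean_space) atlas \<Rightarrow>
     (('a \<Rightarrow> ('a, 'n) tvec) \<Rightarrow> ('a \<Rightarrow> ('a, 'n) tvec) \<Rightarrow> 'a \<Rightarrow> ('a, 'n) tvec) \<Rightarrow>
     (('a, 'n) tpoint \<Rightarrow> real) \<Rightarrow> (('a, 'n) tpoint \<Rightarrow> real) \<Rightarrow>
     (('a, 'n) tpoint \<Rightarrow> (('a, 'n) tpoint, 'n \<times> 'n) tvec \<Rightarrow>
       (('a, 'n) tpoint, 'n \<times> 'n) tvec) \<Rightarrow> bool"
  where "weighted_complex_structure A D mu lam J \<longleftrightarrow>
    (\<forall>u\<in>TM A.
      (\<forall>\<xi>\<in>tangent_space (tangent_atlas A) u.
        J u \<xi> \<in> tangent_space (tangent_atlas A) u \<and>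
        (\<forall>a. J u (a *\<^sub>R \<xi>) = a *\<^sub>R J u \<xi>) \<and>
        (\<forall>\<eta>\<in>tangent_space (tangent_atlas A) u. J u (\<xi> + \<eta>) = J u \<xi> + J u \<eta>)) \<and>
      (\<forall>w\<in>tangent_space A (fst u).
        J u (hlift A D u w) = (mu u / lam u) *\<^sub>R vlift A u w \<and>
        J u (vlift A u w) = - ((lam u / mu u) *\<^sub>R hlift A D u w)))"

definition fundamental_form ::
    "('b \<Rightarrow> ('b, 'k) tvec \<Rightarrow> ('b, 'k) tvec \<Rightarrow> real) \<Rightarrow> ('b \<Rightarrow> ('b, 'k) tvec \<Rightarrow> ('b, 'k) tvec) \<Rightarrow>
     'b \<Rightarrow> ('b, 'k) tvec \<Rightarrow> ('b, 'k) tvec \<Rightarrow> real"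
  where "fundamental_form g J u X Y = g u (J u X) Y"

definition mixed_plane ::
    "('a, 'n::euclidean_space) atlas \<Rightarrow>
     (('a \<Rightarrow> ('a, 'n) tvec) \<Rightarrow> ('a \<Rightarrow> ('a, 'n) tvec) \<Rightarrow> 'a \<Rightarrow> ('a, 'n) tvec) \<Rightarrow>
     (('a, 'n) tpoint \<Rightarrow> real) \<Rightarrow> (('a, 'n) tpoint \<Rightarrow> real) \<Rightarrow>
     ('a, 'n) tpoint \<Rightarrow> (('a, 'n) tpoint, 'n \<times> 'n) tvec set"
  where "mixed_plane A D f1 f2 u =
    {f1 u *\<^sub>R hlift A D u x + f2 u *\<^sub>R vlift A u x | x. x \<in> tangent_space A (fst u)}"

end

theory Submission
  imports Defs
begin

text \<open>In a chart \<open>(x, y)\<close> of the total space a tangent vector \<open>(s, t)\<close> has horizontal part \<open>s\<close> and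
  vertical part \<open>t + \<Gamma>\<^sub>x(s, y)\<close>, so \<open>P\<close> is spanned by the vectors \<open>(f\<^sub>1 v, f\<^sub>2 v - f\<^sub>1 \<Gamma>\<^sub>x(v, y))\<close>;
  that \<open>\<omega>\<close> vanishes on \<open>P\<close> is the symmetry of \<open>g\<^sub>M\<close>, and \<open>J\<close> maps \<open>P\<close> to another plane of the
  same form. Fibres and zero section are coordinate subspaces \<open>S\<close> in these charts, hence totally
  geodesic as soon as the Christoffel symbols of \<open>g\<close> map \<open>S \<times> S\<close> to \<open>S\<close>. By Koszul's formula this
  reduces to two facts about the weights: their derivative vanishes in horizontal directions (parallel
  transport preserves the norm), which handles the fibres, and at the zero section it vanishes in
  vertical directions (they are even on each fibre), which handles the zero section.\<close>

section \<open>Calculus of smooth maps\<close>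

text \<open>The notions are intrinsic: a tangent vector is a family over all charts, a connection
  acts on fields over open sets, horizontal vectors come from parallel sections, horizontal lifts
  from a definite description. Each has to be shown to be determined by its value in one arbitrary
  chart; as connections act on local fields, coordinate frames over a chart domain suffice and no
  cut-off functions enter. The shaping obstacle is that a radial weight is smooth on the total space
  but given as \<open>k\<close> of the norm for an arbitrary function \<open>k\<close>. Koszul's
  formula is tested against a single vector: the horizontal vector over the unwanted base component
  for fibres, the unwanted fibre component for the zero section. The pairing is then a positive
  factor times the squared length of that component, so its vanishing kills the component.\<close>

lemma sum_fun_apply: "(\<Sum>i\<in>I. f i) x = (\<Sum>i\<in>I. f i x)"
  by (induction I rule: infinite_finite_induct) auto

lemma Ck_on_subset: "Ck_on k S f \<Longrightarrow> T \<subseteq> S \<Longrightarrow> Ck_on k T f"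
  by (induction k arbitrary: f) (auto intro: continuous_on_subset)

lemma has_derivative_imp_frechet: "(f has_derivative f') (at x) \<Longrightarrow> frechet_derivative f (at x) = f'"
  by (rule frechet_derivative_at[symmetric])

text \<open>\<open>frechet_derivative\<close> is a choice among all derivatives. Both functions
  admit the same derivatives at \<open>x\<close>, so the choices coincide even where none
  exists.\<close>

lemma eq_on_open_frechet:
  assumes "open S" "x \<in> S" "\<And>y. y \<in> S \<Longrightarrow> f y = g y"
  shows "(f has_derivative f') (at x) \<longleftrightarrow> (g has_derivative f') (at x)"
    and "frechet_derivative f (at x) = frechet_derivative g (at x)"
proof -
  have *: "(f has_derivative d) (at x) \<longleftrightarrow> (g has_derivative d) (at x)" for d
    using has_derivative_transform_within_open[OF _ assms(1,2), of f d UNIV g]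
      has_derivative_transform_within_open[OF _ assms(1,2), of g d UNIV f] assms(3) by auto
  then show "(f has_derivative f') (at x) \<longleftrightarrow> (g has_derivative f') (at x)" by blast
  show "frechet_derivative f (at x) = frechet_derivative g (at x)"
    unfolding frechet_derivative_def using * by simp
qed

text \<open>Derivatives in \<open>Ck_on\<close> are taken in full neighbourhoods, so equality on
  \<open>S\<close> passes to them because \<open>S\<close> is open.\<close>

lemma Ck_on_cong:
  assumes "open S" "\<And>x. x \<in> S \<Longrightarrow> f x = g x"
  shows "Ck_on k S f \<longleftrightarrow> Ck_on k S g"
  using assms(2)
proof (induction k arbitrary: f g)
  case 0
  then show ?case using continuous_on_cong by force
next
  case (Suc k)
  have 1: "frechet_derivative f (at x) = frechet_derivative g (at x)" if "x \<in> S" for x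
    using eq_on_open_frechet(2)[OF assms(1) that] Suc.prems by blast
  have "f differentiable (at x) \<longleftrightarrow> g differentiable (at x)" if "x \<in> S" for x
    unfolding differentiable_def using eq_on_open_frechet(1)[OF assms(1) that] Suc.prems by blast
  moreover have "Ck_on k S (\<lambda>x. frechet_derivative f (at x) v) \<longleftrightarrow>
      Ck_on k S (\<lambda>x. frechet_derivative g (at x) v)" for v
    using 1 by (intro Suc.IH) simp
  ultimately show ?case unfolding Ck_on.simps by blast
qed

text \<open>Lets an explicit formula for the derivative replace the chosen one; all closure rules
  below argue by induction on the order through it.\<close>

lemma Ck_on_SucI:
  assumes "open S" "\<And>x. x \<in> S \<Longrightarrow> (f has_derivative f' x) (at x)"
    and "\<And>v. Ck_on k S (\<lambda>x. f' x v)"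
  shows "Ck_on (Suc k) S f"
proof -
  have "Ck_on k S (\<lambda>x. frechet_derivative f (at x) v) \<longleftrightarrow> Ck_on k S (\<lambda>x. f' x v)" for v
    using has_derivative_imp_frechet[OF assms(2)] by (intro Ck_on_cong assms(1)) metis
  then show ?thesis using assms by (auto simp: differentiable_def)
qed

lemma Ck_on_SucD:
  assumes "Ck_on (Suc k) S f"
  shows "x \<in> S \<Longrightarrow> (f has_derivative frechet_derivative f (at x)) (at x)"
    and "Ck_on k S (\<lambda>x. frechet_derivative f (at x) v)"
  using assms frechet_derivative_works by auto

lemma Ck_on_Suc_imp: "Ck_on (Suc k) S f \<Longrightarrow> Ck_on k S f"
proof (induction k arbitrary: f)
  case 0
  then show ?case
    by (simp add: differentiable_imp_continuous_on differentiable_at_imp_differentiable_on)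
next
  case (Suc k)
  show ?case
    unfolding Ck_on.simps(2)[of k] using Suc.prems Suc.IH by (subst (asm) Ck_on.simps(2)) blast
qed

lemma Ck_on_const: "Ck_on k S (\<lambda>x. a)"
  by (induction k arbitrary: a) (auto simp: has_derivative_imp_frechet[OF has_derivative_const])

lemma Ck_on_bounded_linear:
  assumes "open S" "bounded_linear h" "Ck_on k S f"
  shows "Ck_on k S (\<lambda>x. h (f x))"
  using assms(3)
proof (induction k arbitrary: f)
  case 0
  then show ?case by (simp add: assms(2) bounded_linear.continuous_on)
next
  case (Suc k)
  show ?case
  proof (rule Ck_on_SucI[OF assms(1)])
    show "((\<lambda>x. h (f x)) has_derivative (\<lambda>v. h (frechet_derivative f (at x) v))) (at x)"
      if "x \<in> S" for x
      using bounded_linear.has_derivative[OF assms(2) Ck_on_SucD(1)[OF Suc.prems that]] .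
    show "Ck_on k S (\<lambda>x. h (frechet_derivative f (at x) v))" for v
      using Suc.IH Ck_on_SucD(2)[OF Suc.prems] .
  qed
qed

lemma Ck_on_ident: "open S \<Longrightarrow> Ck_on k S (\<lambda>x. x)"
proof (cases k)
  case (Suc l)
  assume "open S"
  then show ?thesis unfolding Suc
    by (rule Ck_on_SucI[where f' = "\<lambda>x v. v"]) (auto intro: Ck_on_const)
qed auto

lemma Ck_on_add:
  assumes "open S" "Ck_on k S f" "Ck_on k S g"
  shows "Ck_on k S (\<lambda>x. f x + g x)"
  using assms(2,3)
proof (induction k arbitrary: f g)
  case 0
  then show ?case by (simp add: continuous_on_add)
next
  case (Suc k)
  show ?case
  proof (rule Ck_on_SucI[OF assms(1)])
    show "((\<lambda>x. f x + g x) has_derivative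
        (\<lambda>v. frechet_derivative f (at x) v + frechet_derivative g (at x) v)) (at x)"
      if "x \<in> S" for x
      using has_derivative_add[OF Ck_on_SucD(1)[OF Suc.prems(1) that] Ck_on_SucD(1)[OF Suc.prems(2) that]] .
    show "Ck_on k S (\<lambda>x. frechet_derivative f (at x) v + frechet_derivative g (at x) v)" for v
      using Suc.IH Ck_on_SucD(2)[OF Suc.prems(1)] Ck_on_SucD(2)[OF Suc.prems(2)] .
  qed
qed

lemma Ck_on_sum:
  assumes "open S" "\<And>i. i \<in> I \<Longrightarrow> Ck_on k S (f i)"
  shows "Ck_on k S (\<lambda>x. \<Sum>i\<in>I. f i x)"
  using assms(2)
  by (induction I rule: infinite_finite_induct) (auto intro: Ck_on_const Ck_on_add assms(1))

text \<open>Leibniz rule. Each factor reappears undifferentiated, which is why the induction also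
  lowers the order of \<open>f\<close> and \<open>g\<close> by one.\<close>

lemma (in bounded_bilinear) Ck_on_prod:
  assumes "open S" "Ck_on k S f" "Ck_on k S g"
  shows "Ck_on k S (\<lambda>x. prod (f x) (g x))"
  using assms(2,3)
proof (induction k arbitrary: f g)
  case 0
  then show ?case by (simp add: continuous_on)
next
  case (Suc k)
  show ?case
  proof (rule Ck_on_SucI[OF assms(1)])
    show "((\<lambda>x. prod (f x) (g x)) has_derivative
        (\<lambda>v. prod (f x) (frechet_derivative g (at x) v) + prod (frechet_derivative f (at x) v) (g x))) (at x)"
      if "x \<in> S" for x
      using FDERIV[OF Ck_on_SucD(1)[OF Suc.prems(1) that] Ck_on_SucD(1)[OF Suc.prems(2) that]] .
    show "Ck_on k S (\<lambda>x. prod (f x) (frechet_derivative g (at x) v) + prod (frechet_derivative f (at x) v) (g x))" for v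
      using Suc.IH Ck_on_SucD(2)[OF Suc.prems(1)] Ck_on_SucD(2)[OF Suc.prems(2)]
        Ck_on_Suc_imp[OF Suc.prems(1)] Ck_on_Suc_imp[OF Suc.prems(2)] Ck_on_add[OF assms(1)] by blast
  qed
qed

lemma Ck_on_Pair:
  assumes "open S" "Ck_on k S f" "Ck_on k S g"
  shows "Ck_on k S (\<lambda>x. (f x, g x))"
proof -
  have "bounded_linear (\<lambda>x::'b. (x, 0::'c))" "bounded_linear (\<lambda>x::'c. (0::'b, x))"
    by (auto intro!: bounded_linear_Pair bounded_linear_ident bounded_linear_zero)
  from Ck_on_add[OF assms(1) Ck_on_bounded_linear[OF assms(1) this(1) assms(2)]
      Ck_on_bounded_linear[OF assms(1) this(2) assms(3)]]
  show ?thesis by simp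
qed

lemma linear_Basis_expansion:
  fixes h :: "'n::euclidean_space \<Rightarrow> 'b::real_vector"
  assumes "linear h"
  shows "h v = (\<Sum>b\<in>Basis. (v \<bullet> b) *\<^sub>R h b)"
proof -
  have "h v = h (\<Sum>b\<in>Basis. (v \<bullet> b) *\<^sub>R b)" by (simp add: euclidean_representation)
  then show ?thesis using assms by (simp add: linear_sum linear_scale)
qed

text \<open>By the chain rule the derivative of \<open>f\<close> is taken in a direction that moves
  with \<open>x\<close>, whereas \<open>Ck_on\<close> controls fixed directions only. A finite basis
  of the intermediate space removes the conflict.\<close>

lemma Ck_on_compose:
  fixes g :: "'a::real_normed_vector \<Rightarrow> 'n::euclidean_space" and f :: "'n \<Rightarrow> 'b::real_normed_vector"
  assumes "open S" "open T" "Ck_on k T f" "Ck_on k S g" "\<And>x. x \<in> S \<Longrightarrow> g x \<in> T"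
  shows "Ck_on k S (\<lambda>x. f (g x))"
  using assms(3,4)
proof (induction k arbitrary: f)
  case 0
  then show ?case using assms(5) by (auto intro: continuous_on_compose2)
next
  case (Suc k)
  \<comment> \<open>The chain rule expanded in the basis: scalar coefficients from \<open>g\<close>,
    derivatives of \<open>f\<close> in constant directions.\<close>
  let ?f' = "\<lambda>x v. \<Sum>b\<in>Basis. (frechet_derivative g (at x) v \<bullet> b) *\<^sub>R frechet_derivative f (at (g x)) b"
  show ?case
  proof (rule Ck_on_SucI[OF assms(1)])
    show "((\<lambda>x. f (g x)) has_derivative ?f' x) (at x)" if "x \<in> S" for x
    proof -
      have f: "(f has_derivative frechet_derivative f (at (g x))) (at (g x))"
        using Ck_on_SucD(1)[OF Suc.prems(1)] assms(5)[OF that] .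
      have "linear (frechet_derivative f (at (g x)))"
        using f has_derivative_linear by blast
      from linear_Basis_expansion[OF this, symmetric]
        has_derivative_compose[OF Ck_on_SucD(1)[OF Suc.prems(2) that] f]
      show ?thesis by (simp only:)
    qed
    show "Ck_on k S (\<lambda>x. ?f' x v)" for v
    proof (rule Ck_on_sum[OF assms(1)])
      fix b :: 'n
      have "Ck_on k S (\<lambda>x. frechet_derivative g (at x) v \<bullet> b)"
        using Ck_on_bounded_linear[OF assms(1) bounded_linear_inner_left Ck_on_SucD(2)[OF Suc.prems(2)]] .
      moreover have "Ck_on k S (\<lambda>x. frechet_derivative f (at (g x)) b)"
        using Suc.IH[OF Ck_on_SucD(2)[OF Suc.prems(1)] Ck_on_Suc_imp[OF Suc.prems(2)]] .
      ultimately show "Ck_on k S (\<lambda>x. (frechet_derivative g (at x) v \<bullet> b) *\<^sub>R frechet_derivative f (at (g x)) b)"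
        using bounded_bilinear.Ck_on_prod[OF bounded_bilinear_scaleR assms(1)] by blast
    qed
  qed
qed

text \<open>The derivative of the inverse is a polynomial in the inverse itself, so the induction
  closes.\<close>

lemma Ck_on_inverse: "Ck_on k (- {0::real}) inverse"
proof (induction k)
  case 0
  then show ?case by (auto intro!: continuous_intros)
next
  case (Suc k)
  show ?case
  proof (rule Ck_on_SucI)
    show "(inverse has_derivative (\<lambda>v. (- inverse x * inverse x) * v)) (at x)" if "x \<in> - {0}" for x :: real
      using has_derivative_inverse'[of x UNIV] that by (simp add: mult_ac)
    have "Ck_on k (- {0::real}) (\<lambda>x. - inverse x)"
      by (intro Ck_on_bounded_linear[OF _ bounded_linear_minus[OF bounded_linear_ident] Suc]) auto
    from bounded_bilinear.Ck_on_prod[OF bounded_bilinear_mult _ this Suc]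
    show "Ck_on k (- {0}) (\<lambda>x. (- inverse x * inverse x) * v)" for v :: real
      by (intro Ck_on_bounded_linear[OF _ bounded_linear_mult_left]) auto
  qed auto
qed

section \<open>Closure rules for infinitely differentiable maps\<close>

lemma smooth_on_subset: "smooth_on S f \<Longrightarrow> T \<subseteq> S \<Longrightarrow> smooth_on T f"
  unfolding smooth_on_def using Ck_on_subset by blast

lemma smooth_on_cong:
  "open S \<Longrightarrow> (\<And>x. x \<in> S \<Longrightarrow> f x = g x) \<Longrightarrow> smooth_on S f \<longleftrightarrow> smooth_on S g"
  unfolding smooth_on_def using Ck_on_cong by metis

lemma smooth_on_has_derivative:
  "smooth_on S f \<Longrightarrow> x \<in> S \<Longrightarrow> (f has_derivative frechet_derivative f (at x)) (at x)"
  unfolding smooth_on_def using Ck_on_SucD(1) by blast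

lemma smooth_on_frechet: "smooth_on S f \<Longrightarrow> smooth_on S (\<lambda>x. frechet_derivative f (at x) v)"
  unfolding smooth_on_def using Ck_on_SucD(2) by blast

lemma smooth_on_const: "smooth_on S (\<lambda>x. a)"
  unfolding smooth_on_def using Ck_on_const by blast

lemma smooth_on_ident: "open S \<Longrightarrow> smooth_on S (\<lambda>x. x)"
  unfolding smooth_on_def using Ck_on_ident by blast

lemma smooth_on_bounded_linear:
  "open S \<Longrightarrow> bounded_linear h \<Longrightarrow> smooth_on S f \<Longrightarrow> smooth_on S (\<lambda>x. h (f x))"
  unfolding smooth_on_def by (intro allI Ck_on_bounded_linear[where h = h and f = f]) auto

lemma smooth_on_add:
  "open S \<Longrightarrow> smooth_on S f \<Longrightarrow> smooth_on S g \<Longrightarrow> smooth_on S (\<lambda>x. f x + g x)"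
  unfolding smooth_on_def by (intro allI Ck_on_add[where f = f and g = g]) auto

lemma smooth_on_sum:
  "open S \<Longrightarrow> (\<And>i. i \<in> I \<Longrightarrow> smooth_on S (f i)) \<Longrightarrow> smooth_on S (\<lambda>x. \<Sum>i\<in>I. f i x)"
  unfolding smooth_on_def by (intro allI Ck_on_sum[where f = f]) auto

lemma smooth_on_scaleR:
  "open S \<Longrightarrow> smooth_on S f \<Longrightarrow> smooth_on S g \<Longrightarrow> smooth_on S (\<lambda>x. f x *\<^sub>R g x)"
  unfolding smooth_on_def by (intro allI bounded_bilinear.Ck_on_prod[OF bounded_bilinear_scaleR, where f = f and g = g]) auto

lemma smooth_on_mult:
  fixes f g :: "_ \<Rightarrow> real"
  shows "open S \<Longrightarrow> smooth_on S f \<Longrightarrow> smooth_on S g \<Longrightarrow> smooth_on S (\<lambda>x. f x * g x)"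
  using smooth_on_scaleR[of S f g] by simp

lemma smooth_on_Pair:
  "open S \<Longrightarrow> smooth_on S f \<Longrightarrow> smooth_on S g \<Longrightarrow> smooth_on S (\<lambda>x. (f x, g x))"
  unfolding smooth_on_def by (intro allI Ck_on_Pair[where f = f and g = g]) auto

lemma smooth_on_compose:
  fixes g :: "'a::real_normed_vector \<Rightarrow> 'n::euclidean_space" and f :: "'n \<Rightarrow> 'b::real_normed_vector"
  shows "open S \<Longrightarrow> open T \<Longrightarrow> smooth_on T f \<Longrightarrow> smooth_on S g \<Longrightarrow> (\<And>x. x \<in> S \<Longrightarrow> g x \<in> T) \<Longrightarrow>
    smooth_on S (\<lambda>x. f (g x))"
  unfolding smooth_on_def by (intro allI Ck_on_compose[where T = T and f = f and g = g]) auto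

lemma smooth_on_inverse:
  fixes f :: "_ \<Rightarrow> real"
  assumes "open S" "smooth_on S f" "\<And>x. x \<in> S \<Longrightarrow> f x \<noteq> 0"
  shows "smooth_on S (\<lambda>x. inverse (f x))"
proof -
  have "smooth_on (- {0::real}) inverse" unfolding smooth_on_def using Ck_on_inverse by blast
  from smooth_on_compose[OF assms(1) _ this assms(2)] show ?thesis using assms(3) by auto
qed

lemma smooth_on_inner_left:
  "open S \<Longrightarrow> smooth_on S f \<Longrightarrow> smooth_on S (\<lambda>x. f x \<bullet> b)"
  by (rule smooth_on_bounded_linear[OF _ bounded_linear_inner_left])

text \<open>Base point and direction vary together here. This is the form of the coordinate change
  of a vector field and of the transition maps of the tangent bundle.\<close>

lemma smooth_on_frechet_vector:
  fixes f :: "'n::euclidean_space \<Rightarrow> 'b::real_normed_vector"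
  assumes "open S" "smooth_on S f" "smooth_on T h" "smooth_on T v" "open T" "\<And>x. x \<in> T \<Longrightarrow> h x \<in> S"
  shows "smooth_on T (\<lambda>x. frechet_derivative f (at (h x)) (v x))"
proof -
  let ?h = "\<lambda>x. \<Sum>b\<in>Basis. (v x \<bullet> b) *\<^sub>R frechet_derivative f (at (h x)) b"
  have 1: "smooth_on T (\<lambda>x. frechet_derivative f (at (h x)) b)" for b
    using smooth_on_compose[OF assms(5,1) smooth_on_frechet[OF assms(2)] assms(3,6)] .
  have 2: "smooth_on T ?h"
    by (rule smooth_on_sum[OF assms(5)],
        rule smooth_on_scaleR[OF assms(5) smooth_on_inner_left[OF assms(5,4)] 1])
  have 3: "frechet_derivative f (at (h x)) (v x) = ?h x" if "x \<in> T" for x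
    by (intro linear_Basis_expansion has_derivative_linear[OF smooth_on_has_derivative[OF assms(2)]] assms(6) that)
  show ?thesis by (rule iffD2[OF smooth_on_cong[OF assms(5)] 2]) (rule 3)
qed

text \<open>Reduces a value of a derivative to a function of one real variable, the form in which
  most explicit computations below are done.\<close>

lemma has_derivative_line:
  fixes f :: "'n::real_normed_vector \<Rightarrow> 'b::real_normed_vector"
  assumes "(f has_derivative f') (at x)"
  shows "((\<lambda>t. f (x + t *\<^sub>R v)) has_vector_derivative f' v) (at 0)"
proof -
  have "((\<lambda>t::real. x + t *\<^sub>R v) has_derivative (\<lambda>t. t *\<^sub>R v)) (at 0)"
    by (auto intro!: derivative_eq_intros)
  from has_derivative_compose[OF this, of f f'] assms
  have "((\<lambda>t. f (x + t *\<^sub>R v)) has_derivative (\<lambda>t. f' (t *\<^sub>R v))) (at 0)" by simp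
  then show ?thesis
    unfolding has_vector_derivative_def using linear_scale[OF has_derivative_linear[OF assms]] by simp
qed

section \<open>Tangent vectors and fields in charts\<close>

text \<open>Inverse of evaluation in the chart \<open>c\<close>: the tangent vector at
  \<open>p\<close> with coordinates \<open>x\<close> in \<open>c\<close>. Its entries in the other
  charts are forced by the transition rule. For fixed \<open>x\<close> and varying \<open>p\<close>
  it is a coordinate field with constant coefficients.\<close>

definition tvec_of :: "('a, 'n::euclidean_space) atlas \<Rightarrow> ('a, 'n) chart \<Rightarrow> 'a \<Rightarrow> 'n \<Rightarrow> ('a, 'n) tvec"
  where "tvec_of A c p x = (\<lambda>d. if d \<in> A \<and> p \<in> fst d
    then frechet_derivative (snd d \<circ> chart_inv c) (at (snd c p)) x else 0)"

text \<open>Isolates the compatibility of charts, which passes from the base to the total space, so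
  that one theory serves both.\<close>

locale smooth_atlas =
  fixes A :: "('a, 'n::euclidean_space) atlas"
  assumes chart: "c \<in> A \<Longrightarrow> is_chart c"
    and transition: "c \<in> A \<Longrightarrow> d \<in> A \<Longrightarrow> smooth_transition c d"
begin

lemma chart_inj: "c \<in> A \<Longrightarrow> inj_on (snd c) (fst c)"
  using chart unfolding is_chart_def by blast

lemma open_chart_image: "c \<in> A \<Longrightarrow> open (snd c ` fst c)"
  using chart unfolding is_chart_def by blast

lemma chart_inv_left: "c \<in> A \<Longrightarrow> p \<in> fst c \<Longrightarrow> chart_inv c (snd c p) = p"
  unfolding chart_inv_def using chart_inj by (simp add: inv_into_f_f)

lemma chart_inv_right: "c \<in> A \<Longrightarrow> x \<in> snd c ` fst c \<Longrightarrow> snd c (chart_inv c x) = x"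
  unfolding chart_inv_def by (simp add: f_inv_into_f)

lemma chart_inv_in: "c \<in> A \<Longrightarrow> x \<in> snd c ` S \<Longrightarrow> S \<subseteq> fst c \<Longrightarrow> chart_inv c x \<in> S"
  by (elim imageE) (simp add: chart_inv_left subset_iff)

lemma open_chart_overlap: "c \<in> A \<Longrightarrow> d \<in> A \<Longrightarrow> open (snd c ` (fst c \<inter> fst d))"
  using transition unfolding smooth_transition_def by blast

lemma smooth_on_transition:
  "c \<in> A \<Longrightarrow> d \<in> A \<Longrightarrow> smooth_on (snd c ` (fst c \<inter> fst d)) (snd d \<circ> chart_inv c)"
  using transition unfolding smooth_transition_def by blast

lemma mopen_chart: "c \<in> A \<Longrightarrow> mopen A (fst c)"
  unfolding mopen_def mcarrier_def using open_chart_overlap by (auto simp: Int_commute)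

lemma mopen_Int: "mopen A V \<Longrightarrow> mopen A W \<Longrightarrow> mopen A (V \<inter> W)"
proof -
  assume *: "mopen A V" "mopen A W"
  have "snd c ` ((V \<inter> W) \<inter> fst c) = snd c ` (V \<inter> fst c) \<inter> snd c ` (W \<inter> fst c)" if "c \<in> A" for c
    using chart_inj[OF that] unfolding inj_on_def by blast
  then show ?thesis using * unfolding mopen_def by auto
qed

lemma mopen_open: "mopen A W \<Longrightarrow> c \<in> A \<Longrightarrow> open (snd c ` (W \<inter> fst c))"
  unfolding mopen_def by blast

lemma mcarrierI: "c \<in> A \<Longrightarrow> p \<in> fst c \<Longrightarrow> p \<in> mcarrier A"
  unfolding mcarrier_def by blast

lemma transition_has_derivative:
  assumes "c \<in> A" "d \<in> A" "p \<in> fst c" "p \<in> fst d"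
  shows "((snd d \<circ> chart_inv c) has_derivative
    frechet_derivative (snd d \<circ> chart_inv c) (at (snd c p))) (at (snd c p))"
  using smooth_on_has_derivative[OF smooth_on_transition[OF assms(1,2)]] assms(3,4) by blast

lemma transition_linear:
  assumes "c \<in> A" "d \<in> A" "p \<in> fst c" "p \<in> fst d"
  shows "linear (frechet_derivative (snd d \<circ> chart_inv c) (at (snd c p)))"
  using has_derivative_linear[OF transition_has_derivative[OF assms]] .

text \<open>Chain rule for a map \<open>h\<close> into the manifold that is read in \<open>c\<close>
  and then in \<open>d\<close>; on \<open>S\<close> it factors through the transition map.\<close>

lemma has_derivative_change_chart:
  assumes "c \<in> A" "d \<in> A" "open S" "x \<in> S" "\<And>y. y \<in> S \<Longrightarrow> h y \<in> fst c" "h x \<in> fst d"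
    and "((\<lambda>y. snd c (h y)) has_derivative h') (at x)"
  shows "((\<lambda>y. snd d (h y)) has_derivative
    (\<lambda>v. frechet_derivative (snd d \<circ> chart_inv c) (at (snd c (h x))) (h' v))) (at x)"
proof -
  have "h x \<in> fst c" using assms(4,5) by blast
  from has_derivative_compose[OF assms(7) transition_has_derivative[OF assms(1,2) this assms(6)]]
  have *: "((\<lambda>y. snd d (chart_inv c (snd c (h y)))) has_derivative
    (\<lambda>v. frechet_derivative (snd d \<circ> chart_inv c) (at (snd c (h x))) (h' v))) (at x)"
    by (simp add: comp_def)
  show ?thesis
    by (rule has_derivative_transform_within_open[OF * assms(3,4)])
      (simp add: chart_inv_left assms(1,5))
qed

lemma transition_cocycle:
  assumes "c \<in> A" "d \<in> A" "e \<in> A" "p \<in> fst c" "p \<in> fst d" "p \<in> fst e"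
  shows "frechet_derivative (snd e \<circ> chart_inv c) (at (snd c p)) v =
    frechet_derivative (snd e \<circ> chart_inv d) (at (snd d p))
      (frechet_derivative (snd d \<circ> chart_inv c) (at (snd c p)) v)"
proof -
  have inv: "chart_inv c (snd c p) = p" using assms by (simp add: chart_inv_left)
  have "((\<lambda>y. snd e (chart_inv c y)) has_derivative
    (\<lambda>v. frechet_derivative (snd e \<circ> chart_inv d) (at (snd d (chart_inv c (snd c p))))
      (frechet_derivative (snd d \<circ> chart_inv c) (at (snd c p)) v))) (at (snd c p))"
  proof (rule has_derivative_change_chart[OF assms(2,3) open_chart_overlap[OF assms(1,2)]])
    show "chart_inv c y \<in> fst d" if "y \<in> snd c ` (fst c \<inter> fst d)" for y
      using chart_inv_in[OF assms(1) that] by blast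
    show "((\<lambda>y. snd d (chart_inv c y)) has_derivative
        frechet_derivative (snd d \<circ> chart_inv c) (at (snd c p))) (at (snd c p))"
      using transition_has_derivative[OF assms(1,2,4,5)] by (simp add: comp_def)
  qed (use assms inv in auto)
  from has_derivative_imp_frechet[OF this] show ?thesis by (simp add: inv comp_def)
qed

lemma transition_self:
  assumes "c \<in> A" "p \<in> fst c"
  shows "frechet_derivative (snd c \<circ> chart_inv c) (at (snd c p)) v = v"
proof -
  have "((snd c \<circ> chart_inv c) has_derivative (\<lambda>v. v)) (at (snd c p))"
    by (rule has_derivative_transform_within_open[OF has_derivative_ident open_chart_image[OF assms(1)]])
      (use assms chart_inv_right in auto)
  from has_derivative_imp_frechet[OF this] show ?thesis by simp
qed

lemma tvec_of_in: "c \<in> A \<Longrightarrow> p \<in> fst c \<Longrightarrow> tvec_of A c p x \<in> tangent_space A p"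
  unfolding tangent_space_def tvec_of_def by (auto intro: transition_cocycle)

lemma tvec_of_coord: "c \<in> A \<Longrightarrow> p \<in> fst c \<Longrightarrow> tvec_of A c p x c = x"
  unfolding tvec_of_def by (simp add: transition_self)

lemma tangent_space_transition:
  "v \<in> tangent_space A p \<Longrightarrow> c \<in> A \<Longrightarrow> d \<in> A \<Longrightarrow> p \<in> fst c \<Longrightarrow> p \<in> fst d \<Longrightarrow>
    v d = frechet_derivative (snd d \<circ> chart_inv c) (at (snd c p)) (v c)"
  unfolding tangent_space_def by blast

lemma tangent_space_zero_outside:
  "v \<in> tangent_space A p \<Longrightarrow> \<not> (c \<in> A \<and> p \<in> fst c) \<Longrightarrow> v c = 0"
  unfolding tangent_space_def by blast

lemma tvec_of_eq:
  assumes "c \<in> A" "p \<in> fst c" "v \<in> tangent_space A p"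
  shows "tvec_of A c p (v c) = v"
proof
  fix d
  show "tvec_of A c p (v c) d = v d"
    unfolding tvec_of_def
    using tangent_space_transition[OF assms(3,1) _ assms(2)] tangent_space_zero_outside[OF assms(3)]
    by auto
qed

text \<open>A single chart determines a tangent vector. Equalities between lifts, differentials and
  covariant derivatives are all checked in this way.\<close>

lemma tangent_eqI:
  assumes "c \<in> A" "p \<in> fst c" "v \<in> tangent_space A p" "w \<in> tangent_space A p" "v c = w c"
  shows "v = w"
  using tvec_of_eq[OF assms(1-3)] tvec_of_eq[OF assms(1,2,4)] unfolding assms(5) by (rule trans[OF sym])

lemma subspace_tangent_space: "subspace (tangent_space A p)"
proof (rule subspaceI)
  show "0 \<in> tangent_space A p"
    unfolding tangent_space_def by (auto simp: linear_0[OF transition_linear])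
next
  fix v w assume vw: "v \<in> tangent_space A p" "w \<in> tangent_space A p"
  have "(v + w) d = frechet_derivative (snd d \<circ> chart_inv c) (at (snd c p)) ((v + w) c)"
    if "c \<in> A" "d \<in> A" "p \<in> fst c \<inter> fst d" for c d
    using that tangent_space_transition[OF vw(1) that(1,2)] tangent_space_transition[OF vw(2) that(1,2)]
      linear_add[OF transition_linear[OF that(1,2)]] by simp
  moreover have "(v + w) c = 0" if "\<not> (c \<in> A \<and> p \<in> fst c)" for c
    using tangent_space_zero_outside[OF vw(1) that] tangent_space_zero_outside[OF vw(2) that] by simp
  ultimately show "v + w \<in> tangent_space A p" unfolding tangent_space_def by blast
next
  fix a v assume v: "v \<in> tangent_space A p"
  have "(a *\<^sub>R v) d = frechet_derivative (snd d \<circ> chart_inv c) (at (snd c p)) ((a *\<^sub>R v) c)"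
    if "c \<in> A" "d \<in> A" "p \<in> fst c \<inter> fst d" for c d
    using that tangent_space_transition[OF v that(1,2)]
      linear_scale[OF transition_linear[OF that(1,2)]] by (simp add: scaleR_fun_def)
  moreover have "(a *\<^sub>R v) c = 0" if "\<not> (c \<in> A \<and> p \<in> fst c)" for c
    using tangent_space_zero_outside[OF v that] by (simp add: scaleR_fun_def)
  ultimately show "a *\<^sub>R v \<in> tangent_space A p" unfolding tangent_space_def by blast
qed

lemma linear_tvec_of: "c \<in> A \<Longrightarrow> p \<in> fst c \<Longrightarrow> linear (tvec_of A c p)"
  by (rule linearI; rule ext; simp add: tvec_of_def scaleR_fun_def
      linear_add[OF transition_linear] linear_scale[OF transition_linear])

text \<open>Differentiating a map into the manifold in every chart yields a compatible family by the
  chain rule. \<open>nb\<close> says that \<open>h\<close> stays in the chart domain near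
  \<open>x\<close>; without it the two chart expressions could not be compared. Velocities and
  differentials of sections are instances.\<close>

lemma derivative_in_tangent_space:
  assumes h: "\<And>d. d \<in> A \<Longrightarrow> h x \<in> fst d \<Longrightarrow> ((\<lambda>y. snd d (h y)) has_derivative h' d) (at x)"
    and nb: "\<And>d. d \<in> A \<Longrightarrow> h x \<in> fst d \<Longrightarrow> \<exists>S. open S \<and> x \<in> S \<and> (\<forall>y\<in>S. h y \<in> fst d)"
  shows "(\<lambda>d. if d \<in> A \<and> h x \<in> fst d then h' d v else 0) \<in> tangent_space A (h x)"
proof -
  have *: "h' d v = frechet_derivative (snd d \<circ> chart_inv c) (at (snd c (h x))) (h' c v)"
    if cd: "c \<in> A" "d \<in> A" "h x \<in> fst c" "h x \<in> fst d" for c d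
  proof -
    obtain S where "open S" "x \<in> S" "\<And>y. y \<in> S \<Longrightarrow> h y \<in> fst c"
      using nb[OF cd(1,3)] by blast
    from has_derivative_change_chart[OF cd(1,2) this cd(4) h[OF cd(1,3)]] h[OF cd(2,4)]
    show ?thesis using has_derivative_unique by (metis (no_types, lifting))
  qed
  show ?thesis
    unfolding tangent_space_def mem_Collect_eq
  proof (intro conjI allI ballI impI)
    fix c d assume "c \<in> A" "d \<in> A" "h x \<in> fst c \<inter> fst d"
    then show "(if d \<in> A \<and> h x \<in> fst d then h' d v else 0) =
      frechet_derivative (snd d \<circ> chart_inv c) (at (snd c (h x)))
        (if c \<in> A \<and> h x \<in> fst c then h' c v else 0)"
      using *[of c d] by simp
  qed (erule if_not_P)
qed

text \<open>\<open>dir_deriv\<close> works in an unspecified chosen chart; passing through the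
  transition map shows that any chart gives the same value.\<close>

lemma dir_deriv_eq:
  assumes "c \<in> A" "p \<in> fst c" "v \<in> tangent_space A p"
    and f: "((\<lambda>x. f (chart_inv c x)) has_derivative f') (at (snd c p))"
  shows "dir_deriv A f p v = f' (v c)"
proof -
  define c0 where "c0 = (SOME c. c \<in> A \<and> p \<in> fst c)"
  have c0: "c0 \<in> A" "p \<in> fst c0"
    using someI[of "\<lambda>c. c \<in> A \<and> p \<in> fst c" c] assms(1,2) unfolding c0_def by auto
  let ?T = "frechet_derivative (snd c \<circ> chart_inv c0) (at (snd c0 p))"
  have "((\<lambda>x. f (chart_inv c ((snd c \<circ> chart_inv c0) x))) has_derivative (\<lambda>v. f' (?T v))) (at (snd c0 p))"
    by (rule has_derivative_compose[OF transition_has_derivative[OF c0(1) assms(1) c0(2) assms(2)]])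
      (use f in \<open>simp add: c0 chart_inv_left\<close>)
  then have "((f \<circ> chart_inv c0) has_derivative (\<lambda>v. f' (?T v))) (at (snd c0 p))"
    by (rule has_derivative_transform_within_open[OF _ open_chart_overlap[OF c0(1) assms(1)]])
      (auto simp: c0 assms chart_inv_left)
  from has_derivative_imp_frechet[OF this]
  show ?thesis
    unfolding dir_deriv_def Let_def c0_def[symmetric]
    using tangent_space_transition[OF assms(3) c0(1) assms(1) c0(2) assms(2)] by simp
qed

text \<open>In any other chart the coordinate expression differs by a smooth transition map, so a
  single chart containing \<open>W\<close> decides smoothness.\<close>

lemma smooth_funI_chart:
  assumes "c \<in> A" "mopen A W" "W \<subseteq> fst c" "smooth_on (snd c ` W) (\<lambda>x. f (chart_inv c x))"
  shows "smooth_fun A W f"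
  unfolding smooth_fun_def
proof
  fix d assume d: "d \<in> A"
  let ?S = "snd d ` (W \<inter> fst d)"
  have S: "open ?S" using mopen_open[OF assms(2) d] .
  have oW: "open (snd c ` W)"
    using mopen_open[OF assms(2,1)] assms(3) by (simp add: inf_absorb1)
  have 1: "smooth_on ?S (snd c \<circ> chart_inv d)"
    by (rule smooth_on_subset[OF smooth_on_transition[OF d assms(1)]]) (use assms(3) in auto)
  have 2: "(snd c \<circ> chart_inv d) x \<in> snd c ` W" if "x \<in> ?S" for x
    using chart_inv_in[OF d that] by auto
  have 3: "(f \<circ> chart_inv d) x = f (chart_inv c ((snd c \<circ> chart_inv d) x))" if "x \<in> ?S" for x
    using chart_inv_in[OF d that] chart_inv_left[OF assms(1)] assms(3) by auto
  show "smooth_on ?S (f \<circ> chart_inv d)"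
    by (rule iffD2[OF smooth_on_cong[OF S 3] smooth_on_compose[OF S oW assms(4) 1 2]])
qed

text \<open>As for functions, except that the coordinate vector is also transformed by the
  derivative of the transition map at a moving point.\<close>

lemma smooth_vector_fieldI_chart:
  assumes "c \<in> A" "mopen A W" "W \<subseteq> fst c" "\<And>p. p \<in> W \<Longrightarrow> X p \<in> tangent_space A p"
    and "smooth_on (snd c ` W) (\<lambda>x. X (chart_inv c x) c)"
  shows "smooth_vector_field A W X"
  unfolding smooth_vector_field_def
proof (intro conjI ballI)
  fix d assume d: "d \<in> A"
  let ?S = "snd d ` (W \<inter> fst d)"
  have S: "open ?S" using mopen_open[OF assms(2) d] .
  have oW: "open (snd c ` W)"
    using mopen_open[OF assms(2,1)] assms(3) by (simp add: inf_absorb1)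
  have 1: "smooth_on ?S (snd c \<circ> chart_inv d)"
    by (rule smooth_on_subset[OF smooth_on_transition[OF d assms(1)]]) (use assms(3) in auto)
  have 2: "(snd c \<circ> chart_inv d) x \<in> snd c ` W" if "x \<in> ?S" for x
    using chart_inv_in[OF d that] by auto
  have 4: "(snd c \<circ> chart_inv d) x \<in> snd c ` (fst c \<inter> fst d)" if "x \<in> ?S" for x
    using chart_inv_in[OF d that] assms(3) by auto
  have 3: "X (chart_inv d x) d = frechet_derivative (snd d \<circ> chart_inv c) (at ((snd c \<circ> chart_inv d) x))
      (X (chart_inv c ((snd c \<circ> chart_inv d) x)) c)" if "x \<in> ?S" for x
  proof -
    have "chart_inv d x \<in> W" "chart_inv d x \<in> fst d" using chart_inv_in[OF d that] by auto
    then show ?thesis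
      using tangent_space_transition[OF assms(4) assms(1) d] chart_inv_left[OF assms(1)] assms(3)
      by auto
  qed
  show "smooth_on ?S (\<lambda>x. X (chart_inv d x) d)"
    by (rule iffD2[OF smooth_on_cong[OF S 3]],
        assumption,
        rule smooth_on_frechet_vector[OF open_chart_overlap[OF assms(1) d]
          smooth_on_transition[OF assms(1) d] 1 smooth_on_compose[OF S oW assms(5) 1 2] S 4])
qed (rule assms(4))

lemma smooth_vector_field_subset:
  "smooth_vector_field A W X \<Longrightarrow> V \<subseteq> W \<Longrightarrow> smooth_vector_field A V X"
  unfolding smooth_vector_field_def
  by (meson Int_mono image_mono smooth_on_subset subset_refl subset_iff)

lemma smooth_fun_const: "smooth_fun A W (\<lambda>_. a)"
  unfolding smooth_fun_def comp_def by (simp add: smooth_on_const)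

lemma smooth_vector_field_tangent: "smooth_vector_field A W X \<Longrightarrow> p \<in> W \<Longrightarrow> X p \<in> tangent_space A p"
  unfolding smooth_vector_field_def by blast

lemma smooth_vector_field_coord:
  "smooth_vector_field A W X \<Longrightarrow> c \<in> A \<Longrightarrow> smooth_on (snd c ` (W \<inter> fst c)) (\<lambda>x. X (chart_inv c x) c)"
  unfolding smooth_vector_field_def by blast

lemma smooth_vector_field_zero: "smooth_vector_field A W (\<lambda>_. 0)"
  unfolding smooth_vector_field_def
  by (auto simp: subspace_0[OF subspace_tangent_space] smooth_on_const)

lemma smooth_vector_field_add:
  assumes "mopen A W" "smooth_vector_field A W X" "smooth_vector_field A W Y"
  shows "smooth_vector_field A W (\<lambda>q. X q + Y q)"
  using assms(2,3) unfolding smooth_vector_field_def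
  by (auto simp: subspace_add[OF subspace_tangent_space] smooth_on_add[OF mopen_open[OF assms(1)]])

lemma smooth_vector_field_scaleR:
  assumes "mopen A W" "smooth_fun A W f" "smooth_vector_field A W X"
  shows "smooth_vector_field A W (\<lambda>q. f q *\<^sub>R X q)"
  unfolding smooth_vector_field_def
proof (intro conjI ballI)
  show "f p *\<^sub>R X p \<in> tangent_space A p" if "p \<in> W" for p
    using subspace_scale[OF subspace_tangent_space smooth_vector_field_tangent[OF assms(3) that]] .
  show "smooth_on (snd c ` (W \<inter> fst c)) (\<lambda>x. (f (chart_inv c x) *\<^sub>R X (chart_inv c x)) c)" if "c \<in> A" for c
    using smooth_on_scaleR[OF mopen_open[OF assms(1) that] _ smooth_vector_field_coord[OF assms(3) that]]
      assms(2) that unfolding smooth_fun_def comp_def scaleR_fun_def by blast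
qed

lemma smooth_vector_field_sum:
  assumes "mopen A W" "\<And>i. i \<in> I \<Longrightarrow> smooth_vector_field A W (X i)"
  shows "smooth_vector_field A W (\<lambda>q. \<Sum>i\<in>I. X i q)"
  using assms(2)
  by (induction I rule: infinite_finite_induct)
    (auto intro: smooth_vector_field_zero smooth_vector_field_add[OF assms(1)])

text \<open>Source of all explicit fields below: coordinate frames, the sections witnessing
  horizontality, and the frames of the planes.\<close>

lemma smooth_vector_field_tvec_of:
  assumes "c \<in> A" "mopen A W" "W \<subseteq> fst c" "smooth_on (snd c ` W) h"
  shows "smooth_vector_field A W (\<lambda>q. tvec_of A c q (h (snd c q)))"
proof (rule smooth_vector_fieldI_chart[OF assms(1-3)])
  show "tvec_of A c p (h (snd c p)) \<in> tangent_space A p" if "p \<in> W" for p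
    using tvec_of_in assms that by blast
  have S: "open (snd c ` W)"
    using mopen_open[OF assms(2,1)] assms(3) by (simp add: inf_absorb1)
  have *: "tvec_of A c (chart_inv c x) (h (snd c (chart_inv c x))) c = h x" if x: "x \<in> snd c ` W" for x
  proof -
    have "chart_inv c x \<in> fst c" using chart_inv_in[OF assms(1) x assms(3)] assms(3) by blast
    moreover have "snd c (chart_inv c x) = x"
      using chart_inv_right[OF assms(1)] x assms(3) by blast
    ultimately show ?thesis by (simp add: tvec_of_coord assms(1))
  qed
  show "smooth_on (snd c ` W) (\<lambda>x. tvec_of A c (chart_inv c x) (h (snd c (chart_inv c x))) c)"
    by (rule iffD2[OF smooth_on_cong[OF S *] assms(4)])
qed

lemma smooth_vector_field_frame: "c \<in> A \<Longrightarrow> smooth_vector_field A (fst c) (\<lambda>q. tvec_of A c q x)"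
  using smooth_vector_field_tvec_of[OF _ mopen_chart subset_refl smooth_on_const] .

lemma smooth_fun_coord:
  assumes "c \<in> A" "mopen A W" "W \<subseteq> fst c" "smooth_vector_field A W X"
  shows "smooth_fun A W (\<lambda>q. X q c \<bullet> b)"
proof (rule smooth_funI_chart[OF assms(1-3)])
  have "W \<inter> fst c = W" using assms(3) by blast
  then show "smooth_on (snd c ` W) (\<lambda>x. X (chart_inv c x) c \<bullet> b)"
    using smooth_on_inner_left[OF mopen_open[OF assms(2,1)] smooth_vector_field_coord[OF assms(4,1)]]
    by simp
qed

lemma tangent_frame_expansion:
  assumes "c \<in> A" "q \<in> fst c" "v \<in> tangent_space A q"
  shows "v = (\<Sum>i\<in>Basis. (v c \<bullet> i) *\<^sub>R tvec_of A c q i)"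
  using trans[OF tvec_of_eq[OF assms, symmetric] linear_Basis_expansion[OF linear_tvec_of[OF assms(1,2)]]] .

end

text \<open>The Christoffel symbols of \<open>c\<close>, extended from basis vectors to a
  vector-valued form that is bilinear by construction, whatever \<open>D\<close> may be.\<close>

definition christoffel ::
  "('a, 'n::euclidean_space) atlas \<Rightarrow>
     (('a \<Rightarrow> ('a, 'n) tvec) \<Rightarrow> ('a \<Rightarrow> ('a, 'n) tvec) \<Rightarrow> 'a \<Rightarrow> ('a, 'n) tvec) \<Rightarrow>
     ('a, 'n) chart \<Rightarrow> 'a \<Rightarrow> 'n \<Rightarrow> 'n \<Rightarrow> 'n"
  where "christoffel A D c p v w = (\<Sum>i\<in>Basis. \<Sum>j\<in>Basis. ((v \<bullet> i) * (w \<bullet> j)) *\<^sub>R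
    D (\<lambda>q. tvec_of A c q i) (\<lambda>q. tvec_of A c q j) p c)"

lemma christoffel_linear_left: "linear (\<lambda>v. christoffel A D c p v w)"
  by (rule linearI) (simp_all add: christoffel_def inner_add_left sum.distrib algebra_simps scaleR_sum_right)

lemma christoffel_linear_right: "linear (\<lambda>w. christoffel A D c p v w)"
  by (rule linearI) (simp_all add: christoffel_def inner_add_left sum.distrib algebra_simps scaleR_sum_right)

lemmas christoffel_simps = linear_add[OF christoffel_linear_left] linear_add[OF christoffel_linear_right]
  linear_scale[OF christoffel_linear_left] linear_scale[OF christoffel_linear_right]
  linear_0[OF christoffel_linear_left] linear_0[OF christoffel_linear_right]

section \<open>Connections and metrics in charts\<close>

text \<open>The Gram matrix of \<open>g\<close> in the chart \<open>c\<close>, with arbitrary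
  vectors as indices. The coordinate point comes last so that a partial application is a function
  that can be differentiated.\<close>

definition metric_coord ::
    "('a, 'n::euclidean_space) atlas \<Rightarrow> ('a \<Rightarrow> ('a, 'n) tvec \<Rightarrow> ('a, 'n) tvec \<Rightarrow> real) \<Rightarrow>
     ('a, 'n) chart \<Rightarrow> 'n \<Rightarrow> 'n \<Rightarrow> 'n \<Rightarrow> real"
  where "metric_coord A g c v w x =
    g (chart_inv c x) (tvec_of A c (chart_inv c x) v) (tvec_of A c (chart_inv c x) w)"

context smooth_atlas
begin

lemma affine_connectionD:
  assumes D: "affine_connection A D" and W: "mopen A W"
    and X: "smooth_vector_field A W X" and Y: "smooth_vector_field A W Y"
  shows connection_smooth: "smooth_vector_field A W (D X Y)"
    and connection_local: "\<And>X' Y' p. smooth_vector_field A W X' \<Longrightarrow> smooth_vector_field A W Y' \<Longrightarrow>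
      (\<And>q. q \<in> W \<Longrightarrow> X q = X' q) \<Longrightarrow> (\<And>q. q \<in> W \<Longrightarrow> Y q = Y' q) \<Longrightarrow> p \<in> W \<Longrightarrow> D X Y p = D X' Y' p"
    and connection_add_left: "\<And>X' p. smooth_vector_field A W X' \<Longrightarrow> p \<in> W \<Longrightarrow>
      D (\<lambda>q. X q + X' q) Y p = D X Y p + D X' Y p"
    and connection_add_right: "\<And>Y' p. smooth_vector_field A W Y' \<Longrightarrow> p \<in> W \<Longrightarrow>
      D X (\<lambda>q. Y q + Y' q) p = D X Y p + D X Y' p"
    and connection_scale_left: "\<And>f p. smooth_fun A W f \<Longrightarrow> p \<in> W \<Longrightarrow>
      D (\<lambda>q. f q *\<^sub>R X q) Y p = f p *\<^sub>R D X Y p"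
    and connection_leibniz: "\<And>f p. smooth_fun A W f \<Longrightarrow> p \<in> W \<Longrightarrow>
      D X (\<lambda>q. f q *\<^sub>R Y q) p = dir_deriv A f p (X p) *\<^sub>R Y p + f p *\<^sub>R D X Y p"
proof -
  note * = D[unfolded affine_connection_def, rule_format, OF W]
  show "smooth_vector_field A W (D X Y)"
    using *[OF X X Y Y smooth_fun_const[of W 0]] by (rule conjunct1)
  show "D X Y p = D X' Y' p" if "smooth_vector_field A W X'" "smooth_vector_field A W Y'"
    "\<And>q. q \<in> W \<Longrightarrow> X q = X' q" "\<And>q. q \<in> W \<Longrightarrow> Y q = Y' q" "p \<in> W" for X' Y' p
    using *[OF X that(1) Y that(2) smooth_fun_const[of W 0], THEN conjunct2, THEN conjunct1] that(3-5)
    by blast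
  show "D (\<lambda>q. X q + X' q) Y p = D X Y p + D X' Y p" if "smooth_vector_field A W X'" "p \<in> W" for X' p
    using *[OF X that(1) Y Y smooth_fun_const[of W 0], THEN conjunct2, THEN conjunct2] that(2) by blast
  show "D X (\<lambda>q. Y q + Y' q) p = D X Y p + D X Y' p" if "smooth_vector_field A W Y'" "p \<in> W" for Y' p
    using *[OF X X Y that(1) smooth_fun_const[of W 0], THEN conjunct2, THEN conjunct2] that(2) by blast
  show "D (\<lambda>q. f q *\<^sub>R X q) Y p = f p *\<^sub>R D X Y p"
    "D X (\<lambda>q. f q *\<^sub>R Y q) p = dir_deriv A f p (X p) *\<^sub>R Y p + f p *\<^sub>R D X Y p"
    if "smooth_fun A W f" "p \<in> W" for f p
    using *[OF X X Y Y that(1), THEN conjunct2, THEN conjunct2] that(2) by blast+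
qed

lemma connection_sum_left:
  assumes D: "affine_connection A D" and W: "mopen A W" and Y: "smooth_vector_field A W Y"
    and f: "\<And>i. i \<in> I \<Longrightarrow> smooth_fun A W (f i)" and X: "\<And>i. i \<in> I \<Longrightarrow> smooth_vector_field A W (X i)"
    and I: "finite I" and p: "p \<in> W"
  shows "D (\<lambda>q. \<Sum>i\<in>I. f i q *\<^sub>R X i q) Y p = (\<Sum>i\<in>I. f i p *\<^sub>R D (X i) Y p)"
  using I f X
proof (induction I)
  case empty
  have "D (\<lambda>q. 0 *\<^sub>R 0) Y p = 0 *\<^sub>R D (\<lambda>q. 0) Y p"
    using connection_scale_left[OF D W smooth_vector_field_zero Y smooth_fun_const[of W 0] p] .
  then show ?case by (simp only: sum.empty scaleR_zero_left)
next
  case (insert i I)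
  have 1: "smooth_vector_field A W (\<lambda>q. f i q *\<^sub>R X i q)"
    by (rule smooth_vector_field_scaleR[OF W]) (use insert.prems in auto)
  have 2: "smooth_vector_field A W (\<lambda>q. \<Sum>i\<in>I. f i q *\<^sub>R X i q)"
    by (rule smooth_vector_field_sum[OF W], rule smooth_vector_field_scaleR[OF W])
      (use insert.prems in auto)
  have 3: "D (\<lambda>q. f i q *\<^sub>R X i q) Y p = f i p *\<^sub>R D (X i) Y p"
    by (rule connection_scale_left[OF D W _ Y _ p]) (use insert.prems in auto)
  have 4: "D (\<lambda>q. \<Sum>i\<in>I. f i q *\<^sub>R X i q) Y p = (\<Sum>i\<in>I. f i p *\<^sub>R D (X i) Y p)"
    by (rule insert.IH) (use insert.prems in auto)
  show ?case
    unfolding sum.insert[OF insert.hyps] connection_add_left[OF D W 1 Y 2 p] 3 4 ..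
qed

lemma connection_sum_right:
  assumes D: "affine_connection A D" and W: "mopen A W" and X: "smooth_vector_field A W X"
    and f: "\<And>i. i \<in> I \<Longrightarrow> smooth_fun A W (f i)" and Y: "\<And>i. i \<in> I \<Longrightarrow> smooth_vector_field A W (Y i)"
    and I: "finite I" and p: "p \<in> W"
  shows "D X (\<lambda>q. \<Sum>i\<in>I. f i q *\<^sub>R Y i q) p =
    (\<Sum>i\<in>I. dir_deriv A (f i) p (X p) *\<^sub>R Y i p + f i p *\<^sub>R D X (Y i) p)"
  using I f Y
proof (induction I)
  case empty
  \<comment> \<open>Additivity applied to \<open>0 + 0\<close> makes the value at the zero field its
    own double, hence 0.\<close>
  have "D X (\<lambda>q. 0 + 0) p = D X (\<lambda>q. 0) p + D X (\<lambda>q. 0) p"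
    by (rule connection_add_right[OF D W X smooth_vector_field_zero smooth_vector_field_zero p])
  then have "D X (\<lambda>q. 0) p = 0" by (simp only: add_0_left add_cancel_right_left)
  then show ?case by (simp only: sum.empty)
next
  case (insert i I)
  have 1: "smooth_vector_field A W (\<lambda>q. f i q *\<^sub>R Y i q)"
    by (rule smooth_vector_field_scaleR[OF W]) (use insert.prems in auto)
  have 2: "smooth_vector_field A W (\<lambda>q. \<Sum>i\<in>I. f i q *\<^sub>R Y i q)"
    by (rule smooth_vector_field_sum[OF W], rule smooth_vector_field_scaleR[OF W])
      (use insert.prems in auto)
  have 3: "D X (\<lambda>q. f i q *\<^sub>R Y i q) p = dir_deriv A (f i) p (X p) *\<^sub>R Y i p + f i p *\<^sub>R D X (Y i) p"
    by (rule connection_leibniz[OF D W X _ _ p]) (use insert.prems in auto)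
  have 4: "D X (\<lambda>q. \<Sum>i\<in>I. f i q *\<^sub>R Y i q) p =
      (\<Sum>i\<in>I. dir_deriv A (f i) p (X p) *\<^sub>R Y i p + f i p *\<^sub>R D X (Y i) p)"
    by (rule insert.IH) (use insert.prems in auto)
  show ?case
    unfolding sum.insert[OF insert.hyps] connection_add_right[OF D W X 1 2 p] 3 4 ..
qed

lemma smooth_vector_field_coord_has_derivative:
  assumes "smooth_vector_field A W X" "c \<in> A" "p \<in> W" "p \<in> fst c"
  shows "((\<lambda>x. X (chart_inv c x) c) has_derivative
    frechet_derivative (\<lambda>x. X (chart_inv c x) c) (at (snd c p))) (at (snd c p))"
  by (rule smooth_on_has_derivative[OF smooth_vector_field_coord[OF assms(1,2)]]) (use assms in auto)

text \<open>The classical formula dY(X) + \<Gamma>(X, Y). Over \<open>W\<close> intersected with the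
  chart domain both fields are expanded in the coordinate frame; linearity over functions in the
  first argument and the Leibniz rule in the second do the rest.\<close>

theorem connection_coord:
  assumes D: "affine_connection A D" and c: "c \<in> A" and W: "mopen A W"
    and X: "smooth_vector_field A W X" and Y: "smooth_vector_field A W Y"
    and p: "p \<in> W" "p \<in> fst c"
  shows "D X Y p c = frechet_derivative (\<lambda>x. Y (chart_inv c x) c) (at (snd c p)) (X p c) +
    christoffel A D c p (X p c) (Y p c)"
proof -
  define V where "V = W \<inter> fst c"
  have V: "mopen A V" "V \<subseteq> fst c" "V \<subseteq> W" "p \<in> V"
    unfolding V_def using mopen_Int[OF W mopen_chart[OF c]] p by auto
  define E where "E i = (\<lambda>q. tvec_of A c q i)" for i
  have E: "smooth_vector_field A V (E i)" for i
    unfolding E_def using smooth_vector_field_subset[OF smooth_vector_field_frame[OF c] V(2)] .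
  have XV: "smooth_vector_field A V X" and YV: "smooth_vector_field A V Y"
    using smooth_vector_field_subset[OF _ V(3)] X Y by auto
  have fX: "smooth_fun A V (\<lambda>q. X q c \<bullet> i)" and fY: "smooth_fun A V (\<lambda>q. Y q c \<bullet> i)" for i
    using smooth_fun_coord[OF c V(1,2)] XV YV by auto
  have expand: "Z q = (\<Sum>i\<in>Basis. (Z q c \<bullet> i) *\<^sub>R E i q)"
    if "smooth_vector_field A V Z" "q \<in> V" for Z q
    unfolding E_def
    using tangent_frame_expansion[OF c _ smooth_vector_field_tangent[OF that]] that(2) V(2) by blast
  have sX: "smooth_vector_field A V (\<lambda>q. \<Sum>i\<in>Basis. (X q c \<bullet> i) *\<^sub>R E i q)"
    and sY: "smooth_vector_field A V (\<lambda>q. \<Sum>i\<in>Basis. (Y q c \<bullet> i) *\<^sub>R E i q)"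
    by (intro smooth_vector_field_sum[OF V(1)] smooth_vector_field_scaleR[OF V(1)] fX fY E)+
  let ?Y' = "frechet_derivative (\<lambda>x. Y (chart_inv c x) c) (at (snd c p))"
  have Y': "((\<lambda>x. Y (chart_inv c x) c) has_derivative ?Y') (at (snd c p))"
    using smooth_vector_field_coord_has_derivative[OF Y c p] .
  have Ep: "E i p c = i" for i unfolding E_def using tvec_of_coord[OF c p(2)] .
  have dd: "dir_deriv A (\<lambda>q. Y q c \<bullet> j) p (E i p) = ?Y' i \<bullet> j" for i j
    using dir_deriv_eq[OF c p(2) smooth_vector_field_tangent[OF E V(4)]
        bounded_linear.has_derivative[OF bounded_linear_inner_left Y']] Ep by simp
  \<comment> \<open>The field and its expansion are different total functions that agree on
    \<open>V\<close> only, so the locality clause of the connection is what permits the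
    replacement.\<close>
  have 1: "D X Y p = (\<Sum>i\<in>Basis. (X p c \<bullet> i) *\<^sub>R D (E i) Y p)"
    using connection_local[OF D V(1) XV YV sX YV expand[OF XV] refl V(4)]
      connection_sum_left[OF D V(1) YV fX E finite_Basis V(4)] by simp
  have 2: "D (E i) Y p = (\<Sum>j\<in>Basis. (?Y' i \<bullet> j) *\<^sub>R E j p + (Y p c \<bullet> j) *\<^sub>R D (E i) (E j) p)" for i
    using connection_local[OF D V(1) E YV E sY refl expand[OF YV] V(4)]
      connection_sum_right[OF D V(1) E fY E finite_Basis V(4)] dd by simp
  have "D (E i) Y p c = ?Y' i + (\<Sum>j\<in>Basis. (Y p c \<bullet> j) *\<^sub>R D (E i) (E j) p c)" for i
    unfolding 2 by (simp add: sum_fun_apply scaleR_fun_def sum.distrib Ep euclidean_representation)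
  then have "D X Y p c = (\<Sum>i\<in>Basis. (X p c \<bullet> i) *\<^sub>R ?Y' i) + christoffel A D c p (X p c) (Y p c)"
    unfolding 1 christoffel_def E_def[symmetric]
    by (simp add: sum_fun_apply scaleR_fun_def scaleR_add_right sum.distrib scaleR_sum_right)
  then show ?thesis unfolding linear_Basis_expansion[OF has_derivative_linear[OF Y'], symmetric] .
qed

text \<open>Constant coordinates make the derivative term vanish. This identifies
  \<open>christoffel\<close> for arbitrary \<open>v\<close>, \<open>w\<close>, not only for basis
  vectors.\<close>

lemma connection_frame_coord:
  assumes D: "affine_connection A D" and c: "c \<in> A" and p: "p \<in> fst c"
  shows "D (\<lambda>q. tvec_of A c q v) (\<lambda>q. tvec_of A c q w) p c = christoffel A D c p v w"
proof -
  have *: "tvec_of A c (chart_inv c x) w c = w" if "x \<in> snd c ` fst c" for x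
    using tvec_of_coord[OF c chart_inv_in[OF c that subset_refl]] .
  have "frechet_derivative (\<lambda>x. tvec_of A c (chart_inv c x) w c) (at (snd c p)) =
      frechet_derivative (\<lambda>x. w) (at (snd c p))"
    by (rule eq_on_open_frechet(2)[OF open_chart_image[OF c] _ *]) (use p in auto)
  then show ?thesis
    using connection_coord[OF D c mopen_chart[OF c] smooth_vector_field_frame[OF c]
        smooth_vector_field_frame[OF c] p p, of v w]
    by (simp add: tvec_of_coord[OF c p])
qed

lemma connection_in_tangent_space:
  assumes "affine_connection A D" "mopen A W" "smooth_vector_field A W X" "smooth_vector_field A W Y" "p \<in> W"
  shows "D X Y p \<in> tangent_space A p"
  using smooth_vector_field_tangent[OF connection_smooth[OF assms(1-4)] assms(5)] .

text \<open>Covariant derivatives of frame fields are smooth fields. This will give smoothness of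
  the local frames of the planes.\<close>

lemma smooth_on_christoffel:
  assumes D: "affine_connection A D" and c: "c \<in> A" and S: "open S"
    and h: "smooth_on S h" "\<And>x. x \<in> S \<Longrightarrow> h x \<in> snd c ` fst c"
    and v: "smooth_on S v" and w: "smooth_on S w"
  shows "smooth_on S (\<lambda>x. christoffel A D c (chart_inv c (h x)) (v x) (w x))"
  unfolding christoffel_def
proof (intro smooth_on_sum[OF S] smooth_on_scaleR[OF S] smooth_on_mult[OF S] smooth_on_inner_left[OF S] v w)
  fix i j
  have "smooth_on (snd c ` fst c) (\<lambda>x. D (\<lambda>q. tvec_of A c q i) (\<lambda>q. tvec_of A c q j) (chart_inv c x) c)"
    using smooth_vector_field_coord[OF connection_smooth[OF D mopen_chart[OF c]
          smooth_vector_field_frame[OF c] smooth_vector_field_frame[OF c]] c] by simp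
  from smooth_on_compose[OF S open_chart_image[OF c] this h]
  show "smooth_on S (\<lambda>x. D (\<lambda>q. tvec_of A c q i) (\<lambda>q. tvec_of A c q j) (chart_inv c (h x)) c)" .
qed

section \<open>Metrics in a chart, and Koszul's formula\<close>

lemma riemannian_metricD:
  assumes g: "riemannian_metric A g" and c: "c \<in> A" "p \<in> fst c"
    and vw: "v \<in> tangent_space A p" "w \<in> tangent_space A p"
  shows metric_sym: "g p v w = g p w v"
    and metric_pos: "v \<noteq> 0 \<Longrightarrow> g p v v > 0"
    and metric_scale_left: "g p (a *\<^sub>R v) w = a * g p v w"
    and metric_scale_right: "g p v (a *\<^sub>R w) = a * g p v w"
    and metric_add_left: "v' \<in> tangent_space A p \<Longrightarrow> g p (v + v') w = g p v w + g p v' w"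
    and metric_add_right: "v' \<in> tangent_space A p \<Longrightarrow> g p w (v + v') = g p w v + g p w v'"
proof -
  note * = g[unfolded riemannian_metric_def, THEN conjunct1, rule_format, OF mcarrierI[OF c]]
  show sym: "g p v w = g p w v" using *[OF vw] by blast
  show "v \<noteq> 0 \<Longrightarrow> g p v v > 0" using *[OF vw] by blast
  show "g p (a *\<^sub>R v) w = a * g p v w" using *[OF vw] by blast
  have aw: "a *\<^sub>R w \<in> tangent_space A p" using subspace_scale[OF subspace_tangent_space vw(2)] .
  have "g p v (a *\<^sub>R w) = g p (a *\<^sub>R w) v" using *[OF vw(1) aw] by blast
  also have "\<dots> = a * g p w v" using *[OF vw(2,1)] by blast
  finally show "g p v (a *\<^sub>R w) = a * g p v w" using sym by simp
  assume v': "v' \<in> tangent_space A p"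
  show "g p (v + v') w = g p v w + g p v' w" using *[OF vw] v' by blast
  have av: "v + v' \<in> tangent_space A p" using subspace_add[OF subspace_tangent_space vw(1) v'] .
  have "g p w (v + v') = g p (v + v') w" using *[OF vw(2) av] by blast
  also have "\<dots> = g p v w + g p v' w" using *[OF vw] v' by blast
  also have "g p v' w = g p w v'" using *[OF v' vw(2)] by blast
  finally show "g p w (v + v') = g p w v + g p w v'" unfolding sym .
qed

lemma metric_zero:
  assumes "riemannian_metric A g" "c \<in> A" "p \<in> fst c" "v \<in> tangent_space A p"
  shows "g p 0 v = 0" "g p v 0 = 0"
  using metric_scale_left[OF assms(1-3) assms(4,4), of 0] metric_scale_right[OF assms(1-3) assms(4,4), of 0]
  by simp_all

lemma metric_coord_smooth:
  assumes g: "riemannian_metric A g" and c: "c \<in> A"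
  shows "smooth_on (snd c ` fst c) (metric_coord A g c v w)"
proof -
  have "smooth_fun A (fst c) (\<lambda>q. g q (tvec_of A c q v) (tvec_of A c q w))"
    using g[unfolded riemannian_metric_def, THEN conjunct2, rule_format, OF mopen_chart[OF c]
        smooth_vector_field_frame[OF c] smooth_vector_field_frame[OF c]] .
  then have "smooth_on (snd c ` (fst c \<inter> fst c)) ((\<lambda>q. g q (tvec_of A c q v) (tvec_of A c q w)) \<circ> chart_inv c)"
    unfolding smooth_fun_def using c by blast
  then show ?thesis by (simp add: comp_def metric_coord_def[abs_def])
qed

lemma metric_coord_has_derivative:
  assumes g: "riemannian_metric A g" and c: "c \<in> A" "p \<in> fst c"
  shows "(metric_coord A g c v w has_derivative frechet_derivative (metric_coord A g c v w) (at (snd c p))) (at (snd c p))"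
  using smooth_on_has_derivative[OF metric_coord_smooth[OF g c(1)]] c(2) by blast

text \<open>Metricity evaluated on the fields with constant coordinates \<open>v\<close>,
  \<open>w\<close>, differentiated in the constant direction \<open>a\<close>.\<close>

lemma levi_civita_metric_coord:
  assumes g: "riemannian_metric A g" and D: "levi_civita A g D" and c: "c \<in> A" "p \<in> fst c"
  shows "frechet_derivative (metric_coord A g c v w) (at (snd c p)) a =
    g p (tvec_of A c p (christoffel A D c p a v)) (tvec_of A c p w) +
    g p (tvec_of A c p v) (tvec_of A c p (christoffel A D c p a w))"
proof -
  define E where "E i = (\<lambda>q. tvec_of A c q i)" for i
  have E: "smooth_vector_field A (fst c) (E i)" for i
    unfolding E_def using smooth_vector_field_frame[OF c(1)] .
  have conn: "affine_connection A D" using D unfolding levi_civita_def by blast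
  have "dir_deriv A (\<lambda>q. g q (E v q) (E w q)) p (E a p) = g p (D (E a) (E v) p) (E w p) + g p (E v p) (D (E a) (E w) p)"
    using D[unfolded levi_civita_def, THEN conjunct2, rule_format, OF mopen_chart[OF c(1)] E E E c(2)]
    by blast
  moreover have "dir_deriv A (\<lambda>q. g q (E v q) (E w q)) p (E a p) =
      frechet_derivative (metric_coord A g c v w) (at (snd c p)) (E a p c)"
    using metric_coord_has_derivative[OF g c, of v w]
    unfolding metric_coord_def[abs_def] E_def[symmetric]
    by (intro dir_deriv_eq[OF c smooth_vector_field_tangent[OF E c(2)]]) (simp add: E_def)
  moreover have "E a p c = a" unfolding E_def using tvec_of_coord[OF c] .
  moreover have "D (E a) (E v) p = tvec_of A c p (christoffel A D c p a v)" for a v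
    using tvec_of_eq[OF c connection_in_tangent_space[OF conn mopen_chart[OF c(1)] E E c(2)]]
      connection_frame_coord[OF conn c] unfolding E_def by metis
  ultimately show ?thesis unfolding E_def by simp
qed

text \<open>Torsion-freeness: the bracket of two fields with constant coordinates vanishes.\<close>

lemma christoffel_sym:
  assumes D: "levi_civita A g D" and c: "c \<in> A" "p \<in> fst c"
  shows "christoffel A D c p v w = christoffel A D c p w v"
proof -
  define E where "E i = (\<lambda>q. tvec_of A c q i)" for i
  have E: "smooth_vector_field A (fst c) (E i)" for i
    unfolding E_def using smooth_vector_field_frame[OF c(1)] .
  have conn: "affine_connection A D" using D unfolding levi_civita_def by blast
  have "D (E v) (E w) p - D (E w) (E v) p = lie_bracket A (E v) (E w) p"
    using D[unfolded levi_civita_def, THEN conjunct2, rule_format, OF mopen_chart[OF c(1)] E E E c(2)]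
    by blast
  then have "D (E v) (E w) p c - D (E w) (E v) p c = lie_bracket A (E v) (E w) p c"
    by (metis minus_apply)
  moreover have "dir_deriv A (\<lambda>q. E w q c) p (E v p) = 0" for v w
  proof (rule dir_deriv_eq[OF c smooth_vector_field_tangent[OF E c(2)]])
    show "((\<lambda>x. E w (chart_inv c x) c) has_derivative (\<lambda>_. 0)) (at (snd c p))"
    proof (rule has_derivative_transform_within_open[OF has_derivative_const open_chart_image[OF c(1)]])
      show "w = E w (chart_inv c x) c" if "x \<in> snd c ` fst c" for x
        unfolding E_def using tvec_of_coord[OF c(1) chart_inv_in[OF c(1) that subset_refl], symmetric] .
    qed (use c in auto)
  qed
  ultimately show ?thesis
    unfolding lie_bracket_def using c connection_frame_coord[OF conn c] E_def by simp
qed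

text \<open>Metricity expands the three derivatives into six pairings; symmetry of the Christoffel
  symbols and of the metric cancels four of them. No bracket terms occur because the fields have
  constant coordinates.\<close>

theorem koszul_coord:
  assumes g: "riemannian_metric A g" and D: "levi_civita A g D" and c: "c \<in> A" "p \<in> fst c"
  shows "2 * g p (tvec_of A c p (christoffel A D c p a b)) (tvec_of A c p z) =
    frechet_derivative (metric_coord A g c b z) (at (snd c p)) a +
    frechet_derivative (metric_coord A g c a z) (at (snd c p)) b -
    frechet_derivative (metric_coord A g c a b) (at (snd c p)) z"
  unfolding levi_civita_metric_coord[OF assms]
  using christoffel_sym[OF D c] metric_sym[OF g c tvec_of_in[OF c] tvec_of_in[OF c]]
  by (smt (verit))

end

section \<open>The total space of the tangent bundle\<close>

lemma smooth_on_fst: "open S \<Longrightarrow> smooth_on S fst"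
  using smooth_on_bounded_linear[OF _ bounded_linear_fst smooth_on_ident, of S] by simp

lemma smooth_on_snd: "open S \<Longrightarrow> smooth_on S snd"
  using smooth_on_bounded_linear[OF _ bounded_linear_snd smooth_on_ident, of S] by simp

lemma fst_tangent_chart: "u \<in> fst (tangent_chart A c) \<longleftrightarrow> u \<in> TM A \<and> fst u \<in> fst c"
  unfolding tangent_chart_def by simp

lemma snd_tangent_chart: "snd (tangent_chart A c) u = (snd c (fst u), snd u c)"
  unfolding tangent_chart_def by simp

lemma TM_iff: "u \<in> TM A \<longleftrightarrow> fst u \<in> mcarrier A \<and> snd u \<in> tangent_space A (fst u)"
  unfolding TM_def by (cases u) simp

lemma tangent_atlasE:
  assumes "d \<in> tangent_atlas A"
  obtains c where "c \<in> A" "d = tangent_chart A c"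
  using assms unfolding tangent_atlas_def by blast

lemma tangent_atlasI: "c \<in> A \<Longrightarrow> tangent_chart A c \<in> tangent_atlas A"
  unfolding tangent_atlas_def by blast

context smooth_atlas
begin

text \<open>Every coordinate vector is realised at every point through \<open>tvec_of\<close>, so
  the image is a full product. Openness of chart images and overlaps in the total space follows from
  this.\<close>

lemma tangent_chart_image:
  assumes c: "c \<in> A" and S: "S \<subseteq> fst c"
  shows "snd (tangent_chart A c) ` {u \<in> TM A. fst u \<in> S} = (snd c ` S) \<times> UNIV"
proof (intro subset_antisym subsetI)
  fix z assume "z \<in> (snd c ` S) \<times> (UNIV :: 'n set)"
  then obtain p y where z: "z = (snd c p, y)" "p \<in> S" by (cases z) auto
  then have p: "p \<in> fst c" using S by blast
  have "(p, tvec_of A c p y) \<in> TM A"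
    unfolding TM_iff using mcarrierI[OF c p] tvec_of_in[OF c p] by simp
  moreover have "snd (tangent_chart A c) (p, tvec_of A c p y) = z"
    by (simp add: snd_tangent_chart tvec_of_coord[OF c p] z)
  ultimately show "z \<in> snd (tangent_chart A c) ` {u \<in> TM A. fst u \<in> S}" using z(2) by force
qed (auto simp: snd_tangent_chart)

lemma tangent_chart_inj:
  assumes "c \<in> A"
  shows "inj_on (snd (tangent_chart A c)) (fst (tangent_chart A c))"
proof (rule inj_onI)
  fix u v assume uv: "u \<in> fst (tangent_chart A c)" "v \<in> fst (tangent_chart A c)"
    and eq: "snd (tangent_chart A c) u = snd (tangent_chart A c) v"
  then have "fst u = fst v"
    using inj_onD[OF chart_inj[OF assms]] unfolding fst_tangent_chart snd_tangent_chart by blast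
  moreover from this have "snd u = snd v"
    using uv eq by (intro tangent_eqI[OF assms, of "fst v"])
      (simp_all add: fst_tangent_chart snd_tangent_chart TM_iff)
  ultimately show "u = v" by (rule prod_eqI)
qed

lemma chart_inv_tangent_chart:
  assumes c: "c \<in> A" and x: "x \<in> snd c ` fst c"
  shows "chart_inv (tangent_chart A c) (x, y) = (chart_inv c x, tvec_of A c (chart_inv c x) y)"
proof -
  have p: "chart_inv c x \<in> fst c" using chart_inv_in[OF c x subset_refl] .
  show ?thesis
    unfolding chart_inv_def[of "tangent_chart A c"]
  proof (rule inv_into_f_eq[OF tangent_chart_inj[OF c]])
    show "(chart_inv c x, tvec_of A c (chart_inv c x) y) \<in> fst (tangent_chart A c)"
      unfolding fst_tangent_chart TM_iff using mcarrierI[OF c p] tvec_of_in[OF c p] p by simp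
    show "snd (tangent_chart A c) (chart_inv c x, tvec_of A c (chart_inv c x) y) = (x, y)"
      by (simp add: snd_tangent_chart tvec_of_coord[OF c p] chart_inv_right[OF c x])
  qed
qed

lemma tangent_chart_domain_image:
  "c \<in> A \<Longrightarrow> snd (tangent_chart A c) ` fst (tangent_chart A c) = (snd c ` fst c) \<times> UNIV"
  using tangent_chart_image[OF _ subset_refl] unfolding tangent_chart_def by simp

lemma tangent_chart_overlap:
  assumes "c \<in> A"
  shows "snd (tangent_chart A c) ` (fst (tangent_chart A c) \<inter> fst (tangent_chart A d)) =
    (snd c ` (fst c \<inter> fst d)) \<times> UNIV"
proof -
  have "fst (tangent_chart A c) \<inter> fst (tangent_chart A d) = {u \<in> TM A. fst u \<in> fst c \<inter> fst d}"
    by (auto simp: fst_tangent_chart)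
  then show ?thesis using tangent_chart_image[OF assms, of "fst c \<inter> fst d"] by simp
qed

lemma tangent_chart_transition:
  assumes c: "c \<in> A" and d: "d \<in> A" and z: "fst z \<in> snd c ` (fst c \<inter> fst d)"
  shows "snd (tangent_chart A d) (chart_inv (tangent_chart A c) z) =
    ((snd d \<circ> chart_inv c) (fst z), frechet_derivative (snd d \<circ> chart_inv c) (at (fst z)) (snd z))"
proof -
  have p: "chart_inv c (fst z) \<in> fst c" "chart_inv c (fst z) \<in> fst d"
    using chart_inv_in[OF c z] by auto
  have x: "fst z \<in> snd c ` fst c" using z by blast
  have "chart_inv (tangent_chart A c) z = (chart_inv c (fst z), tvec_of A c (chart_inv c (fst z)) (snd z))"
    using chart_inv_tangent_chart[OF c x, of "snd z"] by simp
  then show ?thesis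
    by (simp add: snd_tangent_chart tvec_of_def d p chart_inv_right[OF c x])
qed

text \<open>A transition map of the total space sends (x, y) to the transformed point and to the
  derivative at \<open>x\<close> applied to \<open>y\<close>; both components are smooth on the
  overlap times the model space.\<close>

lemma smooth_atlas_tangent_atlas: "smooth_atlas (tangent_atlas A)"
proof
  fix c' assume "c' \<in> tangent_atlas A"
  then obtain c where c: "c \<in> A" and c': "c' = tangent_chart A c" by (rule tangent_atlasE)
  show "is_chart c'"
    unfolding is_chart_def c' tangent_chart_domain_image[OF c]
    using tangent_chart_inj[OF c] open_Times[OF open_chart_image[OF c] open_UNIV] by blast
  fix d' assume "d' \<in> tangent_atlas A"
  then obtain d where d: "d \<in> A" and d': "d' = tangent_chart A d" by (rule tangent_atlasE)
  let ?S = "(snd c ` (fst c \<inter> fst d)) \<times> (UNIV :: 'n set)"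
  have oS: "open ?S" using open_Times[OF open_chart_overlap[OF c d] open_UNIV] .
  have in1: "fst z \<in> snd c ` (fst c \<inter> fst d)" if "z \<in> ?S" for z using that by auto
  have 1: "smooth_on ?S (\<lambda>z. (snd d \<circ> chart_inv c) (fst z))"
    using smooth_on_compose[OF oS open_chart_overlap[OF c d] smooth_on_transition[OF c d] smooth_on_fst[OF oS] in1] .
  have 2: "smooth_on ?S (\<lambda>z. frechet_derivative (snd d \<circ> chart_inv c) (at (fst z)) (snd z))"
    using smooth_on_frechet_vector[OF open_chart_overlap[OF c d] smooth_on_transition[OF c d]
        smooth_on_fst[OF oS] smooth_on_snd[OF oS] oS in1] .
  have eq: "(snd d' \<circ> chart_inv c') z = ((snd d \<circ> chart_inv c) (fst z),
      frechet_derivative (snd d \<circ> chart_inv c) (at (fst z)) (snd z))" if "z \<in> ?S" for z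
    using tangent_chart_transition[OF c d in1[OF that]] unfolding c' d' by simp
  show "smooth_transition c' d'"
    unfolding smooth_transition_def
  proof
    show "open (snd c' ` (fst c' \<inter> fst d'))"
      unfolding c' d' tangent_chart_overlap[OF c] by (rule oS)
    show "smooth_on (snd c' ` (fst c' \<inter> fst d')) (snd d' \<circ> chart_inv c')"
      unfolding tangent_chart_overlap[OF c, of d, folded c' d']
      by (rule iffD2[OF smooth_on_cong[OF oS eq] smooth_on_Pair[OF oS 1 2]])
  qed
qed

lemma velocity_in_tangent_space:
  assumes h: "\<And>d. d \<in> A \<Longrightarrow> h t \<in> fst d \<Longrightarrow> (\<lambda>y. snd d (h y)) differentiable (at t)"
    and nb: "\<And>d. d \<in> A \<Longrightarrow> h t \<in> fst d \<Longrightarrow> \<exists>S. open S \<and> t \<in> S \<and> (\<forall>y\<in>S. h y \<in> fst d)"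
  shows "velocity A h t \<in> tangent_space A (h t)"
proof -
  have 1: "((\<lambda>y. snd d (h y)) has_derivative (\<lambda>r. r *\<^sub>R vector_derivative (\<lambda>y. snd d (h y)) (at t))) (at t)"
    if "d \<in> A" "h t \<in> fst d" for d
    using h[OF that] unfolding vector_derivative_works has_vector_derivative_def .
  from derivative_in_tangent_space[of h, OF 1 nb, of 1]
  show ?thesis unfolding velocity_def comp_def scaleR_one .
qed

text \<open>Makes every chart result available a second time, for the total space, under the prefix
  \<open>T\<close>.\<close>

interpretation T: smooth_atlas "tangent_atlas A"
  by (rule smooth_atlas_tangent_atlas)

lemma mcarrier_tangent_atlas: "mcarrier (tangent_atlas A) = TM A"
  unfolding mcarrier_def tangent_atlas_def by (auto simp: fst_tangent_chart TM_iff mcarrier_def)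

lemma TM_E:
  assumes "u \<in> TM A"
  obtains c where "c \<in> A" "u \<in> fst (tangent_chart A c)"
  using assms unfolding TM_iff mcarrier_def fst_tangent_chart by blast

section \<open>The projection, vertical vectors and differentials of sections\<close>

lemma differential_fst:
  assumes c: "c \<in> A" and u: "u \<in> fst (tangent_chart A c)"
    and \<xi>: "\<xi> \<in> tangent_space (tangent_atlas A) u"
  shows "differential (tangent_atlas A) A fst u \<xi> = tvec_of A c (fst u) (fst (\<xi> (tangent_chart A c)))"
proof
  fix d :: "('a, 'n) chart"
  have p: "fst u \<in> fst c" using u unfolding fst_tangent_chart by blast
  let ?T = "frechet_derivative (snd d \<circ> chart_inv c) (at (snd c (fst u)))"
  have "dir_deriv (tangent_atlas A) (snd d \<circ> fst) u \<xi> = ?T (fst (\<xi> (tangent_chart A c)))"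
    if d: "d \<in> A" "fst u \<in> fst d"
  proof (rule T.dir_deriv_eq[OF tangent_atlasI[OF c] u \<xi>])
    have oS: "open ((snd c ` (fst c \<inter> fst d)) \<times> (UNIV :: 'n set))"
      using open_Times[OF open_chart_overlap[OF c d(1)] open_UNIV] .
    have "((\<lambda>z. (snd d \<circ> chart_inv c) (fst z)) has_derivative (\<lambda>v. ?T (fst v))) (at (snd (tangent_chart A c) u))"
      by (rule has_derivative_compose[OF bounded_linear.has_derivative[OF bounded_linear_fst has_derivative_ident]])
        (simp only: snd_tangent_chart fst_conv transition_has_derivative[OF c d(1) p d(2)])
    then show "((\<lambda>z. (snd d \<circ> fst) (chart_inv (tangent_chart A c) z)) has_derivative (\<lambda>v. ?T (fst v)))
        (at (snd (tangent_chart A c) u))"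
    proof (rule has_derivative_transform_within_open[OF _ oS])
      show "snd (tangent_chart A c) u \<in> snd c ` (fst c \<inter> fst d) \<times> UNIV"
        using p d by (simp add: snd_tangent_chart)
      fix z assume "z \<in> snd c ` (fst c \<inter> fst d) \<times> (UNIV :: 'n set)"
      then have "fst z \<in> snd c ` (fst c \<inter> fst d)" by auto
      from tangent_chart_transition[OF c d(1) this]
      show "(snd d \<circ> chart_inv c) (fst z) = (snd d \<circ> fst) (chart_inv (tangent_chart A c) z)"
        by (simp add: snd_tangent_chart)
    qed
  qed
  then show "differential (tangent_atlas A) A fst u \<xi> d = tvec_of A c (fst u) (fst (\<xi> (tangent_chart A c))) d"
    unfolding differential_def tvec_of_def by simp
qed

lemma vertical_iff:
  assumes c: "c \<in> A" and u: "u \<in> fst (tangent_chart A c)"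
  shows "\<xi> \<in> vertical A u \<longleftrightarrow> \<xi> \<in> tangent_space (tangent_atlas A) u \<and> fst (\<xi> (tangent_chart A c)) = 0"
proof -
  have p: "fst u \<in> fst c" using u unfolding fst_tangent_chart by blast
  have "tvec_of A c (fst u) x = 0 \<longleftrightarrow> x = 0" for x
    using linear_0[OF linear_tvec_of[OF c p]] tvec_of_coord[OF c p, of x] zero_fun_apply by metis
  then show ?thesis
    unfolding vertical_def mem_Collect_eq using differential_fst[OF c u] by metis
qed

text \<open>The curve defining the lift is affine in every tangent chart and never leaves the fibre,
  so its velocity there is (0, w).\<close>

lemma vlift_coord:
  assumes u: "u \<in> TM A" and w: "w \<in> tangent_space A (fst u)"
  shows vlift_in: "vlift A u w \<in> tangent_space (tangent_atlas A) u"
    and "c \<in> A \<Longrightarrow> u \<in> fst (tangent_chart A c) \<Longrightarrow> vlift A u w (tangent_chart A c) = (0, w c)"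
proof -
  define h where "h t = (fst u, snd u + t *\<^sub>R w)" for t :: real
  have h0: "h 0 = u" unfolding h_def by simp
  have hTM: "h t \<in> TM A" for t
    using u subspace_add[OF subspace_tangent_space _ subspace_scale[OF subspace_tangent_space w]]
    unfolding TM_iff h_def by simp
  have hd: "((\<lambda>y. snd (tangent_chart A c) (h y)) has_vector_derivative (0, w c)) (at t)" for c t
    unfolding h_def snd_tangent_chart has_vector_derivative_def
    by (auto simp: scaleR_fun_def intro!: derivative_eq_intros)
  have "velocity (tangent_atlas A) h 0 \<in> tangent_space (tangent_atlas A) (h 0)"
  proof (rule T.velocity_in_tangent_space)
    fix d assume d: "d \<in> tangent_atlas A" "h 0 \<in> fst d"
    then obtain c where c: "d = tangent_chart A c" by (auto elim: tangent_atlasE)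
    show "(\<lambda>y. snd d (h y)) differentiable at 0"
      unfolding c by (rule differentiableI_vector[OF hd])
    have "\<forall>y. h y \<in> fst d"
      using d(2) hTM unfolding c fst_tangent_chart by (simp add: h_def)
    then show "\<exists>S. open S \<and> 0 \<in> S \<and> (\<forall>y\<in>S. h y \<in> fst d)" by (intro exI[of _ UNIV]) simp
  qed
  then show "vlift A u w \<in> tangent_space (tangent_atlas A) u"
    unfolding vlift_def h0 unfolding h_def .
  assume c: "c \<in> A" "u \<in> fst (tangent_chart A c)"
  have "velocity (tangent_atlas A) h 0 (tangent_chart A c) = (0, w c)"
    unfolding velocity_def comp_def using tangent_atlasI[OF c(1)] c(2) h0
    by (simp add: vector_derivative_at[OF hd])
  then show "vlift A u w (tangent_chart A c) = (0, w c)"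
    unfolding vlift_def h_def .
qed

text \<open>Two charts occur because a differential has entries in all tangent charts
  \<open>d\<close>, while its argument is differentiated in one chart \<open>c\<close> of the
  base.\<close>

lemma section_has_derivative:
  assumes c: "c \<in> A" and d: "d \<in> A" and W: "mopen A W" and Y: "smooth_vector_field A W Y"
    and p: "p \<in> W" "p \<in> fst c" "p \<in> fst d"
  defines "T \<equiv> frechet_derivative (snd d \<circ> chart_inv c) (at (snd c p))"
  shows "((\<lambda>x. snd (tangent_chart A d) (chart_inv c x, Y (chart_inv c x))) has_derivative
    (\<lambda>v. (T v, frechet_derivative (\<lambda>x. Y (chart_inv d x) d) (at (snd d p)) (T v)))) (at (snd c p))"
proof -
  let ?S = "snd c ` (fst c \<inter> fst d)"
  let ?Y' = "frechet_derivative (\<lambda>x. Y (chart_inv d x) d) (at (snd d p))"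
  have pS: "snd c p \<in> ?S" using p by blast
  have T: "((snd d \<circ> chart_inv c) has_derivative T) (at (snd c p))"
    unfolding T_def by (rule transition_has_derivative[OF c d p(2,3)])
  have "((\<lambda>x. Y (chart_inv d ((snd d \<circ> chart_inv c) x)) d) has_derivative (\<lambda>v. ?Y' (T v))) (at (snd c p))"
    by (rule has_derivative_compose[OF T])
      (use smooth_vector_field_coord_has_derivative[OF Y d p(1,3)] in \<open>simp add: chart_inv_left c p\<close>)
  from has_derivative_Pair[OF T this]
  show ?thesis
  proof (rule has_derivative_transform_within_open[OF _ open_chart_overlap[OF c d] pS])
    fix x assume x: "x \<in> ?S"
    then have "chart_inv c x \<in> fst d" using chart_inv_in[OF c x] by blast
    then show "((snd d \<circ> chart_inv c) x, Y (chart_inv d ((snd d \<circ> chart_inv c) x)) d) =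
        snd (tangent_chart A d) (chart_inv c x, Y (chart_inv c x))"
      by (simp add: snd_tangent_chart chart_inv_left d)
  qed
qed

lemma smooth_vector_field_section_in_TM:
  "c \<in> A \<Longrightarrow> smooth_vector_field A W Y \<Longrightarrow> q \<in> W \<Longrightarrow> q \<in> fst c \<Longrightarrow> (q, Y q) \<in> TM A"
  unfolding TM_iff using smooth_vector_field_tangent mcarrierI by simp

text \<open>In a chart the section is the graph of the coordinate function of \<open>Y\<close>,
  hence the pair as derivative. Compatibility of the entries comes from differentiating the
  composite of the section with the inverse chart.\<close>

lemma section_differential:
  assumes W: "mopen A W" and Y: "smooth_vector_field A W Y" and p: "p \<in> W"
    and v: "v \<in> tangent_space A p"
  defines "\<xi> \<equiv> differential A (tangent_atlas A) (\<lambda>q. (q, Y q)) p v"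
  shows section_differential_in: "\<xi> \<in> tangent_space (tangent_atlas A) (p, Y p)"
    and section_differential_coord: "c \<in> A \<Longrightarrow> p \<in> fst c \<Longrightarrow> \<xi> (tangent_chart A c) =
      (v c, frechet_derivative (\<lambda>x. Y (chart_inv c x) c) (at (snd c p)) (v c))"
proof -
  have in_TM: "(q, Y q) \<in> TM A" if "q \<in> W" "q \<in> fst c" "c \<in> A" for q c
    using smooth_vector_field_section_in_TM[OF that(3) Y that(1,2)] .
  have val: "\<xi> d = frechet_derivative (\<lambda>x. snd d (chart_inv c x, Y (chart_inv c x))) (at (snd c p)) (v c)"
    and dv: "((\<lambda>x. snd d (chart_inv c x, Y (chart_inv c x))) has_derivative
      frechet_derivative (\<lambda>x. snd d (chart_inv c x, Y (chart_inv c x))) (at (snd c p))) (at (snd c p))"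
    if cd: "c \<in> A" "p \<in> fst c" "d \<in> tangent_atlas A" "(p, Y p) \<in> fst d" for c d
  proof -
    obtain d0 where d0: "d0 \<in> A" "d = tangent_chart A d0" using tangent_atlasE[OF cd(3)] .
    have pd0: "p \<in> fst d0" using cd(4) unfolding d0(2) fst_tangent_chart by simp
    note * = section_has_derivative[OF cd(1) d0(1) W Y p cd(2) pd0, folded d0(2)]
    show dv: "((\<lambda>x. snd d (chart_inv c x, Y (chart_inv c x))) has_derivative
      frechet_derivative (\<lambda>x. snd d (chart_inv c x, Y (chart_inv c x))) (at (snd c p))) (at (snd c p))"
      using * has_derivative_imp_frechet[OF *] by simp
    have "dir_deriv A (snd d \<circ> (\<lambda>q. (q, Y q))) p v =
      frechet_derivative (\<lambda>x. snd d (chart_inv c x, Y (chart_inv c x))) (at (snd c p)) (v c)"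
      by (rule dir_deriv_eq[OF cd(1,2) v]) (use dv in simp)
    then show "\<xi> d = frechet_derivative (\<lambda>x. snd d (chart_inv c x, Y (chart_inv c x))) (at (snd c p)) (v c)"
      unfolding \<xi>_def differential_def using cd(3,4) by simp
  qed
  show "\<xi> \<in> tangent_space (tangent_atlas A) (p, Y p)"
  proof -
    obtain c where c: "c \<in> A" "p \<in> fst c"
      using W p unfolding mopen_def mcarrier_def by blast
    let ?h = "\<lambda>x. (chart_inv c x, Y (chart_inv c x))"
    have hp: "?h (snd c p) = (p, Y p)" using chart_inv_left[OF c] by simp
    have "(\<lambda>d. if d \<in> tangent_atlas A \<and> ?h (snd c p) \<in> fst d
        then frechet_derivative (\<lambda>x. snd d (?h x)) (at (snd c p)) (v c) else 0)
      \<in> tangent_space (tangent_atlas A) (?h (snd c p))"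
    proof (rule T.derivative_in_tangent_space)
      fix d assume d: "d \<in> tangent_atlas A" "?h (snd c p) \<in> fst d"
      show "((\<lambda>x. snd d (?h x)) has_derivative frechet_derivative (\<lambda>x. snd d (?h x)) (at (snd c p))) (at (snd c p))"
        using dv[OF c d(1)] d(2) unfolding hp by blast
      obtain d0 where d0: "d0 \<in> A" "d = tangent_chart A d0" using tangent_atlasE[OF d(1)] .
      have pd0: "p \<in> fst d0" using d(2) unfolding hp d0(2) fst_tangent_chart by simp
      \<comment> \<open>The section lies in the domain of \<open>d\<close> wherever it is defined
        and the base point lies in the domain of \<open>d0\<close>; this open set is the required
        neighbourhood.\<close>
      have o: "open (snd c ` (W \<inter> fst d0 \<inter> fst c))"
        by (rule mopen_open[OF mopen_Int[OF W mopen_chart[OF d0(1)]] c(1)])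
      have "?h x \<in> fst d" if x: "x \<in> snd c ` (W \<inter> fst d0 \<inter> fst c)" for x
      proof -
        have "chart_inv c x \<in> W \<inter> fst d0 \<inter> fst c" by (rule chart_inv_in[OF c(1) x]) blast
        then show ?thesis unfolding d0(2) fst_tangent_chart using in_TM[OF _ _ d0(1)] by simp
      qed
      then show "\<exists>S. open S \<and> snd c p \<in> S \<and> (\<forall>x\<in>S. ?h x \<in> fst d)"
        using o p pd0 c by (intro exI[of _ "snd c ` (W \<inter> fst d0 \<inter> fst c)"]) blast
    qed
    moreover have "\<xi> = (\<lambda>d. if d \<in> tangent_atlas A \<and> ?h (snd c p) \<in> fst d
        then frechet_derivative (\<lambda>x. snd d (?h x)) (at (snd c p)) (v c) else 0)"
    proof
      fix d
      show "\<xi> d = (if d \<in> tangent_atlas A \<and> ?h (snd c p) \<in> fst d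
        then frechet_derivative (\<lambda>x. snd d (?h x)) (at (snd c p)) (v c) else 0)"
      proof (cases "d \<in> tangent_atlas A \<and> (p, Y p) \<in> fst d")
        case True
        then show ?thesis unfolding hp using val[OF c, of d] by simp
      next
        case False
        then show ?thesis by (simp only: hp \<xi>_def differential_def if_False)
      qed
    qed
    ultimately show ?thesis unfolding hp by simp
  qed
  assume c: "c \<in> A" "p \<in> fst c"
  have "(p, Y p) \<in> fst (tangent_chart A c)"
    unfolding fst_tangent_chart using in_TM[OF p c(2,1)] c by simp
  from val[OF c tangent_atlasI[OF c(1)] this]
  show "\<xi> (tangent_chart A c) = (v c, frechet_derivative (\<lambda>x. Y (chart_inv c x) c) (at (snd c p)) (v c))"
    unfolding has_derivative_imp_frechet[OF section_has_derivative[OF c(1,1) W Y p c(2,2)]]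
    by (simp add: transition_self[OF c])
qed

text \<open>The condition that \<open>D X Y\<close> vanishes at the base point reads dY(X) +
  \<Gamma>(X, u) = 0, and dY(X) is the fibre component of the differential of the section.\<close>

lemma horizontalD:
  assumes D: "affine_connection A D" and c: "c \<in> A" and u: "u \<in> fst (tangent_chart A c)"
    and \<xi>: "\<xi> \<in> horizontal A D u"
  shows "\<xi> \<in> tangent_space (tangent_atlas A) u"
    and "snd (\<xi> (tangent_chart A c)) = - christoffel A D c (fst u) (fst (\<xi> (tangent_chart A c))) (snd u c)"
proof -
  have pc: "fst u \<in> fst c" using u unfolding fst_tangent_chart by blast
  obtain W X Y where \<xi>_eq: "\<xi> = differential A (tangent_atlas A) (\<lambda>q. (q, Y q)) (fst u) (X (fst u))"
    and W: "mopen A W" and p: "fst u \<in> W" and X: "smooth_vector_field A W X"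
    and Y: "smooth_vector_field A W Y" and Yu: "Y (fst u) = snd u" and D0: "D X Y (fst u) = 0"
    using \<xi> unfolding horizontal_def by blast
  have Xp: "X (fst u) \<in> tangent_space A (fst u)" using smooth_vector_field_tangent[OF X p] .
  show "\<xi> \<in> tangent_space (tangent_atlas A) u"
    using section_differential_in[OF W Y p Xp] unfolding \<xi>_eq Yu by simp
  have "0 = D X Y (fst u) c" unfolding D0 by simp
  also have "\<dots> = frechet_derivative (\<lambda>x. Y (chart_inv c x) c) (at (snd c (fst u))) (X (fst u) c) +
      christoffel A D c (fst u) (X (fst u) c) (snd u c)"
    using connection_coord[OF D c W X Y p pc] unfolding Yu .
  finally have "frechet_derivative (\<lambda>x. Y (chart_inv c x) c) (at (snd c (fst u))) (X (fst u) c) =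
      - christoffel A D c (fst u) (X (fst u) c) (snd u c)"
    by (simp add: eq_neg_iff_add_eq_0)
  then show "snd (\<xi> (tangent_chart A c)) = - christoffel A D c (fst u) (fst (\<xi> (tangent_chart A c))) (snd u c)"
    using section_differential_coord[OF W Y p Xp c pc] unfolding \<xi>_eq by simp
qed

text \<open>The section witnessing horizontality is affine in the chart; its slope is chosen so that
  its covariant derivative in direction \<open>s\<close> vanishes (for \<open>s = 0\<close> the quotient by 0 is harmless,
  since then the Christoffel term vanishes).\<close>

lemma horizontalI:
  assumes D: "affine_connection A D" and c: "c \<in> A" and u: "u \<in> fst (tangent_chart A c)"
    and \<xi>: "\<xi> \<in> tangent_space (tangent_atlas A) u"
    and coord: "snd (\<xi> (tangent_chart A c)) = - christoffel A D c (fst u) (fst (\<xi> (tangent_chart A c))) (snd u c)"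
  shows "\<xi> \<in> horizontal A D u"
proof -
  have pc: "fst u \<in> fst c" and uT: "u \<in> TM A" using u unfolding fst_tangent_chart by auto
  have su: "snd u \<in> tangent_space A (fst u)" using uT unfolding TM_iff by blast
  define s where "s = fst (\<xi> (tangent_chart A c))"
  define G where "G = christoffel A D c (fst u) s (snd u c)"
  define h where "h x = snd u c + (((x - snd c (fst u)) \<bullet> s) / (s \<bullet> s)) *\<^sub>R (- G)" for x
  define Y where "Y = (\<lambda>q. tvec_of A c q (h (snd c q)))"
  define X where "X = (\<lambda>q. tvec_of A c q s)"
  note o = open_chart_image[OF c]
  have hd: "(h has_derivative (\<lambda>v. ((v \<bullet> s) / (s \<bullet> s)) *\<^sub>R (- G))) (at x)" for x
    unfolding h_def by (auto intro!: derivative_eq_intros simp: divide_inverse)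
  have hs: "smooth_on (snd c ` fst c) h"
  proof -
    have "smooth_on (snd c ` fst c) (\<lambda>x. (x \<bullet> s) *\<^sub>R ((1 / (s \<bullet> s)) *\<^sub>R (- G)) +
        (snd u c - ((snd c (fst u) \<bullet> s) / (s \<bullet> s)) *\<^sub>R (- G)))"
      by (intro smooth_on_add[OF o] smooth_on_scaleR[OF o] smooth_on_inner_left[OF o]
          smooth_on_ident[OF o] smooth_on_const)
    moreover have "(\<lambda>x. (x \<bullet> s) *\<^sub>R ((1 / (s \<bullet> s)) *\<^sub>R (- G)) +
        (snd u c - ((snd c (fst u) \<bullet> s) / (s \<bullet> s)) *\<^sub>R (- G))) = h"
      unfolding h_def by (auto simp: fun_eq_iff inner_diff_left diff_divide_distrib algebra_simps)
    ultimately show ?thesis by simp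
  qed
  have Y: "smooth_vector_field A (fst c) Y"
    unfolding Y_def by (rule smooth_vector_field_tvec_of[OF c mopen_chart[OF c] subset_refl hs])
  have X: "smooth_vector_field A (fst c) X"
    unfolding X_def by (rule smooth_vector_field_frame[OF c])
  have Xp: "X (fst u) \<in> tangent_space A (fst u)" using smooth_vector_field_tangent[OF X pc] .
  have Xc: "X (fst u) c = s" unfolding X_def by (rule tvec_of_coord[OF c pc])
  have Yu: "Y (fst u) = snd u"
    unfolding Y_def h_def using tvec_of_eq[OF c pc su] by simp
  have "h x = Y (chart_inv c x) c" if "x \<in> snd c ` fst c" for x
    unfolding Y_def
    using tvec_of_coord[OF c chart_inv_in[OF c that subset_refl]] chart_inv_right[OF c that] by simp
  then have "((\<lambda>x. Y (chart_inv c x) c) has_derivative (\<lambda>v. ((v \<bullet> s) / (s \<bullet> s)) *\<^sub>R (- G))) (at (snd c (fst u)))"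
    by (intro has_derivative_transform_within_open[OF hd o]) (use pc in auto)
  from has_derivative_imp_frechet[OF this]
  have Y': "frechet_derivative (\<lambda>x. Y (chart_inv c x) c) (at (snd c (fst u))) s = - G"
    by (cases "s = 0") (simp_all add: G_def christoffel_simps)
  have "D X Y (fst u) c = 0"
    using connection_coord[OF D c mopen_chart[OF c] X Y pc pc] Y' unfolding Xc Yu G_def by simp
  then have D0: "D X Y (fst u) = 0"
    by (intro tangent_eqI[OF c pc connection_in_tangent_space[OF D mopen_chart[OF c] X Y pc]
          subspace_0[OF subspace_tangent_space]]) simp
  have "\<xi> = differential A (tangent_atlas A) (\<lambda>q. (q, Y q)) (fst u) (X (fst u))"
  proof (rule T.tangent_eqI[OF tangent_atlasI[OF c] u \<xi>])
    show "differential A (tangent_atlas A) (\<lambda>q. (q, Y q)) (fst u) (X (fst u)) \<in> tangent_space (tangent_atlas A) u"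
      using section_differential_in[OF mopen_chart[OF c] Y pc Xp] unfolding Yu by simp
    show "\<xi> (tangent_chart A c) =
        differential A (tangent_atlas A) (\<lambda>q. (q, Y q)) (fst u) (X (fst u)) (tangent_chart A c)"
      unfolding section_differential_coord[OF mopen_chart[OF c] Y pc Xp c pc] Xc Y'
      using coord unfolding s_def G_def by (intro prod_eqI) simp_all
  qed
  then show ?thesis
    unfolding horizontal_def using mopen_chart[OF c] pc X Y Yu D0 by blast
qed

text \<open>Resolves the definite description: a horizontal vector over \<open>w\<close> must have
  coordinates (w, -\<Gamma>(w, u)), and the vector with these coordinates is horizontal.\<close>

lemma hlift_coord:
  assumes D: "affine_connection A D" and c: "c \<in> A" and u: "u \<in> fst (tangent_chart A c)"
    and w: "w \<in> tangent_space A (fst u)"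
  shows hlift_horizontal: "hlift A D u w \<in> horizontal A D u"
    and hlift_in: "hlift A D u w \<in> tangent_space (tangent_atlas A) u"
    and hlift_chart: "hlift A D u w (tangent_chart A c) = (w c, - christoffel A D c (fst u) (w c) (snd u c))"
proof -
  have pc: "fst u \<in> fst c" using u unfolding fst_tangent_chart by blast
  note tc = tangent_atlasI[OF c]
  let ?z = "(w c, - christoffel A D c (fst u) (w c) (snd u c))"
  define \<xi> where "\<xi> = tvec_of (tangent_atlas A) (tangent_chart A c) u ?z"
  have \<xi>: "\<xi> \<in> tangent_space (tangent_atlas A) u" unfolding \<xi>_def by (rule T.tvec_of_in[OF tc u])
  have \<xi>c: "\<xi> (tangent_chart A c) = ?z" unfolding \<xi>_def by (rule T.tvec_of_coord[OF tc u])
  have hor: "\<xi> \<in> horizontal A D u" by (rule horizontalI[OF D c u \<xi>]) (simp add: \<xi>c)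
  have pr: "differential (tangent_atlas A) A fst u \<xi> = w"
    unfolding differential_fst[OF c u \<xi>] \<xi>c using tvec_of_eq[OF c pc w] by simp
  have "hlift A D u w = \<xi>"
    unfolding hlift_def
  proof (rule the_equality)
    fix \<eta> assume \<eta>: "\<eta> \<in> horizontal A D u \<and> differential (tangent_atlas A) A fst u \<eta> = w"
    then have \<eta>T: "\<eta> \<in> tangent_space (tangent_atlas A) u" using horizontalD(1)[OF D c u] by blast
    have "fst (\<eta> (tangent_chart A c)) = w c"
      using \<eta> tvec_of_coord[OF c pc] unfolding differential_fst[OF c u \<eta>T] by metis
    then have "\<eta> (tangent_chart A c) = ?z"
      using horizontalD(2)[OF D c u] \<eta> by (intro prod_eqI) simp_all
    then show "\<eta> = \<xi>" using T.tangent_eqI[OF tc u \<eta>T \<xi>] \<xi>c by simp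
  qed (use hor pr in blast)
  then show "hlift A D u w \<in> horizontal A D u" "hlift A D u w \<in> tangent_space (tangent_atlas A) u"
    "hlift A D u w (tangent_chart A c) = ?z"
    using hor \<xi> \<xi>c by simp_all
qed

text \<open>In coordinates: (s, t) = (s, -\<Gamma>(s, u)) + (0, t + \<Gamma>(s, u)).\<close>

lemma horizontal_vertical_decomposition:
  assumes D: "affine_connection A D" and c: "c \<in> A" and u: "u \<in> fst (tangent_chart A c)"
  shows "tvec_of (tangent_atlas A) (tangent_chart A c) u (s, t) =
    hlift A D u (tvec_of A c (fst u) s) +
    vlift A u (tvec_of A c (fst u) (t + christoffel A D c (fst u) s (snd u c)))"
proof -
  have pc: "fst u \<in> fst c" and uT: "u \<in> TM A" using u unfolding fst_tangent_chart by auto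
  note tc = tangent_atlasI[OF c] and t = tvec_of_in[OF c pc]
  show ?thesis
  proof (rule T.tangent_eqI[OF tc u T.tvec_of_in[OF tc u]])
    show "hlift A D u (tvec_of A c (fst u) s) +
        vlift A u (tvec_of A c (fst u) (t + christoffel A D c (fst u) s (snd u c))) \<in> tangent_space (tangent_atlas A) u"
      using subspace_add[OF T.subspace_tangent_space hlift_in[OF D c u t] vlift_in[OF uT t]] .
  qed (simp add: T.tvec_of_coord[OF tc u] hlift_chart[OF D c u t] vlift_coord(2)[OF uT t c u]
      tvec_of_coord[OF c pc])
qed

end

section \<open>Submanifolds in adapted charts\<close>

text \<open>The difference quotients lie in \<open>S\<close>, and a subspace of a Euclidean space is
  closed.\<close>

lemma has_vector_derivative_in_subspace:
  fixes f :: "real \<Rightarrow> 'n::euclidean_space"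
  assumes f: "(f has_vector_derivative v) (at 0)" and S: "subspace S"
    and ev: "open T" "0 \<in> T" "\<And>t. t \<in> T \<Longrightarrow> f t \<in> S"
  shows "v \<in> S"
proof -
  have "((\<lambda>h. norm (f (0 + h) - f 0 - h *\<^sub>R v) / norm h) \<longlongrightarrow> 0) (at 0)"
    using f unfolding has_vector_derivative_def has_derivative_at by blast
  then have "((\<lambda>h. norm ((1 / h) *\<^sub>R (f h - f 0) - v)) \<longlongrightarrow> 0) (at 0)"
  proof (rule Lim_transform_eventually)
    have "norm (f (0 + h) - f 0 - h *\<^sub>R v) / norm h = norm ((1 / h) *\<^sub>R (f h - f 0) - v)" if "h \<noteq> 0" for h
    proof -
      have "(1 / h) *\<^sub>R (f h - f 0) - v = (1 / h) *\<^sub>R (f (0 + h) - f 0 - h *\<^sub>R v)"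
        using that by (simp add: scaleR_diff_right)
      then show ?thesis by simp
    qed
    then show "\<forall>\<^sub>F h in at 0. norm (f (0 + h) - f 0 - h *\<^sub>R v) / norm h = norm ((1 / h) *\<^sub>R (f h - f 0) - v)"
      by (simp add: eventually_at_filter)
  qed
  then have lim: "((\<lambda>h. (1 / h) *\<^sub>R (f h - f 0)) \<longlongrightarrow> v) (at 0)"
    using Lim_null tendsto_norm_zero_iff by blast
  have "\<forall>\<^sub>F h in at 0. (1 / h) *\<^sub>R (f h - f 0) \<in> S"
    using eventually_at_topological[of "\<lambda>h. h \<in> T" 0 UNIV] ev(1,2)
    by (auto elim!: eventually_mono[rotated] intro!: subspace_scale[OF S] subspace_diff[OF S] ev(3)
        simp: eventually_at_topological)
  then show ?thesis
    using Lim_in_closed_set[OF closed_subspace[OF S] _ _ lim] by simp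
qed

text \<open>A slice chart taken from \<open>A\<close> itself, since tangent vectors have entries
  only in charts of \<open>A\<close>. Letting \<open>q\<close> vary makes one chart serve all points
  of \<open>N\<close> in its domain; if there are none, the condition is vacuous.\<close>

definition adapted_chart ::
    "('a, 'n::euclidean_space) atlas \<Rightarrow> 'a set \<Rightarrow> ('a, 'n) chart \<Rightarrow> 'n set \<Rightarrow> bool"
  where "adapted_chart A N c S \<longleftrightarrow> c \<in> A \<and> subspace S \<and>
    (\<forall>q\<in>fst c \<inter> N. snd c ` (fst c \<inter> N) = {x \<in> snd c ` fst c. x - snd c q \<in> S})"

context smooth_atlas
begin

lemma adapted_chart_inv_in:
  assumes N: "adapted_chart A N c S" and q: "q \<in> fst c" "q \<in> N"
    and x: "x \<in> snd c ` fst c" "x - snd c q \<in> S"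
  shows "chart_inv c x \<in> N"
proof -
  have c: "c \<in> A" using N unfolding adapted_chart_def by blast
  have "snd c ` (fst c \<inter> N) = {x \<in> snd c ` fst c. x - snd c q \<in> S}"
    using N q unfolding adapted_chart_def by blast
  then have "x \<in> snd c ` (fst c \<inter> N)" using x by blast
  from chart_inv_in[OF c this] show ?thesis by blast
qed

lemma maximal_chart_atlas: "c \<in> A \<Longrightarrow> maximal_chart A c"
  unfolding maximal_chart_def using chart transition mcarrierI by blast

lemma embedded_submanifoldI:
  assumes "N \<subseteq> mcarrier A"
    and "\<And>q. q \<in> N \<Longrightarrow> \<exists>c S. adapted_chart A N c S \<and> q \<in> fst c \<and> dim S = k"
  shows "embedded_submanifold A k N"
  unfolding embedded_submanifold_def
proof (intro conjI ballI)
  fix q assume q: "q \<in> N"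
  from assms(2)[OF q] obtain c S where cS: "adapted_chart A N c S" "q \<in> fst c" "dim S = k" by blast
  have *: "c \<in> A" "subspace S" "snd c ` (fst c \<inter> N) = {x \<in> snd c ` fst c. x - snd c q \<in> S}"
    using cS(1,2) q unfolding adapted_chart_def by auto
  show "\<exists>c S. maximal_chart A c \<and> q \<in> fst c \<and> subspace S \<and> dim S = k \<and>
      snd c ` (fst c \<inter> N) = {x \<in> snd c ` fst c. x - snd c q \<in> S}"
    by (rule exI[of _ c], rule exI[of _ S]) (intro conjI maximal_chart_atlas * cS)
qed (rule assms(1))

lemma open_line_preimage:
  fixes x :: "'b::real_normed_vector"
  assumes "open U"
  shows "open {t. x + t *\<^sub>R v \<in> U}"
  by (rule open_vimage[OF assms, unfolded vimage_def]) (intro continuous_intros)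

text \<open>A curve in \<open>N\<close> has coordinate displacements from \<open>q\<close> in
  \<open>S\<close>, and these survive differentiation.\<close>

lemma submanifold_tangent_subset:
  assumes N: "adapted_chart A N c S" and q: "q \<in> fst c" "q \<in> N"
    and v: "v \<in> submanifold_tangent A N q"
  shows "v \<in> tangent_space A q" "v c \<in> S"
proof -
  have c: "c \<in> A" and S: "subspace S"
    and im: "snd c ` (fst c \<inter> N) = {x \<in> snd c ` fst c. x - snd c q \<in> S}"
    using N q unfolding adapted_chart_def by auto
  obtain \<gamma> e where v_eq: "v = velocity A \<gamma> 0" and e: "e > 0" and sm: "smooth_curve A {-e<..<e} \<gamma>"
    and \<gamma>0: "\<gamma> 0 = q" and \<gamma>N: "\<gamma> ` {-e<..<e} \<subseteq> N"
    using v unfolding submanifold_tangent_def by blast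
  let ?O = "\<lambda>d. {t \<in> {-e<..<e}. \<gamma> t \<in> fst d}"
  have O: "open (?O d)" "smooth_on (?O d) (\<lambda>t. snd d (\<gamma> t))" if "d \<in> A" for d
    using sm that unfolding smooth_curve_def comp_def by blast+
  have dif: "(\<lambda>t. snd d (\<gamma> t)) differentiable (at 0)" if "d \<in> A" "\<gamma> 0 \<in> fst d" for d
    using smooth_on_has_derivative[OF O(2)[OF that(1)], of 0] e that(2)
    unfolding differentiable_def by auto
  have "velocity A \<gamma> 0 \<in> tangent_space A (\<gamma> 0)"
  proof (rule velocity_in_tangent_space[OF dif])
    show "\<exists>T. open T \<and> 0 \<in> T \<and> (\<forall>t\<in>T. \<gamma> t \<in> fst d)" if "d \<in> A" "\<gamma> 0 \<in> fst d" for d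
      using O(1)[OF that(1)] e that(2) by (intro exI[of _ "?O d"]) simp
  qed
  then show "v \<in> tangent_space A q" unfolding v_eq \<gamma>0 .
  have vc: "v c = vector_derivative (\<lambda>t. snd c (\<gamma> t)) (at 0)"
    unfolding v_eq velocity_def comp_def using c q \<gamma>0 by simp
  have "((\<lambda>t. snd c (\<gamma> t)) has_vector_derivative v c) (at 0)"
    unfolding vc vector_derivative_works[symmetric] by (rule dif[OF c]) (simp add: \<gamma>0 q)
  then have "((\<lambda>t. snd c (\<gamma> t) - snd c q) has_vector_derivative v c) (at 0)"
    using has_vector_derivative_diff[OF _ has_vector_derivative_const] by fastforce
  then show "v c \<in> S"
  proof (rule has_vector_derivative_in_subspace[OF _ S O(1)[OF c]])
    show "snd c (\<gamma> t) - snd c q \<in> S" if "t \<in> ?O c" for t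
      using im \<gamma>N that by blast
  qed (use e \<gamma>0 q in auto)
qed

text \<open>The straight coordinate line through \<open>q\<close> with direction \<open>v c\<close>
  stays in the slice, hence in \<open>N\<close>, and has velocity \<open>v\<close>.\<close>

lemma submanifold_tangentI:
  assumes N: "adapted_chart A N c S" and q: "q \<in> fst c" "q \<in> N"
    and v: "v \<in> tangent_space A q" "v c \<in> S"
  shows "v \<in> submanifold_tangent A N q"
proof -
  have c: "c \<in> A" and S: "subspace S"
    using N q unfolding adapted_chart_def by auto
  define l where "l t = snd c q + t *\<^sub>R v c" for t :: real
  define \<gamma> where "\<gamma> t = chart_inv c (l t)" for t
  have ol: "open {t. l t \<in> U}" if "open U" for U
    unfolding l_def by (rule open_line_preimage[OF that])
  have l0: "l 0 = snd c q" unfolding l_def by simp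
  have \<gamma>0: "\<gamma> 0 = q" unfolding \<gamma>_def l0 by (rule chart_inv_left[OF c q(1)])
  obtain e where e: "e > 0" "ball 0 e \<subseteq> {t. l t \<in> snd c ` fst c}"
    using ol[OF open_chart_image[OF c]] q(1) unfolding open_contains_ball l0[symmetric]
    by (metis (mono_tags, lifting) image_eqI l0 mem_Collect_eq)
  let ?I = "{-e<..<e}"
  have lI: "l t \<in> snd c ` fst c" if "t \<in> ?I" for t
    using e(2) that by (auto simp: subset_iff dist_real_def)
  have \<gamma>c: "\<gamma> t \<in> fst c" "snd c (\<gamma> t) = l t" if "t \<in> ?I" for t
    unfolding \<gamma>_def using chart_inv_in[OF c lI[OF that] subset_refl] chart_inv_right[OF c lI[OF that]] by auto
  have \<gamma>N: "\<gamma> t \<in> N" if "t \<in> ?I" for t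
    unfolding \<gamma>_def
    by (rule adapted_chart_inv_in[OF N q lI[OF that]]) (simp add: l_def subspace_scale[OF S v(2)])
  \<comment> \<open>Times at which the curve lies in another chart domain are times at which the
    line lies in the coordinate image of the overlap. Openness and smoothness are then checked on
    the line.\<close>
  have O: "{t \<in> ?I. \<gamma> t \<in> fst d} = ?I \<inter> {t. l t \<in> snd c ` (fst c \<inter> fst d)}" for d
  proof (intro set_eqI iffI)
    fix t assume "t \<in> {t \<in> ?I. \<gamma> t \<in> fst d}"
    then have t: "t \<in> ?I" "\<gamma> t \<in> fst d" by auto
    have "l t \<in> snd c ` (fst c \<inter> fst d)"
      by (rule image_eqI[of _ _ "\<gamma> t"]) (use \<gamma>c[OF t(1)] t(2) in auto)
    then show "t \<in> ?I \<inter> {t. l t \<in> snd c ` (fst c \<inter> fst d)}" using t(1) by blast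
  next
    fix t assume t: "t \<in> ?I \<inter> {t. l t \<in> snd c ` (fst c \<inter> fst d)}"
    then have "chart_inv c (l t) \<in> fst c \<inter> fst d" by (intro chart_inv_in[OF c]) auto
    then show "t \<in> {t \<in> ?I. \<gamma> t \<in> fst d}" using t unfolding \<gamma>_def by blast
  qed
  have oO: "open {t \<in> ?I. \<gamma> t \<in> fst d}" if "d \<in> A" for d
    unfolding O using ol[OF open_chart_overlap[OF c that]] by (intro open_Int) auto
  have sO: "smooth_on {t \<in> ?I. \<gamma> t \<in> fst d} (snd d \<circ> \<gamma>)" if d: "d \<in> A" for d
  proof -
    note o = oO[OF d]
    have "smooth_on {t \<in> ?I. \<gamma> t \<in> fst d} l"
      unfolding l_def by (intro smooth_on_add[OF o] smooth_on_scaleR[OF o] smooth_on_const smooth_on_ident[OF o])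
    moreover have "l t \<in> snd c ` (fst c \<inter> fst d)" if "t \<in> {t \<in> ?I. \<gamma> t \<in> fst d}" for t
      using that unfolding O by blast
    ultimately show ?thesis
      using smooth_on_compose[OF o open_chart_overlap[OF c d] smooth_on_transition[OF c d]]
      unfolding \<gamma>_def comp_def by blast
  qed
  have smooth: "smooth_curve A ?I \<gamma>"
    unfolding smooth_curve_def using \<gamma>c(1) mcarrierI[OF c] oO sO by blast
  have "velocity A \<gamma> 0 \<in> tangent_space A (\<gamma> 0)"
  proof (rule velocity_in_tangent_space)
    fix d assume d: "d \<in> A" "\<gamma> 0 \<in> fst d"
    have 0: "0 \<in> {t \<in> ?I. \<gamma> t \<in> fst d}" using d(2) e(1) by simp
    show "(\<lambda>y. snd d (\<gamma> y)) differentiable at 0"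
      using smooth_on_has_derivative[OF sO[OF d(1)] 0] unfolding differentiable_def comp_def by blast
    show "\<exists>T. open T \<and> 0 \<in> T \<and> (\<forall>y\<in>T. \<gamma> y \<in> fst d)"
      using oO[OF d(1)] 0 by blast
  qed
  moreover have "velocity A \<gamma> 0 c = v c"
  proof -
    have "(l has_vector_derivative v c) (at 0)"
      unfolding l_def by (auto intro!: derivative_eq_intros)
    then have "((\<lambda>t. snd c (\<gamma> t)) has_vector_derivative v c) (at 0)"
      by (rule has_vector_derivative_transform_within_open[where S = ?I]) (use e(1) \<gamma>c(2) in auto)
    then show ?thesis
      unfolding velocity_def comp_def using c q(1) \<gamma>0 by (simp add: vector_derivative_at)
  qed
  ultimately have "v = velocity A \<gamma> 0"
    unfolding \<gamma>0 using tangent_eqI[OF c q(1) v(1)] by metis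
  then show ?thesis
    unfolding submanifold_tangent_def using e(1) smooth \<gamma>0 \<gamma>N by blast
qed

text \<open>Of the two terms of \<open>connection_coord\<close>, the Christoffel term is covered by
  the hypothesis. The derivative term lies in \<open>S\<close> because \<open>Y\<close> takes values
  in \<open>S\<close> along \<open>N\<close> and the line in the direction of \<open>X\<close> stays
  in \<open>N\<close>.\<close>

theorem totally_geodesicI:
  assumes "\<And>D q. levi_civita A g D \<Longrightarrow> q \<in> N \<Longrightarrow> \<exists>c S. adapted_chart A N c S \<and> q \<in> fst c \<and>
      (\<forall>a\<in>S. \<forall>b\<in>S. christoffel A D c q a b \<in> S)"
  shows "totally_geodesic A g N"
  unfolding totally_geodesic_def
proof (intro allI impI ballI)
  fix D W X Y q
  assume D: "levi_civita A g D" and W: "mopen A W" and X: "smooth_vector_field A W X"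
    and Y: "smooth_vector_field A W Y" and q: "q \<in> W \<inter> N"
    and tan: "\<forall>q\<in>W \<inter> N. X q \<in> submanifold_tangent A N q \<and> Y q \<in> submanifold_tangent A N q"
  obtain c S where N: "adapted_chart A N c S" and qc: "q \<in> fst c"
    and G: "\<And>a b. a \<in> S \<Longrightarrow> b \<in> S \<Longrightarrow> christoffel A D c q a b \<in> S"
    using assms[OF D, of q] q by blast
  have c: "c \<in> A" and S: "subspace S" using N unfolding adapted_chart_def by auto
  have conn: "affine_connection A D" using D unfolding levi_civita_def by blast
  have qW: "q \<in> W" "q \<in> N" using q by auto
  have XS: "X q c \<in> S" and YS: "\<And>q'. q' \<in> W \<Longrightarrow> q' \<in> N \<Longrightarrow> q' \<in> fst c \<Longrightarrow> Y q' c \<in> S"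
    using submanifold_tangent_subset(2)[OF N] tan qc qW by auto
  let ?U = "snd c ` (W \<inter> fst c)"
  let ?Y' = "frechet_derivative (\<lambda>x. Y (chart_inv c x) c) (at (snd c q))"
  \<comment> \<open>Only the values of \<open>Y\<close> on the coordinate line through
    \<open>q\<close> in direction \<open>X q c\<close> matter for this derivative.\<close>
  have "?Y' (X q c) \<in> S"
  proof (rule has_vector_derivative_in_subspace[OF has_derivative_line[OF
          smooth_vector_field_coord_has_derivative[OF Y c qW(1) qc]] S
          open_line_preimage[OF mopen_open[OF W c]]])
    show "0 \<in> {t. snd c q + t *\<^sub>R X q c \<in> ?U}" using qW qc by simp
    fix t assume "t \<in> {t. snd c q + t *\<^sub>R X q c \<in> ?U}"
    then have t: "snd c q + t *\<^sub>R X q c \<in> ?U" by simp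
    have 1: "chart_inv c (snd c q + t *\<^sub>R X q c) \<in> W \<inter> fst c" by (rule chart_inv_in[OF c t]) blast
    moreover have "chart_inv c (snd c q + t *\<^sub>R X q c) \<in> N"
      by (rule adapted_chart_inv_in[OF N qc qW(2)]) (use t subspace_scale[OF S XS] in auto)
    ultimately show "Y (chart_inv c (snd c q + t *\<^sub>R X q c)) c \<in> S" using YS by blast
  qed
  then have "D X Y q c \<in> S"
    unfolding connection_coord[OF conn c W X Y qW(1) qc]
    using subspace_add[OF S] G[OF XS YS[OF qW qc]] by blast
  then show "D X Y q \<in> submanifold_tangent A N q"
    using submanifold_tangentI[OF N qc qW(2) connection_in_tangent_space[OF conn W X Y qW(1)]] by blast
qed

end

section \<open>The weighted structure\<close>

locale weighted_tangent_bundle = smooth_atlas A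
  for A :: "('a, 'n::euclidean_space) atlas" +
  fixes gM :: "'a \<Rightarrow> ('a, 'n) tvec \<Rightarrow> ('a, 'n) tvec \<Rightarrow> real"
    and nabla :: "('a \<Rightarrow> ('a, 'n) tvec) \<Rightarrow> ('a \<Rightarrow> ('a, 'n) tvec) \<Rightarrow> 'a \<Rightarrow> ('a, 'n) tvec"
    and mu lam :: "('a, 'n) tpoint \<Rightarrow> real"
    and g :: "('a, 'n) tpoint \<Rightarrow> (('a, 'n) tpoint, 'n \<times> 'n) tvec \<Rightarrow>
                (('a, 'n) tpoint, 'n \<times> 'n) tvec \<Rightarrow> real"
    and J :: "('a, 'n) tpoint \<Rightarrow> (('a, 'n) tpoint, 'n \<times> 'n) tvec \<Rightarrow>
                (('a, 'n) tpoint, 'n \<times> 'n) tvec"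
  assumes gM: "riemannian_metric A gM" and levi: "levi_civita A gM nabla"
    and mu: "radial_weight A gM mu" and lam: "radial_weight A gM lam"
    and g: "weighted_metric A gM nabla mu lam g"
    and J: "weighted_complex_structure A nabla mu lam J"
begin

abbreviation "TA \<equiv> tangent_atlas A"
abbreviation "tc \<equiv> tangent_chart A"
abbreviation "Chr \<equiv> christoffel A nabla"

sublocale T: smooth_atlas "tangent_atlas A"
  by (rule smooth_atlas_tangent_atlas)

lemma conn: "affine_connection A nabla"
  using levi unfolding levi_civita_def by blast

lemma riemannian_g: "riemannian_metric TA g"
  using g unfolding weighted_metric_def by blast

lemma weights_pos: "u \<in> TM A \<Longrightarrow> mu u > 0" "u \<in> TM A \<Longrightarrow> lam u > 0"
  using mu lam unfolding radial_weight_def by blast+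

lemma weights_smooth: "smooth_fun TA (TM A) mu" "smooth_fun TA (TM A) lam"
  using mu lam unfolding radial_weight_def by blast+

lemma tc_in:
  assumes "u \<in> fst (tc c)"
  shows "u \<in> TM A" "fst u \<in> fst c" "snd u \<in> tangent_space A (fst u)"
  using assms unfolding fst_tangent_chart TM_iff by auto

section \<open>The weighted metric on lifts and in coordinates\<close>

lemma g_hlift_hlift:
  "u \<in> TM A \<Longrightarrow> w \<in> tangent_space A (fst u) \<Longrightarrow> z \<in> tangent_space A (fst u) \<Longrightarrow>
    g u (hlift A nabla u w) (hlift A nabla u z) = (mu u)\<^sup>2 * gM (fst u) w z"
  using g unfolding weighted_metric_def by blast

lemma g_vlift_vlift:
  "u \<in> TM A \<Longrightarrow> w \<in> tangent_space A (fst u) \<Longrightarrow> z \<in> tangent_space A (fst u) \<Longrightarrow>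
    g u (vlift A u w) (vlift A u z) = (lam u)\<^sup>2 * gM (fst u) w z"
  using g unfolding weighted_metric_def by blast

lemma hlift_TM:
  assumes "u \<in> TM A" "w \<in> tangent_space A (fst u)"
  shows "hlift A nabla u w \<in> tangent_space TA u" "hlift A nabla u w \<in> horizontal A nabla u"
  using TM_E[OF assms(1)] hlift_in[OF conn _ _ assms(2)] hlift_horizontal[OF conn _ _ assms(2)] by blast+

lemma vlift_vertical:
  assumes "u \<in> TM A" "w \<in> tangent_space A (fst u)"
  shows "vlift A u w \<in> vertical A u"
proof -
  obtain c where c: "c \<in> A" "u \<in> fst (tc c)" using TM_E[OF assms(1)] .
  show ?thesis
    unfolding vertical_iff[OF c] using vlift_in[OF assms] vlift_coord(2)[OF assms c] by simp
qed

lemma g_hlift_vlift: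
  assumes "u \<in> TM A" "w \<in> tangent_space A (fst u)" "z \<in> tangent_space A (fst u)"
  shows "g u (hlift A nabla u w) (vlift A u z) = 0" "g u (vlift A u z) (hlift A nabla u w) = 0"
proof -
  show *: "g u (hlift A nabla u w) (vlift A u z) = 0"
    using g hlift_TM(2)[OF assms(1,2)] vlift_vertical[OF assms(1,3)] assms(1)
    unfolding weighted_metric_def by blast
  obtain c where c: "c \<in> A" "u \<in> fst (tc c)" using TM_E[OF assms(1)] .
  show "g u (vlift A u z) (hlift A nabla u w) = 0"
    using T.metric_sym[OF riemannian_g tangent_atlasI[OF c(1)] c(2) vlift_in[OF assms(1,3)] hlift_TM(1)[OF assms(1,2)]] *
    by simp
qed

text \<open>Both vectors are split into lifts; the cross terms vanish by orthogonality of the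
  horizontal and vertical spaces.\<close>

lemma g_tvec_of:
  assumes c: "c \<in> A" and u: "u \<in> fst (tc c)"
  shows "g u (tvec_of TA (tc c) u (s, t)) (tvec_of TA (tc c) u (s', t')) =
    (mu u)\<^sup>2 * gM (fst u) (tvec_of A c (fst u) s) (tvec_of A c (fst u) s') +
    (lam u)\<^sup>2 * gM (fst u) (tvec_of A c (fst u) (t + Chr c (fst u) s (snd u c)))
      (tvec_of A c (fst u) (t' + Chr c (fst u) s' (snd u c)))"
proof -
  note uT = tc_in(1)[OF u] and t = tvec_of_in[OF c tc_in(2)[OF u]]
  note tc = tangent_atlasI[OF c]
  note h = hlift_TM(1)[OF uT t] and v = vlift_in[OF uT t]
  note add = subspace_add[OF T.subspace_tangent_space]
  note left = T.metric_add_left[OF riemannian_g tc u] and right = T.metric_add_right[OF riemannian_g tc u]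
  show ?thesis
    unfolding horizontal_vertical_decomposition[OF conn c u]
    unfolding left[OF h add[OF h v] v] right[OF h h v] right[OF h v v]
      g_hlift_hlift[OF uT t t] g_vlift_vlift[OF uT t t] g_hlift_vlift[OF uT t t]
    by simp
qed

text \<open>The matrix of \<open>g\<close> as an explicit function of (x, y). This is the expression
  whose derivatives enter Koszul's formula.\<close>

lemma metric_coord_total:
  assumes c: "c \<in> A" and x: "x \<in> snd c ` fst c"
  shows "metric_coord TA g (tc c) (s, t) (s', t') (x, y) =
    (mu (chart_inv (tc c) (x, y)))\<^sup>2 * metric_coord A gM c s s' x +
    (lam (chart_inv (tc c) (x, y)))\<^sup>2 * metric_coord A gM c
      (t + Chr c (chart_inv c x) s y) (t' + Chr c (chart_inv c x) s' y) x"
proof -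
  let ?u = "chart_inv (tc c) (x, y)"
  have p: "chart_inv c x \<in> fst c" using chart_inv_in[OF c x subset_refl] .
  have u_eq: "?u = (chart_inv c x, tvec_of A c (chart_inv c x) y)"
    by (rule chart_inv_tangent_chart[OF c x])
  have "(x, y) \<in> snd (tc c) ` fst (tc c)" unfolding tangent_chart_domain_image[OF c] using x by simp
  then have u: "?u \<in> fst (tc c)" by (rule T.chart_inv_in[OF tangent_atlasI[OF c] _ subset_refl])
  have uc: "fst ?u = chart_inv c x" "snd ?u c = y"
    unfolding u_eq using tvec_of_coord[OF c p] by simp_all
  show ?thesis
    unfolding metric_coord_def g_tvec_of[OF c u] uc ..
qed

lemma metric_coord_bilinear:
  assumes c: "c \<in> A" and x: "x \<in> snd c ` fst c"
  shows metric_coord_add_left: "metric_coord A gM c (v + v') w x = metric_coord A gM c v w x + metric_coord A gM c v' w x"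
    and metric_coord_add_right: "metric_coord A gM c w (v + v') x = metric_coord A gM c w v x + metric_coord A gM c w v' x"
    and metric_coord_scale_left: "metric_coord A gM c (a *\<^sub>R v) w x = a * metric_coord A gM c v w x"
    and metric_coord_scale_right: "metric_coord A gM c v (a *\<^sub>R w) x = a * metric_coord A gM c v w x"
    and metric_coord_sym: "metric_coord A gM c v w x = metric_coord A gM c w v x"
    and metric_coord_pos: "v \<noteq> 0 \<Longrightarrow> metric_coord A gM c v v x > 0"
    and metric_coord_zero_left: "metric_coord A gM c 0 w x = 0"
    and metric_coord_zero_right: "metric_coord A gM c v 0 x = 0"
proof -
  have p: "chart_inv c x \<in> fst c" using chart_inv_in[OF c x subset_refl] .
  note t = tvec_of_in[OF c p]
  note lin = linear_add[OF linear_tvec_of[OF c p]] linear_scale[OF linear_tvec_of[OF c p]]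
    linear_0[OF linear_tvec_of[OF c p]]
  show "metric_coord A gM c (v + v') w x = metric_coord A gM c v w x + metric_coord A gM c v' w x"
    unfolding metric_coord_def lin by (rule metric_add_left[OF gM c p t t t])
  show "metric_coord A gM c w (v + v') x = metric_coord A gM c w v x + metric_coord A gM c w v' x"
    unfolding metric_coord_def lin by (rule metric_add_right[OF gM c p t t t])
  show "metric_coord A gM c (a *\<^sub>R v) w x = a * metric_coord A gM c v w x"
    unfolding metric_coord_def lin by (rule metric_scale_left[OF gM c p t t])
  show "metric_coord A gM c v (a *\<^sub>R w) x = a * metric_coord A gM c v w x"
    unfolding metric_coord_def lin by (rule metric_scale_right[OF gM c p t t])
  show "metric_coord A gM c v w x = metric_coord A gM c w v x"
    unfolding metric_coord_def by (rule metric_sym[OF gM c p t t])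
  show "metric_coord A gM c 0 w x = 0" "metric_coord A gM c v 0 x = 0"
    unfolding metric_coord_def lin by (rule metric_zero[OF gM c p t])+
  assume "v \<noteq> 0"
  then have "tvec_of A c (chart_inv c x) v \<noteq> 0"
    using tvec_of_coord[OF c p] by (metis zero_fun_apply)
  then show "metric_coord A gM c v v x > 0"
    unfolding metric_coord_def by (rule metric_pos[OF gM c p t t])
qed

text \<open>The vector f1 w^h + f2 w^v at \<open>u\<close>, as a function of the coordinates
  \<open>v\<close> of \<open>w\<close>. Its linearity in \<open>v\<close> yields both the dimension
  of the plane and a local frame.\<close>

definition plane_vector where
  "plane_vector f1 f2 c u v =
    tvec_of TA (tc c) u (f1 u *\<^sub>R v, f2 u *\<^sub>R v - f1 u *\<^sub>R Chr c (fst u) v (snd u c))"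
  for f1 f2 :: "('a, 'n) tpoint \<Rightarrow> real"

lemma plane_vector_eq:
  assumes c: "c \<in> A" and u: "u \<in> fst (tc c)" and w: "w \<in> tangent_space A (fst u)"
  shows "f1 u *\<^sub>R hlift A nabla u w + f2 u *\<^sub>R vlift A u w = plane_vector f1 f2 c u (w c)"
proof -
  note tc = tangent_atlasI[OF c] and uT = tc_in(1)[OF u]
  show ?thesis
    unfolding plane_vector_def
  proof (rule T.tangent_eqI[OF tc u _ T.tvec_of_in[OF tc u]])
    show "f1 u *\<^sub>R hlift A nabla u w + f2 u *\<^sub>R vlift A u w \<in> tangent_space TA u"
      by (intro subspace_add[OF T.subspace_tangent_space] subspace_scale[OF T.subspace_tangent_space]
          hlift_in[OF conn c u w] vlift_in[OF uT w])
    show "(f1 u *\<^sub>R hlift A nabla u w + f2 u *\<^sub>R vlift A u w) (tc c) =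
      tvec_of TA (tc c) u (f1 u *\<^sub>R w c, f2 u *\<^sub>R w c - f1 u *\<^sub>R Chr c (fst u) (w c) (snd u c)) (tc c)"
      unfolding T.tvec_of_coord[OF tc u] plus_fun_apply scaleR_fun_def
        hlift_chart[OF conn c u w] vlift_coord(2)[OF uT w c u] by simp
  qed
qed

lemma mixed_plane_eq:
  assumes c: "c \<in> A" and u: "u \<in> fst (tc c)"
  shows "mixed_plane A nabla f1 f2 u = range (plane_vector f1 f2 c u)"
proof (intro subset_antisym subsetI)
  fix \<xi> assume "\<xi> \<in> mixed_plane A nabla f1 f2 u"
  then show "\<xi> \<in> range (plane_vector f1 f2 c u)"
    unfolding mixed_plane_def using plane_vector_eq[OF c u] by blast
next
  fix \<xi> assume "\<xi> \<in> range (plane_vector f1 f2 c u)"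
  then obtain v where v: "\<xi> = plane_vector f1 f2 c u v" by blast
  note t = tvec_of_in[OF c tc_in(2)[OF u], of v]
  have "\<xi> = f1 u *\<^sub>R hlift A nabla u (tvec_of A c (fst u) v) + f2 u *\<^sub>R vlift A u (tvec_of A c (fst u) v)"
    unfolding plane_vector_eq[OF c u t] tvec_of_coord[OF c tc_in(2)[OF u]] v ..
  then show "\<xi> \<in> mixed_plane A nabla f1 f2 u" unfolding mixed_plane_def using t by blast
qed

lemma plane_vector_linear:
  assumes c: "c \<in> A" and u: "u \<in> fst (tc c)"
  shows "linear (plane_vector f1 f2 c u)"
proof -
  have "linear (\<lambda>v. (f1 u *\<^sub>R v, f2 u *\<^sub>R v - f1 u *\<^sub>R Chr c (fst u) v (snd u c)))"
    by (rule linearI) (simp_all add: christoffel_simps algebra_simps)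
  from linear_compose[OF this T.linear_tvec_of[OF tangent_atlasI[OF c] u]]
  show ?thesis by (simp add: plane_vector_def[abs_def] comp_def)
qed

text \<open>If \<open>f1 u\<close> is nonzero, the base component recovers \<open>v\<close>;
  otherwise the Christoffel term drops out and the fibre component is \<open>f2 u\<close> times
  \<open>v\<close>.\<close>

lemma plane_vector_inj:
  assumes c: "c \<in> A" and u: "u \<in> fst (tc c)" and f: "f1 u \<noteq> 0 \<or> f2 u \<noteq> 0"
  shows "inj (plane_vector f1 f2 c u)"
  unfolding linear_injective_0[OF plane_vector_linear[OF c u]]
proof (intro allI impI)
  fix v assume "plane_vector f1 f2 c u v = 0"
  then have "(f1 u *\<^sub>R v, f2 u *\<^sub>R v - f1 u *\<^sub>R Chr c (fst u) v (snd u c)) = 0"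
    unfolding plane_vector_def using T.tvec_of_coord[OF tangent_atlasI[OF c] u] by (metis zero_fun_apply)
  then show "v = 0" using f by (auto simp: zero_prod_def)
qed

lemma plane_range_span:
  assumes c: "c \<in> A" and u: "u \<in> fst (tc c)"
  shows "range (plane_vector f1 f2 c u) = span (plane_vector f1 f2 c u ` Basis)"
  using linear_span_image[OF plane_vector_linear[OF c u, of f1 f2], of Basis] by simp

text \<open>A pointwise statement: the plane is the image of the model space under an injective
  linear map, for arbitrary coefficient functions.\<close>

lemma mixed_plane_field:
  assumes f: "\<And>u. u \<in> TM A \<Longrightarrow> f1 u \<noteq> 0 \<or> f2 u \<noteq> 0"
  shows "plane_field TA DIM('n) (mixed_plane A nabla f1 f2)"
  unfolding plane_field_def mcarrier_tangent_atlas
proof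
  fix u assume uT: "u \<in> TM A"
  then obtain c where c: "c \<in> A" and u: "u \<in> fst (tc c)" by (rule TM_E)
  have "range (plane_vector f1 f2 c u) \<subseteq> tangent_space TA u"
    unfolding plane_vector_def using T.tvec_of_in[OF tangent_atlasI[OF c] u] by blast
  moreover have "dim (span (plane_vector f1 f2 c u ` Basis)) = DIM('n)"
  proof -
    have inj: "inj (plane_vector f1 f2 c u)" using plane_vector_inj[OF c u, of f1 f2, OF f[OF uT]] .
    have "independent (plane_vector f1 f2 c u ` Basis)"
      by (rule linear_independent_injective_image[OF plane_vector_linear[OF c u] independent_Basis])
        (use inj in \<open>simp add: inj_on_subset\<close>)
    then show ?thesis
      using dim_eq_card_independent card_image[OF inj_on_subset[OF inj subset_UNIV], of Basis]
      unfolding dim_span by metis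
  qed
  ultimately show "mixed_plane A nabla f1 f2 u \<subseteq> tangent_space TA u \<and>
      subspace (mixed_plane A nabla f1 f2 u) \<and> dim (mixed_plane A nabla f1 f2 u) = DIM('n)"
    unfolding mixed_plane_eq[OF c u] plane_range_span[OF c u] by simp
qed

text \<open>With smooth coefficients the images of the basis vectors are smooth fields over a
  tangent chart, and they span the plane at each of its points.\<close>

lemma mixed_plane_distribution:
  assumes f: "\<And>u. u \<in> TM A \<Longrightarrow> f1 u \<noteq> 0 \<or> f2 u \<noteq> 0"
    and f1: "smooth_fun TA (TM A) f1" and f2: "smooth_fun TA (TM A) f2"
  shows "distribution TA DIM('n) (mixed_plane A nabla f1 f2)"
  unfolding distribution_def
proof (intro conjI ballI)
  show "plane_field TA DIM('n) (mixed_plane A nabla f1 f2)"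
    using mixed_plane_field f by blast
  fix u0 assume "u0 \<in> mcarrier TA"
  then obtain c where c: "c \<in> A" and u0: "u0 \<in> fst (tc c)"
    unfolding mcarrier_tangent_atlas by (rule TM_E)
  note tc = tangent_atlasI[OF c]
  let ?U = "snd (tc c) ` fst (tc c)"
  have U: "?U = (snd c ` fst c) \<times> UNIV" by (rule tangent_chart_domain_image[OF c])
  have oU: "open ?U" using T.open_chart_image[OF tc] .
  \<comment> \<open>A local frame is indexed by numbers below the rank, so the basis of the model
    space is enumerated.\<close>
  obtain b where b: "bij_betw b {..<DIM('n)} (Basis :: 'n set)"
    using ex_bij_betw_nat_finite[OF finite_Basis] unfolding lessThan_atLeast0 by blast
  \<comment> \<open>Coordinates of \<open>plane_vector\<close> as a function of the point (x, y);
    the difference is written with a factor -1 so that the rules for sums and multiples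
    apply.\<close>
  define h where "h v z = (f1 (chart_inv (tc c) z) *\<^sub>R v, f2 (chart_inv (tc c) z) *\<^sub>R v +
    (- 1) *\<^sub>R (f1 (chart_inv (tc c) z) *\<^sub>R Chr c (chart_inv c (fst z)) v (snd z)))" for v z
  have fs: "smooth_on ?U (\<lambda>z. f (chart_inv (tc c) z))" if "smooth_fun TA (TM A) f" for f :: "('a, 'n) tpoint \<Rightarrow> real"
  proof -
    have "TM A \<inter> fst (tc c) = fst (tc c)" using tc_in(1) by blast
    then show ?thesis using that tc unfolding smooth_fun_def comp_def by fastforce
  qed
  have hs: "smooth_on ?U (h v)" for v
    unfolding h_def
  proof (intro smooth_on_Pair[OF oU] smooth_on_add[OF oU] smooth_on_scaleR[OF oU] smooth_on_const fs f1 f2)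
    show "smooth_on ?U (\<lambda>z. Chr c (chart_inv c (fst z)) v (snd z))"
      by (rule smooth_on_christoffel[OF conn c oU smooth_on_fst[OF oU] _ smooth_on_const smooth_on_snd[OF oU]])
        (unfold U, auto)
  qed
  have h_eq: "tvec_of TA (tc c) u (h v (snd (tc c) u)) = plane_vector f1 f2 c u v"
    if u: "u \<in> fst (tc c)" for u v
    unfolding h_def plane_vector_def T.chart_inv_left[OF tc u]
    unfolding snd_tangent_chart fst_conv snd_conv chart_inv_left[OF c tc_in(2)[OF u]] by simp
  define X where "X i = (\<lambda>u. tvec_of TA (tc c) u (h (b i) (snd (tc c) u)))" for i
  have "smooth_vector_field TA (fst (tc c)) (X i)" for i
    unfolding X_def by (rule T.smooth_vector_field_tvec_of[OF tc T.mopen_chart[OF tc] subset_refl hs])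
  moreover have "mixed_plane A nabla f1 f2 u = span ((\<lambda>i. X i u) ` {..<DIM('n)})"
    if u: "u \<in> fst (tc c)" for u
  proof -
    have "(\<lambda>i. X i u) ` {..<DIM('n)} = plane_vector f1 f2 c u ` b ` {..<DIM('n)}"
      unfolding X_def h_eq[OF u] by (simp add: image_image)
    then show ?thesis
      unfolding mixed_plane_eq[OF c u] plane_range_span[OF c u] bij_betw_imp_surj_on[OF b] by simp
  qed
  ultimately show "\<exists>W X. mopen TA W \<and> u0 \<in> W \<and> (\<forall>i<DIM('n). smooth_vector_field TA W (X i)) \<and>
      (\<forall>q\<in>W. mixed_plane A nabla f1 f2 q = span ((\<lambda>i. X i q) ` {..<DIM('n)}))"
    using T.mopen_chart[OF tc] u0 by blast
qed

section \<open>The almost-complex structure and its two-form on the planes\<close>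

lemma J_mixed:
  assumes u: "u \<in> TM A" and w: "w \<in> tangent_space A (fst u)"
  shows "J u (a *\<^sub>R hlift A nabla u w + b *\<^sub>R vlift A u w) =
    (- (b * (lam u / mu u))) *\<^sub>R hlift A nabla u w + (a * (mu u / lam u)) *\<^sub>R vlift A u w"
proof -
  note * = J[unfolded weighted_complex_structure_def, rule_format, OF u]
  have lin: "J u (r *\<^sub>R \<xi>) = r *\<^sub>R J u \<xi>" "J u (\<xi> + \<eta>) = J u \<xi> + J u \<eta>"
    if "\<xi> \<in> tangent_space TA u" "\<eta> \<in> tangent_space TA u" for \<xi> \<eta> r
    using *[THEN conjunct1, rule_format, OF that(1)] that(2) by blast+
  have Jh: "J u (hlift A nabla u w) = (mu u / lam u) *\<^sub>R vlift A u w"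
    and Jv: "J u (vlift A u w) = - ((lam u / mu u) *\<^sub>R hlift A nabla u w)"
    using *[THEN conjunct2, rule_format, OF w] by blast+
  note h = hlift_TM(1)[OF u w] and v = vlift_in[OF u w]
  note sc = subspace_scale[OF T.subspace_tangent_space]
  have "J u (a *\<^sub>R hlift A nabla u w + b *\<^sub>R vlift A u w) =
      a *\<^sub>R J u (hlift A nabla u w) + b *\<^sub>R J u (vlift A u w)"
    unfolding lin(2)[OF sc[OF h] sc[OF v]] lin(1)[OF h h] lin(1)[OF v v] ..
  also have "\<dots> = a *\<^sub>R ((mu u / lam u) *\<^sub>R vlift A u w) + b *\<^sub>R (- ((lam u / mu u) *\<^sub>R hlift A nabla u w))"
    unfolding Jh Jv ..
  finally show ?thesis
    by (simp only: scaleR_scaleR scaleR_minus_right scaleR_minus_left add.commute)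
qed

text \<open>\<open>J\<close> turns the pair of coefficients by a quarter and rescales it by the
  ratio of the weights. All results on JP reduce to those on P by this change of
  coefficients.\<close>

lemma J_mixed_plane:
  assumes u: "u \<in> TM A"
  shows "J u ` mixed_plane A nabla f1 f2 u =
    mixed_plane A nabla (\<lambda>u. - (f2 u * (lam u / mu u))) (\<lambda>u. f1 u * (mu u / lam u)) u"
proof (intro subset_antisym subsetI)
  fix \<xi> assume "\<xi> \<in> J u ` mixed_plane A nabla f1 f2 u"
  then obtain w where w: "w \<in> tangent_space A (fst u)"
    and "\<xi> = J u (f1 u *\<^sub>R hlift A nabla u w + f2 u *\<^sub>R vlift A u w)"
    unfolding mixed_plane_def by blast
  then show "\<xi> \<in> mixed_plane A nabla (\<lambda>u. - (f2 u * (lam u / mu u))) (\<lambda>u. f1 u * (mu u / lam u)) u"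
    unfolding mixed_plane_def J_mixed[OF u w] by blast
next
  fix \<xi> assume "\<xi> \<in> mixed_plane A nabla (\<lambda>u. - (f2 u * (lam u / mu u))) (\<lambda>u. f1 u * (mu u / lam u)) u"
  then obtain w where w: "w \<in> tangent_space A (fst u)"
    and "\<xi> = J u (f1 u *\<^sub>R hlift A nabla u w + f2 u *\<^sub>R vlift A u w)"
    unfolding mixed_plane_def using J_mixed[OF u] by force
  then show "\<xi> \<in> J u ` mixed_plane A nabla f1 f2 u"
    unfolding mixed_plane_def by blast
qed

text \<open>The horizontal parts contribute -f1 f2 lam mu gM(w, z), the vertical parts f1 f2 mu lam
  gM(w, z). The ratios in \<open>J\<close> are exactly those that equalise the two weights of
  \<open>g\<close>.\<close>

lemma omega_mixed_plane:
  assumes u: "u \<in> TM A" and \<xi>: "\<xi> \<in> mixed_plane A nabla f1 f2 u" and \<eta>: "\<eta> \<in> mixed_plane A nabla f1 f2 u"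
  shows "fundamental_form g J u \<xi> \<eta> = 0"
proof -
  obtain w z where w: "w \<in> tangent_space A (fst u)" and z: "z \<in> tangent_space A (fst u)"
    and eq: "\<xi> = f1 u *\<^sub>R hlift A nabla u w + f2 u *\<^sub>R vlift A u w"
      "\<eta> = f1 u *\<^sub>R hlift A nabla u z + f2 u *\<^sub>R vlift A u z"
    using \<xi> \<eta> unfolding mixed_plane_def by blast
  obtain c where c: "c \<in> A" and uc: "u \<in> fst (tc c)" using u by (rule TM_E)
  note tc = tangent_atlasI[OF c]
  note h = hlift_TM(1)[OF u] and v = vlift_in[OF u]
  note add = subspace_add[OF T.subspace_tangent_space]
  note sc = subspace_scale[OF T.subspace_tangent_space]
  note left = T.metric_add_left[OF riemannian_g tc uc] and right = T.metric_add_right[OF riemannian_g tc uc]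
    and sleft = T.metric_scale_left[OF riemannian_g tc uc] and sright = T.metric_scale_right[OF riemannian_g tc uc]
  have split: "g u (a *\<^sub>R hlift A nabla u w + b *\<^sub>R vlift A u w) (a' *\<^sub>R hlift A nabla u z + b' *\<^sub>R vlift A u z) =
    a * a' * ((mu u)\<^sup>2 * gM (fst u) w z) + b * b' * ((lam u)\<^sup>2 * gM (fst u) w z)" for a b a' b'
    unfolding left[OF sc[OF h[OF w]] add[OF sc[OF h[OF z]] sc[OF v[OF z]]] sc[OF v[OF w]]]
      right[OF sc[OF h[OF z]] sc[OF h[OF w]] sc[OF v[OF z]]]
      right[OF sc[OF h[OF z]] sc[OF v[OF w]] sc[OF v[OF z]]]
      sleft[OF h[OF w] sc[OF h[OF z]]] sleft[OF h[OF w] sc[OF v[OF z]]]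
      sleft[OF v[OF w] sc[OF h[OF z]]] sleft[OF v[OF w] sc[OF v[OF z]]]
      sright[OF h[OF w] h[OF z]] sright[OF h[OF w] v[OF z]]
      sright[OF v[OF w] h[OF z]] sright[OF v[OF w] v[OF z]]
      g_hlift_hlift[OF u w z] g_vlift_vlift[OF u w z] g_hlift_vlift(1)[OF u w z] g_hlift_vlift(2)[OF u z w]
    by simp
  show ?thesis
    unfolding fundamental_form_def eq J_mixed[OF u w] split
    using weights_pos[OF u] by (simp add: field_simps power2_eq_square)
qed

theorem R_Lagrangian_mixed_plane_field:
  assumes f: "\<And>u. u \<in> TM A \<Longrightarrow> f1 u \<noteq> 0 \<or> f2 u \<noteq> 0"
  shows "R_Lagrangian_plane_field TA (fundamental_form g J) DIM('n) (mixed_plane A nabla f1 f2)"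
  unfolding R_Lagrangian_plane_field_def vanishes_on_def mcarrier_tangent_atlas
proof (intro conjI ballI)
  show "plane_field TA DIM('n) (mixed_plane A nabla f1 f2)"
    using mixed_plane_field f by blast
qed (auto intro: omega_mixed_plane)

theorem R_Lagrangian_mixed_distribution:
  assumes f: "\<And>u. u \<in> TM A \<Longrightarrow> f1 u \<noteq> 0 \<or> f2 u \<noteq> 0"
    and f12: "smooth_fun TA (TM A) f1" "smooth_fun TA (TM A) f2"
  shows "R_Lagrangian_distribution TA (fundamental_form g J) DIM('n) (mixed_plane A nabla f1 f2)"
  unfolding R_Lagrangian_distribution_def vanishes_on_def mcarrier_tangent_atlas
proof (intro conjI ballI)
  show "distribution TA DIM('n) (mixed_plane A nabla f1 f2)"
    using mixed_plane_distribution[OF _ f12] f by blast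
qed (auto intro: omega_mixed_plane)

end

context smooth_atlas
begin

text \<open>The identifications of plane fields below hold on the total space only, so they cannot
  be used as equations between functions.\<close>

lemma R_Lagrangian_plane_field_cong:
  assumes "R_Lagrangian_plane_field A om m P" "\<And>p. p \<in> mcarrier A \<Longrightarrow> P p = Q p"
  shows "R_Lagrangian_plane_field A om m Q"
  using assms unfolding R_Lagrangian_plane_field_def plane_field_def vanishes_on_def by simp

lemma R_Lagrangian_distribution_cong:
  assumes P: "R_Lagrangian_distribution A om m P" and PQ: "\<And>p. p \<in> mcarrier A \<Longrightarrow> P p = Q p"
  shows "R_Lagrangian_distribution A om m Q"
proof -
  have 1: "plane_field A m Q" "vanishes_on om (mcarrier A) Q" "2 * m = DIM('n)"
    using assms unfolding R_Lagrangian_distribution_def distribution_def plane_field_def vanishes_on_def by simp_all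
  have "\<exists>W X. mopen A W \<and> p \<in> W \<and> (\<forall>i<m. smooth_vector_field A W (X i)) \<and>
      (\<forall>q\<in>W. Q q = span ((\<lambda>i. X i q) ` {..<m}))" if p: "p \<in> mcarrier A" for p
  proof -
    obtain W X where W: "mopen A W" "p \<in> W" "\<forall>i<m. smooth_vector_field A W (X i)"
      "\<forall>q\<in>W. P q = span ((\<lambda>i. X i q) ` {..<m})"
      using P p unfolding R_Lagrangian_distribution_def distribution_def by blast
    \<comment> \<open>An open domain of a local frame lies in the carrier, where \<open>P\<close>
      and \<open>Q\<close> agree; the same frame therefore serves \<open>Q\<close>.\<close>
    have "W \<subseteq> mcarrier A" using W(1) unfolding mopen_def by blast
    then have "\<forall>q\<in>W. Q q = span ((\<lambda>i. X i q) ` {..<m})" using W(4) PQ by (metis subsetD)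
    then show ?thesis using W(1-3) by blast
  qed
  then show ?thesis unfolding R_Lagrangian_distribution_def distribution_def using 1 by blast
qed

end

section \<open>The second fundamental forms\<close>

text \<open>Lets the terms of Koszul's formula be computed as ordinary derivatives along coordinate
  lines.\<close>

lemma frechet_eq_line_derivative:
  fixes F :: "'n::real_normed_vector \<Rightarrow> real"
  assumes F: "(F has_derivative F') (at z)" and "((\<lambda>t. F (z + t *\<^sub>R a)) has_real_derivative d) (at 0)"
  shows "F' a = d"
  using has_derivative_line[OF F, of a] assms(2)
  unfolding has_real_derivative_iff_has_vector_derivative by (rule vector_derivative_unique_at)

lemma DERIV_locally_eq:
  fixes f h :: "real \<Rightarrow> real"
  assumes "(f has_real_derivative d) (at 0)" "open T" "0 \<in> T" "\<And>t. t \<in> T \<Longrightarrow> f t = h t"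
  shows "(h has_real_derivative d) (at 0)"
  using has_field_derivative_transform_within_open[OF assms] .

context weighted_tangent_bundle
begin

section \<open>Derivatives of radial weights\<close>

lemma chart_inv_tc_in:
  assumes c: "c \<in> A" and x: "x \<in> snd c ` fst c"
  shows "chart_inv (tc c) (x, y) \<in> fst (tc c)" "snd (tc c) (chart_inv (tc c) (x, y)) = (x, y)"
proof -
  have *: "(x, y) \<in> snd (tc c) ` fst (tc c)" unfolding tangent_chart_domain_image[OF c] using x by simp
  show "chart_inv (tc c) (x, y) \<in> fst (tc c)"
    by (rule T.chart_inv_in[OF tangent_atlasI[OF c] * subset_refl])
  show "snd (tc c) (chart_inv (tc c) (x, y)) = (x, y)"
    by (rule T.chart_inv_right[OF tangent_atlasI[OF c] *])
qed

lemma weight_has_derivative: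
  assumes w: "radial_weight A gM w" and c: "c \<in> A" and x: "x \<in> snd c ` fst c"
  shows "((\<lambda>z. w (chart_inv (tc c) z)) has_derivative
    frechet_derivative (\<lambda>z. w (chart_inv (tc c) z)) (at (x, y))) (at (x, y))"
proof -
  have "TM A \<inter> fst (tc c) = fst (tc c)" using tc_in(1) by blast
  then have "smooth_on (snd (tc c) ` fst (tc c)) (\<lambda>z. w (chart_inv (tc c) z))"
    using w tangent_atlasI[OF c] unfolding radial_weight_def smooth_fun_def comp_def by fastforce
  from smooth_on_has_derivative[OF this] show ?thesis
    unfolding tangent_chart_domain_image[OF c] using x by blast
qed

text \<open>The square root of the norm is absorbed into \<open>k\<close>, leaving a function of the
  squared length of \<open>y\<close> at \<open>x\<close>; the same \<open>k\<close> works in every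
  chart.\<close>

lemma radial_weight_coord:
  assumes w: "radial_weight A gM w"
  obtains k where "\<And>c x y. c \<in> A \<Longrightarrow> x \<in> snd c ` fst c \<Longrightarrow>
    w (chart_inv (tc c) (x, y)) = k (metric_coord A gM c y y x)"
proof -
  obtain k where k: "\<And>u. u \<in> TM A \<Longrightarrow> w u = k (tnorm gM u)"
    using w unfolding radial_weight_def by blast
  show ?thesis
  proof (rule that[of "\<lambda>r. k (sqrt r)"])
    fix c x y assume c: "c \<in> A" and x: "x \<in> snd c ` fst c"
    show "w (chart_inv (tc c) (x, y)) = k (sqrt (metric_coord A gM c y y x))"
      using k[OF tc_in(1)[OF chart_inv_tc_in(1)[OF c x]], of y]
      unfolding tnorm_def chart_inv_tangent_chart[OF c x] metric_coord_def by simp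
  qed
qed

text \<open>Metricity of \<open>nabla\<close> along a coordinate line, in the one-variable form that
  derivative rules can combine.\<close>

lemma metric_coord_line:
  assumes c: "c \<in> A" and x: "x \<in> snd c ` fst c"
  shows "((\<lambda>t. metric_coord A gM c v w (x + t *\<^sub>R a)) has_real_derivative
    metric_coord A gM c (Chr c (chart_inv c x) a v) w x + metric_coord A gM c v (Chr c (chart_inv c x) a w) x) (at 0)"
proof -
  have p: "chart_inv c x \<in> fst c" using chart_inv_in[OF c x subset_refl] .
  show ?thesis
    using has_derivative_line[OF metric_coord_has_derivative[OF gM c p, of v w], of a]
      levi_civita_metric_coord[OF gM levi c p, of v w a] chart_inv_right[OF c x]
    unfolding metric_coord_def[of A gM c _ _ x] has_real_derivative_iff_has_vector_derivative by simp
qed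

text \<open>A horizontal vector is the velocity of a curve of constant norm: rescale a line in the chart
  to constant norm. By metricity the scaling factor is stationary at \<open>0\<close>, so the velocity does not
  change.\<close>

lemma weight_horizontal_derivative:
  assumes w: "radial_weight A gM w" and c: "c \<in> A" and x: "x \<in> snd c ` fst c"
  shows "frechet_derivative (\<lambda>z. w (chart_inv (tc c) z)) (at (x, y)) (a, - Chr c (chart_inv c x) a y) = 0"
proof -
  define b where "b = - Chr c (chart_inv c x) a y"
  define f where "f z = w (chart_inv (tc c) z)" for z
  let ?M = "metric_coord A gM c"
  let ?f' = "frechet_derivative f (at (x, y))"
  let ?T = "{t. x + t *\<^sub>R a \<in> snd c ` fst c}"
  have f': "(f has_derivative ?f') (at (x, y))"
    using weight_has_derivative[OF w c x] unfolding f_def .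
  obtain k where k: "\<And>x y. x \<in> snd c ` fst c \<Longrightarrow> f (x, y) = k (?M y y x)"
    using radial_weight_coord[OF w] c unfolding f_def by metis
  have T: "open ?T" "0 \<in> ?T" using open_line_preimage[OF open_chart_image[OF c]] x by auto
  have "?f' (a, b) = 0"
  \<comment> \<open>Rescaling to constant norm is impossible from the zero vector; there
    \<open>b = 0\<close>, so the line stays in the zero section and the weight is the constant
    \<open>k 0\<close>.\<close>
  proof (cases "y = 0")
    case True
    then have b0: "b = 0" unfolding b_def by (simp add: christoffel_simps)
    have "((\<lambda>t::real. k 0) has_real_derivative 0) (at 0)" by simp
    then have "((\<lambda>t. f ((x, y) + t *\<^sub>R (a, b))) has_real_derivative 0) (at 0)"
    proof (rule DERIV_locally_eq[OF _ T])
      fix t assume "t \<in> ?T"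
      then have "x + t *\<^sub>R a \<in> snd c ` fst c" by simp
      from k[OF this, of 0] metric_coord_zero_left[OF c this]
      show "k 0 = f ((x, y) + t *\<^sub>R (a, b))" unfolding True b0 by simp
    qed
    then show ?thesis by (rule frechet_eq_line_derivative[OF f'])
  next
    case False
    define N where "N t = ?M (y + t *\<^sub>R b) (y + t *\<^sub>R b) (x + t *\<^sub>R a)" for t
    \<comment> \<open>\<open>N\<close> expanded by bilinearity: \<open>metric_coord_line\<close>
      covers fixed vectors only, so the dependence on \<open>t\<close> is moved into scalar
      factors.\<close>
    have "((\<lambda>t. ?M y y (x + t *\<^sub>R a) + 2 * t * ?M y b (x + t *\<^sub>R a) + t\<^sup>2 * ?M b b (x + t *\<^sub>R a))
        has_real_derivative 2 * ?M y (Chr c (chart_inv c x) a y) x + 2 * ?M y b x) (at 0)"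
      by (rule derivative_eq_intros metric_coord_line[OF c x] refl)+
        (simp add: metric_coord_sym[OF c x, of _ y])
    \<comment> \<open>The two contributions cancel since \<open>b\<close> is minus the Christoffel
      term.\<close>
    moreover have "2 * ?M y (Chr c (chart_inv c x) a y) x + 2 * ?M y b x = 0"
      unfolding b_def using metric_coord_scale_right[OF c x, of y "-1"] by simp
    ultimately have "((\<lambda>t. ?M y y (x + t *\<^sub>R a) + 2 * t * ?M y b (x + t *\<^sub>R a) + t\<^sup>2 * ?M b b (x + t *\<^sub>R a))
        has_real_derivative 0) (at 0)" by simp
    then have N': "(N has_real_derivative 0) (at 0)"
    proof (rule DERIV_locally_eq[OF _ T])
      fix t assume "t \<in> ?T"
      then have t: "x + t *\<^sub>R a \<in> snd c ` fst c" by simp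
      show "?M y y (x + t *\<^sub>R a) + 2 * t * ?M y b (x + t *\<^sub>R a) + t\<^sup>2 * ?M b b (x + t *\<^sub>R a) = N t"
        unfolding N_def metric_coord_add_left[OF c t] metric_coord_add_right[OF c t]
          metric_coord_scale_left[OF c t] metric_coord_scale_right[OF c t]
        using metric_coord_sym[OF c t, of b y] by (simp add: power2_eq_square algebra_simps)
    qed
    have N0: "N 0 > 0" unfolding N_def using metric_coord_pos[OF c x False] by simp
    \<comment> \<open>The rescaling factor, chosen so that the squared norm of the rescaled curve is
      \<open>N 0\<close>; its derivative at 0 vanishes along with that of \<open>N\<close>.\<close>
    define \<rho> where "\<rho> t = sqrt (N 0 / N t)" for t
    have \<rho>0: "\<rho> 0 = 1" unfolding \<rho>_def using N0 by simp
    have \<rho>': "(\<rho> has_real_derivative 0) (at 0)"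
      unfolding \<rho>_def by (rule derivative_eq_intros N' refl | use N0 in simp)+
    have "((\<lambda>t. (x + t *\<^sub>R a, \<rho> t *\<^sub>R (y + t *\<^sub>R b))) has_derivative (\<lambda>t. t *\<^sub>R (a, b))) (at 0)"
    proof -
      have "(\<rho> has_derivative (\<lambda>t. 0 * t)) (at 0)"
        using \<rho>' unfolding has_field_derivative_def .
      then show ?thesis
        by (auto intro!: derivative_eq_intros simp: \<rho>0)
    qed
    from has_derivative_compose[OF this, of f ?f'] f'
    have "((\<lambda>t. f (x + t *\<^sub>R a, \<rho> t *\<^sub>R (y + t *\<^sub>R b))) has_derivative (\<lambda>t. ?f' (t *\<^sub>R (a, b)))) (at 0)"
      by (simp add: \<rho>0)
    then have 1: "((\<lambda>t. f (x + t *\<^sub>R a, \<rho> t *\<^sub>R (y + t *\<^sub>R b))) has_real_derivative ?f' (a, b)) (at 0)"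
      unfolding has_real_derivative_iff_has_vector_derivative has_vector_derivative_def
        linear_scale[OF has_derivative_linear[OF f']] .
    \<comment> \<open>The normalisation identity divides by \<open>N t\<close> and takes a root, so
      positivity is secured near 0.\<close>
    have "isCont N 0" using DERIV_isCont[OF N'] .
    then have "\<forall>\<^sub>F t in at 0. N t > 0"
      using N0 unfolding isCont_def by (rule order_tendstoD(1))
    then obtain R where R: "open R" "0 \<in> R" "\<And>t. t \<in> R \<Longrightarrow> t \<noteq> 0 \<Longrightarrow> N t > 0"
      unfolding eventually_at_topological by auto
    then have Rp: "N t > 0" if "t \<in> R" for t using N0 that by (cases "t = 0") auto
    have "((\<lambda>t::real. k (N 0)) has_real_derivative 0) (at 0)" by simp
    then have "((\<lambda>t. f (x + t *\<^sub>R a, \<rho> t *\<^sub>R (y + t *\<^sub>R b))) has_real_derivative 0) (at 0)"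
    proof (rule DERIV_locally_eq[where T = "?T \<inter> R"])
      fix t assume tR: "t \<in> ?T \<inter> R"
      then have t: "x + t *\<^sub>R a \<in> snd c ` fst c" by simp
      have "\<rho> t * (\<rho> t * N t) = N 0"
        unfolding \<rho>_def using Rp[of t] N0 tR by (simp add: mult.assoc[symmetric])
      then show "k (N 0) = f (x + t *\<^sub>R a, \<rho> t *\<^sub>R (y + t *\<^sub>R b))"
        unfolding k[OF t] metric_coord_scale_left[OF c t] metric_coord_scale_right[OF c t] N_def[of t, symmetric]
        by simp
    qed (use T R in auto)
    with 1 show ?thesis by (rule DERIV_unique)
  qed
  then show ?thesis unfolding f_def b_def .
qed

text \<open>Along a fibre a radial weight is even, hence stationary at the zero section.\<close>

lemma weight_zero_section_derivative:
  assumes w: "radial_weight A gM w" and c: "c \<in> A" and x: "x \<in> snd c ` fst c"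
  shows "frechet_derivative (\<lambda>z. w (chart_inv (tc c) z)) (at (x, 0)) (0, r) = 0"
proof -
  define f where "f z = w (chart_inv (tc c) z)" for z
  let ?f' = "frechet_derivative f (at (x, 0))"
  have f': "(f has_derivative ?f') (at (x, 0))"
    using weight_has_derivative[OF w c x] unfolding f_def .
  obtain k where k: "\<And>y. f (x, y) = k (metric_coord A gM c y y x)"
    using radial_weight_coord[OF w] c x unfolding f_def by metis
  have even: "f (x, y) = f (x, - y)" for y
    unfolding k using metric_coord_scale_left[OF c x, of "-1"] metric_coord_scale_right[OF c x, of _ "-1"] by simp
  have 1: "((\<lambda>t. f ((x, 0) + t *\<^sub>R (0, r))) has_real_derivative ?f' (0, r)) (at 0)"
    using has_derivative_line[OF f'] unfolding has_real_derivative_iff_has_vector_derivative .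
  have 2: "((\<lambda>t. f ((x, 0) + t *\<^sub>R (0, - r))) has_real_derivative ?f' (0, - r)) (at 0)"
    using has_derivative_line[OF f'] unfolding has_real_derivative_iff_has_vector_derivative .
  have "(\<lambda>t. f ((x, 0) + t *\<^sub>R (0, - r))) = (\<lambda>t. f ((x, 0) + t *\<^sub>R (0, r)))"
    using even by simp
  then have "?f' (0, - r) = ?f' (0, r)" using 1 2 DERIV_unique by metis
  moreover have "?f' (0, - r) = - ?f' (0, r)"
    using linear_neg[OF has_derivative_linear[OF f'], of "(0, r)"] by simp
  ultimately show ?thesis unfolding f_def by simp
qed

lemma weight_line:
  assumes w: "radial_weight A gM w" and c: "c \<in> A" and x: "x \<in> snd c ` fst c"
  shows "((\<lambda>t. w (chart_inv (tc c) ((x, y) + t *\<^sub>R z))) has_real_derivative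
    frechet_derivative (\<lambda>z. w (chart_inv (tc c) z)) (at (x, y)) z) (at 0)"
  using has_derivative_line[OF weight_has_derivative[OF w c x]]
  unfolding has_real_derivative_iff_has_vector_derivative .

lemma total_metric_derivative_eq:
  assumes c: "c \<in> A" and u: "u \<in> fst (tc c)"
    and "((\<lambda>t. metric_coord TA g (tc c) v w (snd (tc c) u + t *\<^sub>R a)) has_real_derivative d) (at 0)"
  shows "frechet_derivative (metric_coord TA g (tc c) v w) (at (snd (tc c) u)) a = d"
  by (rule frechet_eq_line_derivative[OF T.metric_coord_has_derivative[OF riemannian_g tangent_atlasI[OF c] u] assms(3)])

text \<open>The fibre directions contribute lam^2 gM(w, C s v) and lam^2 gM(v, C s w) to Koszul's
  formula. The derivative of lam^2 gM(v, w) along the horizontal test vector is their sum, by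
  metricity and stationarity of the weight, so everything cancels.\<close>

theorem christoffel_fibre:
  assumes DT: "levi_civita TA g D" and c: "c \<in> A" and u: "u \<in> fst (tc c)"
  shows "fst (christoffel TA D (tc c) u (0, v) (0, w)) = 0"
proof -
  define x y where "x = snd c (fst u)" and "y = snd u c"
  have x: "x \<in> snd c ` fst c" unfolding x_def using tc_in(2)[OF u] by blast
  have uxy: "snd (tc c) u = (x, y)" unfolding x_def y_def snd_tangent_chart ..
  have uinv: "chart_inv (tc c) (x, y) = u"
    using T.chart_inv_left[OF tangent_atlasI[OF c] u] unfolding uxy .
  let ?M = "metric_coord A gM c"
  let ?G = "metric_coord TA g (tc c)"
  define C where "C = Chr c (chart_inv c x)"
  define l where "l z = lam (chart_inv (tc c) z)" for z
  obtain s t where st: "christoffel TA D (tc c) u (0, v) (0, w) = (s, t)" by fastforce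
  \<comment> \<open>Horizontal at (x, y) with the base component under study, so its pairing with
    the Christoffel vector sees only \<open>s\<close>.\<close>
  define z where "z = (s, - C s y)"
  note Csimps = christoffel_simps[of A nabla c "chart_inv c x", folded C_def]
  \<comment> \<open>The coordinates of \<open>z\<close> are kept fixed while the point moves up the
    fibre, so \<open>z\<close> acquires the vertical part t C s v'. The factor \<open>t\<close>
    makes the derivative of the weight irrelevant at 0.\<close>
  have F: "((\<lambda>t. ?G (0, w') z ((x, y) + t *\<^sub>R (0, v'))) has_real_derivative (l (x, y))\<^sup>2 * ?M w' (C s v') x) (at 0)" for v' w'
  proof -
    have "?G (0, w') z ((x, y) + t *\<^sub>R (0, v')) = t * ((l ((x, y) + t *\<^sub>R (0, v')))\<^sup>2 * ?M w' (C s v') x)" for t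
      unfolding z_def scaleR_Pair add_Pair scaleR_zero_right add_0_right
        metric_coord_total[OF c x] C_def[symmetric] l_def[symmetric] Csimps
        metric_coord_zero_left[OF c x]
      by (simp add: metric_coord_scale_right[OF c x])
    moreover have "((\<lambda>t. t * ((l ((x, y) + t *\<^sub>R (0, v')))\<^sup>2 * ?M w' (C s v') x))
        has_real_derivative (l (x, y))\<^sup>2 * ?M w' (C s v') x) (at 0)"
      by (rule derivative_eq_intros weight_line[OF lam c x, folded l_def] refl)+ simp
    ultimately show ?thesis by simp
  qed
  \<comment> \<open>Vectors without base component have no Christoffel correction at any point, so
    only the weight and the base metric vary along \<open>z\<close>.\<close>
  have G: "((\<lambda>t. ?G (0, v) (0, w) ((x, y) + t *\<^sub>R z)) has_real_derivative
      (l (x, y))\<^sup>2 * (?M (C s v) w x + ?M v (C s w) x)) (at 0)"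
  proof -
    have "((\<lambda>t. (l ((x, y) + t *\<^sub>R z))\<^sup>2 * ?M v w (x + t *\<^sub>R s)) has_real_derivative
        (l (x, y))\<^sup>2 * (?M (C s v) w x + ?M v (C s w) x)) (at 0)"
      unfolding C_def
      by (rule derivative_eq_intros weight_line[OF lam c x, folded l_def] metric_coord_line[OF c x] refl)+
        (use weight_horizontal_derivative[OF lam c x, of y s] in \<open>simp add: z_def C_def l_def\<close>)
    then show ?thesis
    proof (rule DERIV_locally_eq[where T = "{t. x + t *\<^sub>R s \<in> snd c ` fst c}"])
      fix t assume "t \<in> {t. x + t *\<^sub>R s \<in> snd c ` fst c}"
      then have t: "x + t *\<^sub>R s \<in> snd c ` fst c" by simp
      show "(l ((x, y) + t *\<^sub>R z))\<^sup>2 * ?M v w (x + t *\<^sub>R s) = ?G (0, v) (0, w) ((x, y) + t *\<^sub>R z)"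
        unfolding z_def scaleR_Pair add_Pair metric_coord_total[OF c t] l_def christoffel_simps metric_coord_zero_left[OF c t]
        by simp
    qed (use open_line_preimage[OF open_chart_image[OF c]] x in auto)
  qed
  have "2 * ?G (s, t) z (x, y) =
      (l (x, y))\<^sup>2 * ?M w (C s v) x + (l (x, y))\<^sup>2 * ?M v (C s w) x - (l (x, y))\<^sup>2 * (?M (C s v) w x + ?M v (C s w) x)"
    using T.koszul_coord[OF riemannian_g DT tangent_atlasI[OF c] u, of "(0, v)" "(0, w)" z]
    unfolding st total_metric_derivative_eq[OF c u F[of w v, folded uxy]]
      total_metric_derivative_eq[OF c u F[of v w, folded uxy]]
      total_metric_derivative_eq[OF c u G[folded uxy]]
    unfolding metric_coord_def[of TA] uinv uxy .
  then have "?G (s, t) z (x, y) = 0"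
    using metric_coord_sym[OF c x, of w] by (simp add: algebra_simps)
  \<comment> \<open>At (x, y) the vertical part of \<open>z\<close> vanishes, which removes the
    \<open>lam\<close> term.\<close>
  then have "(mu u)\<^sup>2 * ?M s s x = 0"
    unfolding z_def metric_coord_total[OF c x] uinv C_def
    by (simp add: metric_coord_zero_right[OF c x])
  then have "?M s s x = 0" using weights_pos(1)[OF tc_in(1)[OF u]] by simp
  then show ?thesis using metric_coord_pos[OF c x, of s] unfolding st by fastforce
qed

text \<open>All three terms of Koszul's formula vanish when the test vector is the fibre component
  \<open>r\<close> itself: two of them differentiate a function that is zero along the zero section,
  the third uses that \<open>mu\<close> is stationary in vertical directions there.\<close>

theorem christoffel_zero_section:
  assumes DT: "levi_civita TA g D" and c: "c \<in> A" and u: "u \<in> fst (tc c)" and u0: "snd u = 0"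
  shows "snd (christoffel TA D (tc c) u (v, 0) (w, 0)) = 0"
proof -
  define x where "x = snd c (fst u)"
  have x: "x \<in> snd c ` fst c" unfolding x_def using tc_in(2)[OF u] by blast
  have uxy: "snd (tc c) u = (x, 0)" unfolding x_def snd_tangent_chart u0 by simp
  have uinv: "chart_inv (tc c) (x, 0) = u"
    using T.chart_inv_left[OF tangent_atlasI[OF c] u] unfolding uxy .
  let ?M = "metric_coord A gM c"
  let ?G = "metric_coord TA g (tc c)"
  define C where "C = Chr c (chart_inv c x)"
  define l where "l z = lam (chart_inv (tc c) z)" for z
  define k where "k z = mu (chart_inv (tc c) z)" for z
  obtain s r where sr: "christoffel TA D (tc c) u (v, 0) (w, 0) = (s, r)" by fastforce
  note Csimps = christoffel_simps[of A nabla c "chart_inv c x", folded C_def]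
  \<comment> \<open>Over the zero section the Christoffel terms are zero, so base and fibre
    coordinate directions are orthogonal along the whole line.\<close>
  have F: "((\<lambda>t. ?G (w', 0) (0, r) ((x, 0) + t *\<^sub>R (v', 0))) has_real_derivative 0) (at 0)" for v' w'
  proof -
    have "((\<lambda>t::real. 0) has_real_derivative 0) (at 0)" by simp
    then show ?thesis
    proof (rule DERIV_locally_eq[where T = "{t. x + t *\<^sub>R v' \<in> snd c ` fst c}"])
      fix t assume "t \<in> {t. x + t *\<^sub>R v' \<in> snd c ` fst c}"
      then have t: "x + t *\<^sub>R v' \<in> snd c ` fst c" by simp
      show "0 = ?G (w', 0) (0, r) ((x, 0) + t *\<^sub>R (v', 0))"
        unfolding scaleR_Pair add_Pair scaleR_zero_right add_0_right metric_coord_total[OF c t] christoffel_simps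
          metric_coord_zero_left[OF c t] metric_coord_zero_right[OF c t] by simp
    qed (use open_line_preimage[OF open_chart_image[OF c]] x in auto)
  qed
  \<comment> \<open>Moving up the fibre by \<open>t r\<close> gives each base vector a vertical part
    of size \<open>t\<close>; the resulting term is quadratic in \<open>t\<close>, and only the
    derivative of \<open>mu\<close> could survive.\<close>
  have G: "((\<lambda>t. ?G (v, 0) (w, 0) ((x, 0) + t *\<^sub>R (0, r))) has_real_derivative 0) (at 0)"
  proof -
    have "?G (v, 0) (w, 0) ((x, 0) + t *\<^sub>R (0, r)) = (k ((x, 0) + t *\<^sub>R (0, r)))\<^sup>2 * ?M v w x +
        t * (t * ((l ((x, 0) + t *\<^sub>R (0, r)))\<^sup>2 * ?M (C v r) (C w r) x))" for t
      unfolding scaleR_Pair add_Pair scaleR_zero_right add_0_right add_0_left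
        metric_coord_total[OF c x] C_def[symmetric] l_def[symmetric] k_def[symmetric] Csimps
      by (simp add: metric_coord_scale_right[OF c x] metric_coord_scale_left[OF c x])
    moreover have "((\<lambda>t. (k ((x, 0) + t *\<^sub>R (0, r)))\<^sup>2 * ?M v w x +
        t * (t * ((l ((x, 0) + t *\<^sub>R (0, r)))\<^sup>2 * ?M (C v r) (C w r) x))) has_real_derivative 0) (at 0)"
      by (rule derivative_eq_intros weight_line[OF lam c x, folded l_def] weight_line[OF mu c x, folded k_def] refl)+
        (use weight_zero_section_derivative[OF mu c x, of r] in \<open>simp add: k_def\<close>)
    ultimately show ?thesis by simp
  qed
  have "2 * ?G (s, r) (0, r) (x, 0) = 0 + 0 - 0"
    using T.koszul_coord[OF riemannian_g DT tangent_atlasI[OF c] u, of "(v, 0)" "(w, 0)" "(0, r)"]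
    unfolding sr total_metric_derivative_eq[OF c u F[of w v, folded uxy]]
      total_metric_derivative_eq[OF c u F[of v w, folded uxy]]
      total_metric_derivative_eq[OF c u G[folded uxy]]
    unfolding metric_coord_def[of TA] uinv .
  then have "(lam u)\<^sup>2 * ?M r r x = 0"
    unfolding metric_coord_total[OF c x] uinv christoffel_simps
    by (simp add: metric_coord_zero_right[OF c x])
  then have "?M r r x = 0" using weights_pos(2)[OF tc_in(1)[OF u]] by simp
  then show ?thesis using metric_coord_pos[OF c x, of r] unfolding sr by fastforce
qed

text \<open>A vector is zero exactly when its coordinates in one chart are, so the slice is the set
  of points with fibre coordinate 0.\<close>

lemma zero_section_adapted:
  assumes c: "c \<in> A"
  shows "adapted_chart TA (zero_section A) (tc c) (UNIV \<times> {0})"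
  unfolding adapted_chart_def
proof (intro conjI ballI tangent_atlasI[OF c])
  show "subspace (UNIV \<times> {0} :: ('n \<times> 'n) set)"
    by (simp add: subspace_Times)
  fix q assume q: "q \<in> fst (tc c) \<inter> zero_section A"
  then have q0: "snd (snd (tc c) q) = 0" unfolding zero_section_def snd_tangent_chart by auto
  show "snd (tc c) ` (fst (tc c) \<inter> zero_section A) =
      {x \<in> snd (tc c) ` fst (tc c). x - snd (tc c) q \<in> UNIV \<times> {0}}"
  proof (intro set_eqI iffI)
    fix z assume "z \<in> snd (tc c) ` (fst (tc c) \<inter> zero_section A)"
    then show "z \<in> {x \<in> snd (tc c) ` fst (tc c). x - snd (tc c) q \<in> UNIV \<times> {0}}"
      using q0 unfolding zero_section_def by (auto simp: snd_tangent_chart mem_Times_iff)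
  next
    fix z assume z: "z \<in> {x \<in> snd (tc c) ` fst (tc c). x - snd (tc c) q \<in> UNIV \<times> {0}}"
    then obtain u where u: "u \<in> fst (tc c)" "z = snd (tc c) u" by blast
    have "snd u c = 0" using z q0 unfolding u(2) by (simp add: snd_tangent_chart mem_Times_iff)
    then have "snd u = 0"
      by (intro tangent_eqI[OF c tc_in(2,3)[OF u(1)] subspace_0[OF subspace_tangent_space]]) simp
    then have "u \<in> zero_section A"
      unfolding zero_section_def using mcarrierI[OF c tc_in(2)[OF u(1)]] by (cases u) simp
    then show "z \<in> snd (tc c) ` (fst (tc c) \<inter> zero_section A)" using u by blast
  qed
qed

text \<open>Points of the fibre in the chart are those sharing the base coordinates of
  \<open>q\<close>, because the base chart is injective.\<close>

lemma fibre_adapted: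
  assumes c: "c \<in> A"
  shows "adapted_chart TA (tangent_fibre A p) (tc c) ({0} \<times> UNIV)"
  unfolding adapted_chart_def
proof (intro conjI ballI tangent_atlasI[OF c])
  show "subspace ({0} \<times> UNIV :: ('n \<times> 'n) set)"
    by (simp add: subspace_Times)
  fix q assume q: "q \<in> fst (tc c) \<inter> tangent_fibre A p"
  then have q0: "fst q = p" unfolding tangent_fibre_def by auto
  show "snd (tc c) ` (fst (tc c) \<inter> tangent_fibre A p) =
      {x \<in> snd (tc c) ` fst (tc c). x - snd (tc c) q \<in> {0} \<times> UNIV}"
  proof (intro set_eqI iffI)
    fix z assume "z \<in> snd (tc c) ` (fst (tc c) \<inter> tangent_fibre A p)"
    then show "z \<in> {x \<in> snd (tc c) ` fst (tc c). x - snd (tc c) q \<in> {0} \<times> UNIV}"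
    proof -
      assume "z \<in> snd (tc c) ` (fst (tc c) \<inter> tangent_fibre A p)"
      then obtain u where u: "u \<in> fst (tc c)" "u \<in> tangent_fibre A p" "z = snd (tc c) u" by blast
      have "fst u = p" using u(2) unfolding tangent_fibre_def by auto
      then have "z - snd (tc c) q \<in> {0} \<times> UNIV"
        using q0 unfolding u(3) by (simp add: snd_tangent_chart mem_Times_iff)
      then show ?thesis using u by blast
    qed
  next
    fix z assume z: "z \<in> {x \<in> snd (tc c) ` fst (tc c). x - snd (tc c) q \<in> {0} \<times> UNIV}"
    then obtain u where u: "u \<in> fst (tc c)" "z = snd (tc c) u" by blast
    have "snd c (fst u) = snd c (fst q)" using z unfolding u(2) by (simp add: snd_tangent_chart mem_Times_iff)
    moreover have "fst q \<in> fst c" using q tc_in(2) by blast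
    ultimately have "fst u = p"
      using inj_onD[OF chart_inj[OF c]] tc_in(2)[OF u(1)] unfolding q0 by blast
    then have "u \<in> tangent_fibre A p"
      unfolding tangent_fibre_def using tc_in(3)[OF u(1)] by (cases u) simp
    then show "z \<in> snd (tc c) ` (fst (tc c) \<inter> tangent_fibre A p)" using u by blast
  qed
qed

lemma zero_section_subset: "zero_section A \<subseteq> TM A"
  unfolding zero_section_def TM_def using subspace_0[OF subspace_tangent_space] by auto

lemma tangent_fibre_subset: "p \<in> mcarrier A \<Longrightarrow> tangent_fibre A p \<subseteq> TM A"
  unfolding tangent_fibre_def TM_def by auto

text \<open>Both sides consist of the tangent vectors with fibre coordinate -\<Gamma>(s, u) over an
  arbitrary base coordinate \<open>s\<close>.\<close>

lemma horizontal_eq: "u \<in> TM A \<Longrightarrow> horizontal A nabla u = mixed_plane A nabla (\<lambda>_. 1) (\<lambda>_. 0) u"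
proof -
  assume uT: "u \<in> TM A"
  then obtain c where c: "c \<in> A" and u: "u \<in> fst (tc c)" by (rule TM_E)
  note tc = tangent_atlasI[OF c]
  have "\<xi> \<in> horizontal A nabla u \<longleftrightarrow> \<xi> \<in> range (plane_vector (\<lambda>_. 1) (\<lambda>_. 0) c u)" for \<xi>
  proof
    assume \<xi>: "\<xi> \<in> horizontal A nabla u"
    note * = horizontalD[OF conn c u \<xi>]
    have "\<xi> (tc c) = (fst (\<xi> (tc c)), - Chr c (fst u) (fst (\<xi> (tc c))) (snd u c))"
      using *(2) by (intro prod_eqI) simp_all
    then have "\<xi> = plane_vector (\<lambda>_. 1) (\<lambda>_. 0) c u (fst (\<xi> (tc c)))"
      unfolding plane_vector_def
      by (intro T.tangent_eqI[OF tc u *(1) T.tvec_of_in[OF tc u]]) (simp add: T.tvec_of_coord[OF tc u])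
    then show "\<xi> \<in> range (plane_vector (\<lambda>_. 1) (\<lambda>_. 0) c u)" by blast
  next
    assume "\<xi> \<in> range (plane_vector (\<lambda>_. 1) (\<lambda>_. 0) c u)"
    then obtain v where \<xi>: "\<xi> = plane_vector (\<lambda>_. 1) (\<lambda>_. 0) c u v" by blast
    show "\<xi> \<in> horizontal A nabla u"
      unfolding \<xi> plane_vector_def
      by (rule horizontalI[OF conn c u T.tvec_of_in[OF tc u]]) (simp add: T.tvec_of_coord[OF tc u])
  qed
  then show ?thesis unfolding mixed_plane_eq[OF c u] by blast
qed

lemma vertical_eq: "u \<in> TM A \<Longrightarrow> vertical A u = mixed_plane A nabla (\<lambda>_. 0) (\<lambda>_. 1) u"
proof -
  assume uT: "u \<in> TM A"
  then obtain c where c: "c \<in> A" and u: "u \<in> fst (tc c)" by (rule TM_E)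
  note tc = tangent_atlasI[OF c]
  have "\<xi> \<in> vertical A u \<longleftrightarrow> \<xi> \<in> range (plane_vector (\<lambda>_. 0) (\<lambda>_. 1) c u)" for \<xi>
  proof
    assume \<xi>: "\<xi> \<in> vertical A u"
    then have *: "\<xi> \<in> tangent_space TA u" "fst (\<xi> (tc c)) = 0" unfolding vertical_iff[OF c u] by blast+
    have "\<xi> (tc c) = (0, snd (\<xi> (tc c)))"
      using *(2) by (intro prod_eqI) simp_all
    then have "\<xi> = plane_vector (\<lambda>_. 0) (\<lambda>_. 1) c u (snd (\<xi> (tc c)))"
      unfolding plane_vector_def
      by (intro T.tangent_eqI[OF tc u *(1) T.tvec_of_in[OF tc u]]) (simp add: T.tvec_of_coord[OF tc u])
    then show "\<xi> \<in> range (plane_vector (\<lambda>_. 0) (\<lambda>_. 1) c u)" by blast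
  next
    assume "\<xi> \<in> range (plane_vector (\<lambda>_. 0) (\<lambda>_. 1) c u)"
    then obtain v where \<xi>: "\<xi> = plane_vector (\<lambda>_. 0) (\<lambda>_. 1) c u v" by blast
    show "\<xi> \<in> vertical A u"
      unfolding \<xi> plane_vector_def vertical_iff[OF c u] T.tvec_of_coord[OF tc u]
      using T.tvec_of_in[OF tc u] by simp
  qed
  then show ?thesis unfolding mixed_plane_eq[OF c u] by blast
qed

text \<open>The constant coefficients 1 and 0 are smooth and never vanish together.\<close>

theorem R_Lagrangian_horizontal: "R_Lagrangian_distribution TA (fundamental_form g J) DIM('n) (horizontal A nabla)"
  by (rule T.R_Lagrangian_distribution_cong[OF R_Lagrangian_mixed_distribution])
    (use horizontal_eq in \<open>auto simp: mcarrier_tangent_atlas T.smooth_fun_const\<close>)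

theorem R_Lagrangian_vertical: "R_Lagrangian_distribution TA (fundamental_form g J) DIM('n) (vertical A)"
  by (rule T.R_Lagrangian_distribution_cong[OF R_Lagrangian_mixed_distribution])
    (use vertical_eq in \<open>auto simp: mcarrier_tangent_atlas T.smooth_fun_const\<close>)

lemma dim_factors: "dim (UNIV \<times> {0} :: ('n \<times> 'n) set) = DIM('n)" "dim ({0} \<times> UNIV :: ('n \<times> 'n) set) = DIM('n)"
  by (simp_all add: dim_Times)

lemma double_dim: "2 * DIM('n) = DIM('n \<times> 'n)"
  by simp

theorem R_Lagrangian_zero_section:
  "R_Lagrangian_submanifold TA (fundamental_form g J) DIM('n) (zero_section A)"
  unfolding R_Lagrangian_submanifold_def vanishes_on_def
proof (intro conjI ballI double_dim)
  show "embedded_submanifold TA DIM('n) (zero_section A)"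
  proof (rule T.embedded_submanifoldI)
    show "zero_section A \<subseteq> mcarrier TA" unfolding mcarrier_tangent_atlas by (rule zero_section_subset)
    fix q assume "q \<in> zero_section A"
    then obtain c where c: "c \<in> A" and q: "q \<in> fst (tc c)"
      using zero_section_subset by (blast elim: TM_E)
    then show "\<exists>c S. adapted_chart TA (zero_section A) c S \<and> q \<in> fst c \<and> dim S = DIM('n)"
      using zero_section_adapted[OF c] dim_factors(1) by blast
  qed
  fix q \<xi> \<eta> assume q: "q \<in> zero_section A"
    and \<xi>\<eta>: "\<xi> \<in> submanifold_tangent TA (zero_section A) q" "\<eta> \<in> submanifold_tangent TA (zero_section A) q"
  have qT: "q \<in> TM A" using q zero_section_subset by blast
  then obtain c where c: "c \<in> A" and qc: "q \<in> fst (tc c)" by (rule TM_E)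
  have q0: "snd q = 0" using q unfolding zero_section_def by auto
  have "\<zeta> \<in> mixed_plane A nabla (\<lambda>_. 1) (\<lambda>_. 0) q" if \<zeta>: "\<zeta> \<in> submanifold_tangent TA (zero_section A) q" for \<zeta>
  proof -
    note * = T.submanifold_tangent_subset[OF zero_section_adapted[OF c] qc q \<zeta>]
    \<comment> \<open>At a zero vector the Christoffel term is 0, so a vanishing fibre coordinate
      already means horizontal.\<close>
    have "\<zeta> \<in> horizontal A nabla q"
      by (rule horizontalI[OF conn c qc *(1)]) (use *(2) in \<open>simp add: q0 christoffel_simps mem_Times_iff\<close>)
    then show ?thesis unfolding horizontal_eq[OF qT] .
  qed
  then show "fundamental_form g J q \<xi> \<eta> = 0" using omega_mixed_plane[OF qT] \<xi>\<eta> by blast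
qed

theorem R_Lagrangian_fibre:
  assumes p: "p \<in> mcarrier A"
  shows "R_Lagrangian_submanifold TA (fundamental_form g J) DIM('n) (tangent_fibre A p)"
  unfolding R_Lagrangian_submanifold_def vanishes_on_def
proof (intro conjI ballI double_dim)
  show "embedded_submanifold TA DIM('n) (tangent_fibre A p)"
  proof (rule T.embedded_submanifoldI)
    show "tangent_fibre A p \<subseteq> mcarrier TA" unfolding mcarrier_tangent_atlas by (rule tangent_fibre_subset[OF p])
    fix q assume "q \<in> tangent_fibre A p"
    then obtain c where c: "c \<in> A" and q: "q \<in> fst (tc c)"
      using tangent_fibre_subset[OF p] by (blast elim: TM_E)
    then show "\<exists>c S. adapted_chart TA (tangent_fibre A p) c S \<and> q \<in> fst c \<and> dim S = DIM('n)"
      using fibre_adapted[OF c] dim_factors(2) by blast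
  qed
  fix q \<xi> \<eta> assume q: "q \<in> tangent_fibre A p"
    and \<xi>\<eta>: "\<xi> \<in> submanifold_tangent TA (tangent_fibre A p) q" "\<eta> \<in> submanifold_tangent TA (tangent_fibre A p) q"
  have qT: "q \<in> TM A" using q tangent_fibre_subset[OF p] by blast
  then obtain c where c: "c \<in> A" and qc: "q \<in> fst (tc c)" by (rule TM_E)
  have "\<zeta> \<in> mixed_plane A nabla (\<lambda>_. 0) (\<lambda>_. 1) q" if \<zeta>: "\<zeta> \<in> submanifold_tangent TA (tangent_fibre A p) q" for \<zeta>
  proof -
    note * = T.submanifold_tangent_subset[OF fibre_adapted[OF c] qc q \<zeta>]
    \<comment> \<open>Tangency to the slice says that the base coordinate is 0, which is
      verticality.\<close>
    have "\<zeta> \<in> vertical A q"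
      unfolding vertical_iff[OF c qc] using * by (simp add: mem_Times_iff)
    then show ?thesis unfolding vertical_eq[OF qT] .
  qed
  then show "fundamental_form g J q \<xi> \<eta> = 0" using omega_mixed_plane[OF qT] \<xi>\<eta> by blast
qed

theorem totally_geodesic_zero_section: "totally_geodesic TA g (zero_section A)"
proof (rule T.totally_geodesicI)
  fix D q assume D: "levi_civita TA g D" and q: "q \<in> zero_section A"
  then obtain c where c: "c \<in> A" and qc: "q \<in> fst (tc c)"
    using zero_section_subset by (blast elim: TM_E)
  have q0: "snd q = 0" using q unfolding zero_section_def by auto
  have "christoffel TA D (tc c) q a b \<in> UNIV \<times> {0}" if "a \<in> UNIV \<times> {0}" "b \<in> UNIV \<times> {0}" for a b
  proof -
    have "a = (fst a, 0)" "b = (fst b, 0)" using that by (auto simp: mem_Times_iff intro: prod_eqI)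
    then show ?thesis
      using christoffel_zero_section[OF D c qc q0, of "fst a" "fst b"] by (simp add: mem_Times_iff)
  qed
  then show "\<exists>c S. adapted_chart TA (zero_section A) c S \<and> q \<in> fst c \<and> (\<forall>a\<in>S. \<forall>b\<in>S. christoffel TA D c q a b \<in> S)"
    using zero_section_adapted[OF c] qc by blast
qed

theorem totally_geodesic_fibre:
  assumes p: "p \<in> mcarrier A"
  shows "totally_geodesic TA g (tangent_fibre A p)"
proof (rule T.totally_geodesicI)
  fix D q assume D: "levi_civita TA g D" and q: "q \<in> tangent_fibre A p"
  then obtain c where c: "c \<in> A" and qc: "q \<in> fst (tc c)"
    using tangent_fibre_subset[OF p] by (blast elim: TM_E)
  have "christoffel TA D (tc c) q a b \<in> {0} \<times> UNIV" if "a \<in> {0} \<times> UNIV" "b \<in> {0} \<times> UNIV" for a b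
  proof -
    have "a = (0, snd a)" "b = (0, snd b)" using that by (auto simp: mem_Times_iff intro: prod_eqI)
    then show ?thesis
      using christoffel_fibre[OF D c qc, of "snd a" "snd b"] by (simp add: mem_Times_iff)
  qed
  then show "\<exists>c S. adapted_chart TA (tangent_fibre A p) c S \<and> q \<in> fst c \<and> (\<forall>a\<in>S. \<forall>b\<in>S. christoffel TA D c q a b \<in> S)"
    using fibre_adapted[OF c] qc by blast
qed

section \<open>Smooth coefficients for the planes JP\<close>

lemma smooth_fun_ratio:
  fixes a b f :: "('a, 'n) tpoint \<Rightarrow> real"
  assumes f: "smooth_fun TA (TM A) f" and a: "smooth_fun TA (TM A) a" and b: "smooth_fun TA (TM A) b"
    and pos: "\<And>u. u \<in> TM A \<Longrightarrow> b u \<noteq> 0"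
  shows "smooth_fun TA (TM A) (\<lambda>u. f u * (a u / b u))"
  unfolding smooth_fun_def
proof
  fix d assume d: "d \<in> TA"
  let ?S = "snd d ` (TM A \<inter> fst d)"
  have S: "open ?S"
    using T.open_chart_image[OF d] T.mcarrierI[OF d]
    unfolding mcarrier_tangent_atlas by (simp add: Int_absorb1 subsetI)
  have *: "smooth_on ?S (\<lambda>x. h (chart_inv d x))" if "smooth_fun TA (TM A) h" for h :: "('a, 'n) tpoint \<Rightarrow> real"
    using that d unfolding smooth_fun_def comp_def by blast
  have "smooth_on ?S (\<lambda>x. inverse (b (chart_inv d x)))"
  proof (rule smooth_on_inverse[OF S *[OF b]])
    show "b (chart_inv d x) \<noteq> 0" if "x \<in> ?S" for x
      using pos T.chart_inv_in[OF d that] by blast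
  qed
  from smooth_on_mult[OF S *[OF f] smooth_on_mult[OF S *[OF a] this]]
  show "smooth_on ?S ((\<lambda>u. f u * (a u / b u)) \<circ> chart_inv d)"
    unfolding comp_def divide_inverse .
qed

lemma smooth_fun_uminus:
  fixes f :: "('a, 'n) tpoint \<Rightarrow> real"
  shows "smooth_fun TA (TM A) f \<Longrightarrow> smooth_fun TA (TM A) (\<lambda>u. - f u)"
proof -
  assume f: "smooth_fun TA (TM A) f"
  have "smooth_fun TA (TM A) (\<lambda>u. f u * (- 1 / 1))"
    by (rule smooth_fun_ratio[OF f T.smooth_fun_const T.smooth_fun_const]) simp
  then show ?thesis by simp
qed

text \<open>Positivity of the weights makes each new coefficient vanish exactly when the old one it
  comes from does.\<close>

lemma J_coefficients_nonzero:
  assumes "u \<in> TM A" "f1 u \<noteq> 0 \<or> f2 u \<noteq> (0::real)"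
  shows "- (f2 u * (lam u / mu u)) \<noteq> 0 \<or> f1 u * (mu u / lam u) \<noteq> 0"
  using assms(2) weights_pos[OF assms(1)] by auto

theorem R_Lagrangian_J_mixed_plane_field:
  assumes f: "\<And>u. u \<in> TM A \<Longrightarrow> f1 u \<noteq> 0 \<or> f2 u \<noteq> 0"
  shows "R_Lagrangian_plane_field TA (fundamental_form g J) DIM('n) (\<lambda>u. J u ` mixed_plane A nabla f1 f2 u)"
  by (rule T.R_Lagrangian_plane_field_cong[OF R_Lagrangian_mixed_plane_field J_mixed_plane[symmetric]])
    (use J_coefficients_nonzero f in \<open>auto simp: mcarrier_tangent_atlas\<close>)

theorem R_Lagrangian_J_mixed_distribution:
  assumes f: "\<And>u. u \<in> TM A \<Longrightarrow> f1 u \<noteq> 0 \<or> f2 u \<noteq> 0"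
    and f12: "smooth_fun TA (TM A) f1" "smooth_fun TA (TM A) f2"
  shows "R_Lagrangian_distribution TA (fundamental_form g J) DIM('n) (\<lambda>u. J u ` mixed_plane A nabla f1 f2 u)"
proof (rule T.R_Lagrangian_distribution_cong[OF R_Lagrangian_mixed_distribution J_mixed_plane[symmetric]])
  show "smooth_fun TA (TM A) (\<lambda>u. - (f2 u * (lam u / mu u)))"
    by (rule smooth_fun_uminus, rule smooth_fun_ratio[OF f12(2) weights_smooth(2,1)])
      (use weights_pos in fastforce)
  show "smooth_fun TA (TM A) (\<lambda>u. f1 u * (mu u / lam u))"
    by (rule smooth_fun_ratio[OF f12(1) weights_smooth]) (use weights_pos in fastforce)
qed (use J_coefficients_nonzero f in \<open>auto simp: mcarrier_tangent_atlas\<close>)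

end

theorem proposition4p2:
  fixes A :: "('a, 'e::euclidean_space) atlas"
    and gM :: "'a \<Rightarrow> ('a, 'e) tvec \<Rightarrow> ('a, 'e) tvec \<Rightarrow> real"
    and nabla :: "('a \<Rightarrow> ('a, 'e) tvec) \<Rightarrow> ('a \<Rightarrow> ('a, 'e) tvec) \<Rightarrow> 'a \<Rightarrow> ('a, 'e) tvec"
    and mu lam :: "('a, 'e) tpoint \<Rightarrow> real"
    and g :: "('a, 'e) tpoint \<Rightarrow> (('a, 'e) tpoint, 'e \<times> 'e) tvec \<Rightarrow>
                (('a, 'e) tpoint, 'e \<times> 'e) tvec \<Rightarrow> real"
    and J :: "('a, 'e) tpoint \<Rightarrow> (('a, 'e) tpoint, 'e \<times> 'e) tvec \<Rightarrow>
                (('a, 'e) tpoint, 'e \<times> 'e) tvec"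
    and omega :: "('a, 'e) tpoint \<Rightarrow> (('a, 'e) tpoint, 'e \<times> 'e) tvec \<Rightarrow>
                (('a, 'e) tpoint, 'e \<times> 'e) tvec \<Rightarrow> real"
    and m :: nat
  assumes "smooth_manifold A" and "m = DIM('e)" and "m > 1"
    and "riemannian_metric A gM" and "levi_civita A gM nabla"
    and "radial_weight A gM mu" and "radial_weight A gM lam"
    and "weighted_metric A gM nabla mu lam g"
    and "weighted_complex_structure A nabla mu lam J"
    and "omega = fundamental_form g J"
  shows
    "(\<forall>f1 f2. (\<forall>u\<in>TM A. f1 u \<noteq> 0 \<or> f2 u \<noteq> 0) \<longrightarrow>
        R_Lagrangian_plane_field (tangent_atlas A) omega m (mixed_plane A nabla f1 f2) \<and>
        R_Lagrangian_plane_field (tangent_atlas A) omega m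
          (\<lambda>u. J u ` mixed_plane A nabla f1 f2 u)) \<and>
     (\<forall>f1 f2. (\<forall>u\<in>TM A. f1 u \<noteq> 0 \<or> f2 u \<noteq> 0) \<longrightarrow>
        smooth_fun (tangent_atlas A) (TM A) f1 \<longrightarrow> smooth_fun (tangent_atlas A) (TM A) f2 \<longrightarrow>
        R_Lagrangian_distribution (tangent_atlas A) omega m (mixed_plane A nabla f1 f2) \<and>
        R_Lagrangian_distribution (tangent_atlas A) omega m
          (\<lambda>u. J u ` mixed_plane A nabla f1 f2 u)) \<and>
     R_Lagrangian_distribution (tangent_atlas A) omega m (horizontal A nabla) \<and>
     R_Lagrangian_distribution (tangent_atlas A) omega m (vertical A) \<and>
     R_Lagrangian_submanifold (tangent_atlas A) omega m (zero_section A) \<and>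
     totally_geodesic (tangent_atlas A) g (zero_section A) \<and>
     (\<forall>p\<in>mcarrier A.
        R_Lagrangian_submanifold (tangent_atlas A) omega m (tangent_fibre A p) \<and>
        totally_geodesic (tangent_atlas A) g (tangent_fibre A p))"
proof -
  interpret smooth_atlas A
    by unfold_locales (use assms(1) in \<open>auto simp: smooth_manifold_def\<close>)
  interpret weighted_tangent_bundle A gM nabla mu lam g J
    by unfold_locales (fact assms)+
  show ?thesis
    unfolding assms(2) assms(10)
    by (intro conjI allI impI ballI R_Lagrangian_mixed_plane_field R_Lagrangian_J_mixed_plane_field
        R_Lagrangian_mixed_distribution R_Lagrangian_J_mixed_distribution R_Lagrangian_horizontal
        R_Lagrangian_vertical R_Lagrangian_zero_section R_Lagrangian_fibre
        totally_geodesic_zero_section totally_geodesic_fibre) auto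
qed

end
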